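(* Let $A\in\mathbb R^{n\times n}$ be symmetric positive definite, let $N$, $n_s$, $R_s$, $\tilde A_s$ ($s=1,\dots,N$) satisfy the local setting and let $V_0$, $R_0$ satisfy the coarse setting (both described in the context). Let $H$, $P_0$, $H_{hyb}$ be the corresponding operators, let $N^c$ be a coloring constant, and let $\tau>0$. In the following, $\lambda(B)$ denotes an arbitrary eigenvalue of the matrix $B$. 1. (Natural coarse space) Let $C_\sharp>0$ be a constant as defined in the context. If $R_s^\top \operatorname{Ker}(\tilde A_s)\subset V_0$ for every $s\in\{1,\dots,N\}$, then $$\lambda(HAP_0)\le N^c C_\sharp^{-1}\quad\text{and}\quad \lambda(H_{hyb}A)\le \max(1,N^cC_\sharp^{-1}).$$ 2. (GenEO for $\lambda_{\max}$) If $R_s^\top\mathcal Y_L(\tau,\tilde A_s,R_sAR_s^\top)\subset V_0$ for every $s\in\{1,\dots,N\}$, then $$\lambda(HAP_0)\le N^c\tau^{-1}\quad\text{and}\quad \lambda(H_{hyb}A)\le\max(1,N^c\tau^{-1}).$$ 3. (GenEO for $\lambda_{\min}$) Suppose the splitting assumption of the context (or its partition-of-unity version) holds with spsd matrices $M_s\in\mathbb R^{n_s\times n_s}$ and constant $\hat N_c>0$. Suppose that for every $s\in\{1,\dots,N\}$ at least one of the following holds: (a) $\tilde A_s$ is non-singular and $R_s^\top\mathcal Y_L(\tau^{-1},M_s,\tilde A_s)\subset V_0$; (b) $M_s$ is non-singular and $R_s^\top\left[\operatorname{Ker}(\tilde A_s)+\mathcal Y_H(\tau,\tilde A_s,M_s)\right]\subset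 V_0$; (c) $W_s\in\mathbb R^{n_s\times\operatorname{rank}(M_s)}$ is a matrix whose columns form an $\ell_2$-orthonormal basis of $\operatorname{range}(M_s)$ and $R_s^\top\left[\operatorname{Ker}(\tilde A_s)+\operatorname{Ker}(M_s)+W_s\,\mathcal Y_H(\tau,W_s^\top\tilde A_sW_s,W_s^\top M_sW_s)\right]\subset V_0$. Then $$\left(\lambda(HAP_0)=0\ \text{ or }\ (\tau\hat N_c)^{-1}\le\lambda(HAP_0)\right)\quad\text{and}\quad \min\left(1,(\tau\hat N_c)^{-1}\right)\le\lambda(H_{hyb}A).$$
   Context: Abbreviations: spd = symmetric positive definite, spsd = symmetric positive semi-definite. $B^\dagger$ is the Moore-Penrose pseudo-inverse. $\langle x,y\rangle=x^\top y$; for an spd matrix $B$, $\|x\|_B=\langle x,Bx\rangle^{1/2}$; for an spsd matrix $B$, $|x|_B=\langle x,Bx\rangle^{1/2}$ (a semi-norm). Local setting: $N\in\mathbb N$ is the number of subdomains, and for each $s\in\{1,\dots,N\}$, $n_s\in\mathbb N$, $R_s\in\mathbb R^{n_s\times n}$ and $\tilde A_s\in\mathbb R^{n_s\times n_s}$ are such that: $R_sR_s^\top=I$; $\mathbb R^n=\sum_{s=1}^N\operatorname{range}(R_s^\top)$; each $\tilde A_s$ is spsd; and the one-level preconditioner $H:=\sum_{s=1}^NR_s^\top\tilde A_s^\dagger R_s$ is non-singular (hence spd). Coarse setting: $V_0\subset\mathbb R^n$ is a subspace (the coarse space) and $R_0\in\mathbb R^{\dim(V_0)\times n}$ is a matrix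 whose rows form a basis of $V_0$, so $V_0=\operatorname{range}(R_0^\top)$. Operators: $P_0:=I-R_0^\top(R_0AR_0^\top)^{-1}R_0A$ (the $A$-orthogonal projection with $\operatorname{Ker}(P_0)=V_0$) and $H_{hyb}:=P_0HP_0^\top+R_0^\top(R_0AR_0^\top)^{-1}R_0$. Coloring constant: $N^c\in\mathbb N$ is such that there are subsets $\mathcal C_1,\dots,\mathcal C_{N^c}$ of $\{1,\dots,N\}$ with $\{1,\dots,N\}=\bigcup_{j}\mathcal C_j$ and, for each $j$ and all $s,t\in\mathcal C_j$ with $s\ne t$, $R_sAR_t^\top=0$. Splitting assumption: there are spsd matrices $M_s\in\mathbb R^{n_s\times n_s}$ ($s=1,\dots,N$) and a real $\hat N_c>0$ such that every $x\in\mathbb R^n$ can be written $x=\sum_{s=1}^NR_s^\top y_s$ with $y_s\in\mathbb R^{n_s}$ and $\sum_{s=1}^N\langle y_s,M_sy_s\rangle\le\hat N_c\langle x,Ax\rangle$. Partition-of-unity version (which implies the splitting assumption with $y_s=D_sR_sx$): there are spd matrices $D_s\in\mathbb R^{n_s\times n_s}$ with $I=\sum_{s=1}^NR_s^\top D_sR_s$, spsd matrices $M_s$, and $\hat N_c>0$ with $\sum_{s=1}^N\langle D_sR_sx,M_sD_sR_sx\rangle\le\hat N_c\langle x,Ax\rangle$ for every $x\in\mathbb R^n$. Spaces $\mathcal Y_L,\mathcal Y_H$: for $M_A\in\mathbb R^{m\times m}$ spsd, $M_B\in\mathbb R^{m\times m}$ spd and a scalar $\tau>0$, $\mathcal Y_L(\tau,M_A,M_B):=\operatorname{span}\{y: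 M_Ay=\lambda M_By\text{ with }\lambda<\tau\}$ and $\mathcal Y_H(\tau,M_A,M_B):=\operatorname{span}\{y: M_Ay=\lambda M_By\text{ with }\lambda\ge\tau\}$. Constant $C_\sharp$: $C_\sharp>0$ is such that for every $s=1,\dots,N$ and every $x_s\in\mathbb R^{n_s}$, $\|\tilde\Pi_sR_s^\top x_s\|_A^2\le C_\sharp^{-1}|x_s|_{\tilde A_s}^2$, where $\tilde\Pi_s$ is the $A$-orthogonal projection with $\operatorname{Ker}(\tilde\Pi_s)=R_s^\top\operatorname{Ker}(\tilde A_s)$ (the identity if $\tilde A_s$ is non-singular). *)

theory Defs
  imports
    "Jordan_Normal_Form.Gauss_Jordan_Elimination"
    "Jordan_Normal_Form.Matrix_Kernel"
    "Jordan_Normal_Form.DL_Rank"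
    "Jordan_Normal_Form.Spectral_Radius"
    "HOL-Library.Set_Algebras"
begin

definition spsd :: "nat \<Rightarrow> real mat \<Rightarrow> bool" where
  "spsd m B \<longleftrightarrow> B \<in> carrier_mat m m \<and> B\<^sup>T = B \<and>
     (\<forall>x \<in> carrier_vec m. 0 \<le> x \<bullet> (B *\<^sub>v x))"

definition spd :: "nat \<Rightarrow> real mat \<Rightarrow> bool" where
  "spd m B \<longleftrightarrow> B \<in> carrier_mat m m \<and> B\<^sup>T = B \<and>
     (\<forall>x \<in> carrier_vec m. x \<noteq> 0\<^sub>v m \<longrightarrow> 0 < x \<bullet> (B *\<^sub>v x))"

definition energy_norm :: "real mat \<Rightarrow> real vec \<Rightarrow> real" where
  "energy_norm B x = sqrt (x \<bullet> (B *\<^sub>v x))"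

text \<open>The Moore-Penrose pseudo-inverse is the unique matrix satisfying the four Penrose equations.\<close>

definition is_pinv :: "real mat \<Rightarrow> real mat \<Rightarrow> bool" where
  "is_pinv B X \<longleftrightarrow> X \<in> carrier_mat (dim_col B) (dim_row B) \<and>
     B * X * B = B \<and> X * B * X = X \<and> (B * X)\<^sup>T = B * X \<and> (X * B)\<^sup>T = X * B"

definition pinv :: "real mat \<Rightarrow> real mat" where
  "pinv B = (THE X. is_pinv B X)"

text \<open>Only used for invertible matrices, for which \<^const>\<open>mat_inverse\<close> is not \<^const>\<open>None\<close>.\<close>

definition minv :: "real mat \<Rightarrow> real mat" where
  "minv B = the (mat_inverse B)"

abbreviation sum_vecs :: "nat \<Rightarrow> (nat \<Rightarrow> real vec) \<Rightarrow> nat set \<Rightarrow> real vec" where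
  "sum_vecs n \<equiv> finsum_vec TYPE(real) n"

abbreviation sum_mats :: "nat \<Rightarrow> (nat \<Rightarrow> real mat) \<Rightarrow> nat set \<Rightarrow> real mat" where
  "sum_mats n \<equiv> finsum (module_mat TYPE(real) n n)"

abbreviation euclid :: "nat \<Rightarrow> (real, real vec) module" where
  "euclid n \<equiv> module_vec TYPE(real) n"

abbreviation lin_span :: "nat \<Rightarrow> real vec set \<Rightarrow> real vec set" where
  "lin_span n \<equiv> LinearCombinations.module.span class_ring (euclid n)"

definition is_subspace :: "nat \<Rightarrow> real vec set \<Rightarrow> bool" where
  "is_subspace n V \<longleftrightarrow> VectorSpace.subspace class_ring V (euclid n)"

definition sdim :: "nat \<Rightarrow> real vec set \<Rightarrow> nat" where
  "sdim n V = vectorspace.dim class_ring ((euclid n)\<lparr>carrier := V\<rparr>)"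

definition is_basis :: "nat \<Rightarrow> real vec set \<Rightarrow> real vec set \<Rightarrow> bool" where
  "is_basis n S V \<longleftrightarrow> S \<subseteq> V \<and>
     \<not> LinearCombinations.module.lin_dep class_ring (euclid n) S \<and> lin_span n S = V"

definition mat_range :: "real mat \<Rightarrow> real vec set" where
  "mat_range B = (\<lambda>y. B *\<^sub>v y) ` carrier_vec (dim_col B)"

text \<open>The eigenvalues of a real, possibly non-symmetric, matrix are a priori complex.\<close>

definition eigvals :: "real mat \<Rightarrow> complex set" where
  "eigvals B = spectrum (map_mat complex_of_real B)"

definition Y_L :: "real \<Rightarrow> real mat \<Rightarrow> real mat \<Rightarrow> real vec set" where
  "Y_L \<tau> MA MB = lin_span (dim_col MA)
     {y \<in> carrier_vec (dim_col MA). \<exists>l < \<tau>. MA *\<^sub>v y = l \<cdot>\<^sub>v (MB *\<^sub>v y)}"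

definition Y_H :: "real \<Rightarrow> real mat \<Rightarrow> real mat \<Rightarrow> real vec set" where
  "Y_H \<tau> MA MB = lin_span (dim_col MA)
     {y \<in> carrier_vec (dim_col MA). \<exists>l \<ge> \<tau>. MA *\<^sub>v y = l \<cdot>\<^sub>v (MB *\<^sub>v y)}"

definition is_orth_proj :: "nat \<Rightarrow> real mat \<Rightarrow> real vec set \<Rightarrow> real mat \<Rightarrow> bool" where
  "is_orth_proj n A K P \<longleftrightarrow> P \<in> carrier_mat n n \<and> P * P = P \<and> mat_kernel P = K \<and>
     (\<forall>x \<in> mat_kernel P. \<forall>y \<in> mat_range P. x \<bullet> (A *\<^sub>v y) = 0)"

definition one_level :: "nat \<Rightarrow> nat \<Rightarrow> (nat \<Rightarrow> real mat) \<Rightarrow> (nat \<Rightarrow> real mat) \<Rightarrow> real mat" where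
  "one_level n N R At = sum_mats n (\<lambda>s. (R s)\<^sup>T * pinv (At s) * R s) {1..N}"

definition local_setting ::
  "nat \<Rightarrow> nat \<Rightarrow> (nat \<Rightarrow> nat) \<Rightarrow> (nat \<Rightarrow> real mat) \<Rightarrow> (nat \<Rightarrow> real mat) \<Rightarrow> bool" where
  "local_setting n N ns R At \<longleftrightarrow>
     (\<forall>s \<in> {1..N}. R s \<in> carrier_mat (ns s) n \<and> R s * (R s)\<^sup>T = 1\<^sub>m (ns s) \<and> spsd (ns s) (At s)) \<and>
     carrier_vec n = {sum_vecs n (\<lambda>s. v s) {1..N} | v. \<forall>s \<in> {1..N}. v s \<in> mat_range ((R s)\<^sup>T)} \<and>
     invertible_mat (one_level n N R At)"

definition coarse_setting :: "nat \<Rightarrow> real vec set \<Rightarrow> real mat \<Rightarrow> bool" where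
  "coarse_setting n V0 R0 \<longleftrightarrow> is_subspace n V0 \<and>
     R0 \<in> carrier_mat (sdim n V0) n \<and> is_basis n (set (rows R0)) V0"

definition coarse_solve :: "real mat \<Rightarrow> real mat \<Rightarrow> real mat" where
  "coarse_solve A R0 = R0\<^sup>T * minv (R0 * A * R0\<^sup>T) * R0"

definition P0 :: "nat \<Rightarrow> real mat \<Rightarrow> real mat \<Rightarrow> real mat" where
  "P0 n A R0 = 1\<^sub>m n - coarse_solve A R0 * A"

definition hybrid :: "nat \<Rightarrow> real mat \<Rightarrow> real mat \<Rightarrow> real mat \<Rightarrow> real mat" where
  "hybrid n A R0 H = P0 n A R0 * H * (P0 n A R0)\<^sup>T + coarse_solve A R0"

definition coloring_constant ::
  "real mat \<Rightarrow> nat \<Rightarrow> (nat \<Rightarrow> nat) \<Rightarrow> (nat \<Rightarrow> real mat) \<Rightarrow> nat \<Rightarrow> bool" where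
  "coloring_constant A N ns R Nc \<longleftrightarrow>
     (\<exists>C :: nat \<Rightarrow> nat set. (\<forall>j \<in> {1..Nc}. C j \<subseteq> {1..N}) \<and> {1..N} = (\<Union>j \<in> {1..Nc}. C j) \<and>
        (\<forall>j \<in> {1..Nc}. \<forall>s \<in> C j. \<forall>t \<in> C j. s \<noteq> t \<longrightarrow> R s * A * (R t)\<^sup>T = 0\<^sub>m (ns s) (ns t)))"

text \<open>For positive definite \<open>A\<close> the projection \<open>P\<close> below exists and is unique;
  it is the identity if \<open>At s\<close> is non-singular.\<close>

definition C_sharp_constant ::
  "nat \<Rightarrow> real mat \<Rightarrow> nat \<Rightarrow> (nat \<Rightarrow> nat) \<Rightarrow> (nat \<Rightarrow> real mat) \<Rightarrow> (nat \<Rightarrow> real mat) \<Rightarrow> real \<Rightarrow> bool" where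
  "C_sharp_constant n A N ns R At Cs \<longleftrightarrow> 0 < Cs \<and>
     (\<forall>s \<in> {1..N}. \<exists>P. is_orth_proj n A ((\<lambda>y. (R s)\<^sup>T *\<^sub>v y) ` mat_kernel (At s)) P \<and>
        (\<forall>x \<in> carrier_vec (ns s).
           (energy_norm A (P *\<^sub>v ((R s)\<^sup>T *\<^sub>v x)))\<^sup>2 \<le> inverse Cs * (energy_norm (At s) x)\<^sup>2))"

definition splitting ::
  "nat \<Rightarrow> real mat \<Rightarrow> nat \<Rightarrow> (nat \<Rightarrow> nat) \<Rightarrow> (nat \<Rightarrow> real mat) \<Rightarrow> (nat \<Rightarrow> real mat) \<Rightarrow> real \<Rightarrow> bool" where
  "splitting n A N ns R M Nh \<longleftrightarrow>
     (\<forall>x \<in> carrier_vec n. \<exists>y. (\<forall>s \<in> {1..N}. y s \<in> carrier_vec (ns s)) \<and>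
        x = sum_vecs n (\<lambda>s. (R s)\<^sup>T *\<^sub>v y s) {1..N} \<and>
        (\<Sum>s \<in> {1..N}. y s \<bullet> (M s *\<^sub>v y s)) \<le> Nh * (x \<bullet> (A *\<^sub>v x)))"

definition pou_splitting ::
  "nat \<Rightarrow> real mat \<Rightarrow> nat \<Rightarrow> (nat \<Rightarrow> nat) \<Rightarrow> (nat \<Rightarrow> real mat) \<Rightarrow> (nat \<Rightarrow> real mat) \<Rightarrow> real \<Rightarrow> bool" where
  "pou_splitting n A N ns R M Nh \<longleftrightarrow>
     (\<exists>D. (\<forall>s \<in> {1..N}. spd (ns s) (D s)) \<and>
        1\<^sub>m n = sum_mats n (\<lambda>s. (R s)\<^sup>T * D s * R s) {1..N} \<and>
        (\<forall>x \<in> carrier_vec n.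
           (\<Sum>s \<in> {1..N}. (D s *\<^sub>v (R s *\<^sub>v x)) \<bullet> (M s *\<^sub>v (D s *\<^sub>v (R s *\<^sub>v x))))
             \<le> Nh * (x \<bullet> (A *\<^sub>v x))))"

definition orthonormal_basis_mat :: "nat \<Rightarrow> real vec set \<Rightarrow> real mat \<Rightarrow> bool" where
  "orthonormal_basis_mat m V W \<longleftrightarrow> is_basis m (set (cols W)) V \<and>
     (\<forall>i < dim_col W. \<forall>j < dim_col W. col W i \<bullet> col W j = (if i = j then 1 else 0))"

end

theory Submission
  imports Defs
    "Jordan_Normal_Form.Jordan_Normal_Form_Existence"
    "Jordan_Normal_Form.Jordan_Normal_Form_Uniqueness"
begin

text \<open>
  Both \<open>H A P\<^sub>0\<close> and \<open>H\<^sub>h\<^sub>y\<^sub>b A\<close> are self-adjoint for an inner product (given by \<open>H\<^sup>-\<^sup>1\<close> and \<open>A\<close>), so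
  their eigenvalues are real. Apart from the trivial eigenvalue (0, respectively 1), an eigenvalue
  is a Rayleigh quotient \<open>\<langle>A w, H A w\<rangle> / \<langle>w, A w\<rangle>\<close> of some \<open>w \<noteq> 0\<close> that is \<open>A\<close>-orthogonal to \<open>V\<^sub>0\<close>. Because
  of this orthogonality, local vectors may be changed by anything that \<open>R\<^sub>s\<^sup>T\<close> maps into \<open>V\<^sub>0\<close>, and the
  coarse space is chosen so that after such a change the local energies compare with constant
  \<open>C\<^sub>\<sharp>\<close> or \<open>\<tau>\<close>. The comparison comes from the spectral decomposition of the local generalized
  eigenproblem. Colouring (for \<open>\<lambda>\<^sub>m\<^sub>a\<^sub>x\<close>) or the splitting (for \<open>\<lambda>\<^sub>m\<^sub>i\<^sub>n\<close>) globalizes it.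
  In both bounds, expanding \<open>0 \<le> |x - a y|\<^sup>2\<close> with \<open>a\<close> the constant to be proved replaces Cauchy-Schwarz.
\<close>

section \<open>Self-adjoint operators\<close>

text \<open>All spectral facts come from one diagonalization over the reals. Eigenvalues that are a
  priori complex turn out to be real, so the characteristic polynomial splits and a real Jordan form
  exists; definiteness of the inner product leaves only blocks of size one. The resulting functional
  calculus yields both the pseudo-inverses and the splittings of local vectors. The obstacle is that
  the local matrices may be singular. For the upper bound it suffices that
  \<open>g \<bullet> (pinv B *\<^sub>v g)\<close> is the \<open>B\<close>-energy of
  \<open>pinv B *\<^sub>v g\<close>, which holds for every \<open>g\<close>. The lower bound has to
  solve \<open>B *\<^sub>v p = g\<close>, which requires \<open>g\<close> to be orthogonal to the
  kernel of \<open>B\<close>; this is why the kernels of singular local matrices are put into the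
  coarse space there. As for the constants, the upper bound multiplies the number of colours by the
  inverse of the local constant. The reciprocal of the lower bound multiplies the local loss \<tau>
  by the cost of the splitting.\<close>

lemma spsd_of_spd: "spd m B \<Longrightarrow> spsd m B"
  unfolding spd_def spsd_def
  by (metis carrier_matD(1) dual_order.refl less_le_not_le mult_mat_vec_carrier scalar_prod_left_zero)

lemma spd_eq_zero_iff:
  assumes "spd m B" "x \<in> carrier_vec m"
  shows "x \<bullet> (B *\<^sub>v x) = 0 \<longleftrightarrow> x = 0\<^sub>v m"
proof
  show "x = 0\<^sub>v m" if "x \<bullet> (B *\<^sub>v x) = 0"
    using assms that unfolding spd_def by (metis less_irrefl)
  show "x \<bullet> (B *\<^sub>v x) = 0" if "x = 0\<^sub>v m"
    using that assms mult_mat_vec_carrier[of B m m x] unfolding spd_def by simp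
qed

lemma mult_mat_zero_vec:
  fixes B :: "real mat"
  shows "B \<in> carrier_mat m k \<Longrightarrow> B *\<^sub>v 0\<^sub>v k = 0\<^sub>v m"
  by (rule eq_vecI) auto

lemma form_transpose:
  fixes B :: "real mat"
  assumes "B \<in> carrier_mat m k" "x \<in> carrier_vec m" "y \<in> carrier_vec k"
  shows "x \<bullet> (B *\<^sub>v y) = y \<bullet> (B\<^sup>T *\<^sub>v x)"
  using transpose_vec_mult_scalar[OF assms(1,3,2)] assms
  by (metis comm_scalar_prod mult_mat_vec_carrier transpose_carrier_mat)

lemma form_sym:
  fixes B :: "real mat"
  assumes "B \<in> carrier_mat m m" "B\<^sup>T = B" "x \<in> carrier_vec m" "y \<in> carrier_vec m"
  shows "x \<bullet> (B *\<^sub>v y) = y \<bullet> (B *\<^sub>v x)"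
  using form_transpose[OF assms(1,3,4)] assms(2) by simp

lemma scalar_prod_self_ge_0: "0 \<le> x \<bullet> (x :: real vec)"
  by (auto simp: scalar_prod_def intro: sum_nonneg)

lemma scalar_prod_self_eq_0:
  fixes x :: "real vec"
  assumes "x \<in> carrier_vec m" "x \<bullet> x = 0"
  shows "x = 0\<^sub>v m"
proof (rule eq_vecI)
  fix i assume "i < dim_vec (0\<^sub>v m)"
  moreover have "\<forall>i\<in>{0..<m}. x $ i * x $ i = 0"
    using assms by (subst sum_nonneg_eq_0_iff[symmetric]) (auto simp: scalar_prod_def)
  ultimately show "x $ i = 0\<^sub>v m $ i" by simp
qed (use assms in auto)

lemma spd_one: "spd m (1\<^sub>m m)"
  unfolding spd_def using scalar_prod_self_ge_0 scalar_prod_self_eq_0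
  by (auto simp: order_less_le)

text \<open>With \<open>r = B *\<^sub>v x\<close>, the energy of
  \<open>x + t \<cdot>\<^sub>v r\<close> has no constant term, and its linear term dominates for
  small negative \<open>t\<close>. Nonnegativity therefore forces \<open>r\<close> to
  vanish.\<close>

lemma spsd_form_zero:
  assumes B: "spsd m B" and x: "x \<in> carrier_vec m" and 0: "x \<bullet> (B *\<^sub>v x) = 0"
  shows "B *\<^sub>v x = 0\<^sub>v m"
proof -
  note [simp] = mult_mat_vec_carrier[of B m m] mult_add_distrib_mat_vec[of B m m] mult_mat_vec[of B m m]
    add_scalar_prod_distrib[of _ m] scalar_prod_add_distrib[of _ m]
  have Bc: "B \<in> carrier_mat m m" and Bs: "B\<^sup>T = B" using B by (auto simp: spsd_def)
  define r where "r = B *\<^sub>v x"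
  have r: "r \<in> carrier_vec m" unfolding r_def using Bc x by simp
  have xr: "x \<bullet> (B *\<^sub>v r) = r \<bullet> r" using form_sym[OF Bc Bs x r] r_def by simp
  define c where "c = r \<bullet> (B *\<^sub>v r)"
  have nn: "0 \<le> t * t * c + 2 * t * (r \<bullet> r)" for t
  proof -
    have "x + t \<cdot>\<^sub>v r \<in> carrier_vec m" using x r by simp
    hence "0 \<le> (x + t \<cdot>\<^sub>v r) \<bullet> (B *\<^sub>v (x + t \<cdot>\<^sub>v r))" using B unfolding spsd_def by blast
    also have "\<dots> = t * t * c + 2 * t * (r \<bullet> r)"
      using x r Bc 0 xr by (simp add: c_def r_def[symmetric] algebra_simps)
    finally show ?thesis .
  qed
  have rr: "r \<bullet> r \<ge> 0" by (rule scalar_prod_self_ge_0)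
  have "r \<bullet> r = 0"
  proof (rule ccontr)
    assume "r \<bullet> r \<noteq> 0"
    hence p: "r \<bullet> r > 0" using rr by simp
    have c: "c \<ge> 0" using B r unfolding c_def spsd_def by simp
    \<comment> \<open>A negative \<open>t\<close>, scaled so that
      \<open>t * c + 2 * (r \<bullet> r)\<close> stays positive; the added 1 avoids division by zero
      when \<open>c\<close> is 0.\<close>
    define t where "t = - (r \<bullet> r) / (c + 1)"
    have "t * c + 2 * (r \<bullet> r) = (r \<bullet> r) * ((c + 2) / (c + 1))"
      unfolding t_def using c by (simp add: field_simps)
    hence "t * c + 2 * (r \<bullet> r) > 0" using p c by simp
    moreover have "t < 0" unfolding t_def using p c by (simp add: divide_neg_pos)
    ultimately have "t * (t * c + 2 * (r \<bullet> r)) < 0" by (simp add: mult_neg_pos)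
    thus False using nn[of t] by (simp add: algebra_simps)
  qed
  thus ?thesis using r scalar_prod_self_eq_0 unfolding r_def by blast
qed

text \<open>Split a complex eigenvector into real and imaginary parts \<open>a\<close> and
  \<open>b\<close>. Symmetry of \<open>G * K\<close>, tested on this pair, cancels everything except
  the imaginary part \<open>q\<close> of the eigenvalue times the sum of the
  \<open>G\<close>-energies of \<open>a\<close> and \<open>b\<close>, and that sum is positive. A
  nonzero one among \<open>a\<close> and \<open>b\<close> is then a real eigenvector.\<close>

lemma selfadjoint_eigval_real:
  fixes K :: "real mat"
  assumes K: "K \<in> carrier_mat n n" and G: "spd n G" and GK: "(G * K)\<^sup>T = G * K"
    and z: "z \<in> eigvals K"
  shows "\<exists>l v. z = complex_of_real l \<and> v \<in> carrier_vec n \<and> v \<noteq> 0\<^sub>v n \<and> K *\<^sub>v v = l \<cdot>\<^sub>v v"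
proof -
  have Gc: "G \<in> carrier_mat n n" and Gs: "G\<^sup>T = G" using G by (auto simp: spd_def)
  note [simp] = mult_mat_vec_carrier[of K n n] mult_mat_vec_carrier[of G n n]
  from z K obtain v where v: "v \<in> carrier_vec n" "v \<noteq> 0\<^sub>v n"
    "map_mat complex_of_real K *\<^sub>v v = z \<cdot>\<^sub>v v"
    unfolding eigvals_def spectrum_def eigenvalue_def eigenvector_def by auto
  define a where "a = map_vec Re v"
  define b where "b = map_vec Im v"
  define p where "p = Re z"
  define q where "q = Im z"
  have a: "a \<in> carrier_vec n" and b: "b \<in> carrier_vec n" using v by (auto simp: a_def b_def)
  have idx: "row (map_mat complex_of_real K) i \<bullet> v = z * v $ i" if "i < n" for i
  proof -
    show ?thesis using arg_cong[OF v(3), of "\<lambda>w. w $ i"] that K v(1) by simp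
  qed
  have Ka: "K *\<^sub>v a = p \<cdot>\<^sub>v a - q \<cdot>\<^sub>v b"
  proof (rule eq_vecI)
    fix i assume "i < dim_vec (p \<cdot>\<^sub>v a - q \<cdot>\<^sub>v b)"
    hence i: "i < n" using a b by simp
    have "(K *\<^sub>v a) $ i = Re (row (map_mat complex_of_real K) i \<bullet> v)"
      using i K v by (simp add: scalar_prod_def a_def)
    thus "(K *\<^sub>v a) $ i = (p \<cdot>\<^sub>v a - q \<cdot>\<^sub>v b) $ i"
      unfolding idx[OF i] using i v by (simp add: a_def b_def p_def q_def)
  qed (use K a b in auto)
  have Kb: "K *\<^sub>v b = q \<cdot>\<^sub>v a + p \<cdot>\<^sub>v b"
  proof (rule eq_vecI)
    fix i assume "i < dim_vec (q \<cdot>\<^sub>v a + p \<cdot>\<^sub>v b)"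
    hence i: "i < n" using a b by simp
    have "(K *\<^sub>v b) $ i = Im (row (map_mat complex_of_real K) i \<bullet> v)"
      using i K v by (simp add: scalar_prod_def b_def)
    thus "(K *\<^sub>v b) $ i = (q \<cdot>\<^sub>v a + p \<cdot>\<^sub>v b) $ i"
      unfolding idx[OF i] using i v by (simp add: a_def b_def p_def q_def)
  qed (use K a b in auto)
  have ab: "a \<noteq> 0\<^sub>v n \<or> b \<noteq> 0\<^sub>v n"
  proof (rule ccontr)
    assume "\<not> ?thesis"
    hence e: "a = 0\<^sub>v n" "b = 0\<^sub>v n" by auto
    have "v = 0\<^sub>v n"
    proof (rule eq_vecI)
      fix i assume "i < dim_vec (0\<^sub>v n)"
      thus "v $ i = 0\<^sub>v n $ i" using arg_cong[OF e(1), of "\<lambda>w. w $ i"] arg_cong[OF e(2), of "\<lambda>w. w $ i"] v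
        by (simp add: a_def b_def complex_eq_iff)
    qed (use v in auto)
    thus False using v by simp
  qed
  have "b \<bullet> (G *\<^sub>v (K *\<^sub>v a)) = a \<bullet> (G *\<^sub>v (K *\<^sub>v b))"
    using form_sym[OF _ GK a b] Gc K a b by simp
  moreover have "b \<bullet> (G *\<^sub>v (K *\<^sub>v a)) = p * (b \<bullet> (G *\<^sub>v a)) - q * (b \<bullet> (G *\<^sub>v b))"
    unfolding Ka using Gc a b
    by (simp add: mult_minus_distrib_mat_vec[of G n n] mult_mat_vec[of G n n] scalar_prod_minus_distrib[of _ n])
  moreover have "a \<bullet> (G *\<^sub>v (K *\<^sub>v b)) = q * (a \<bullet> (G *\<^sub>v a)) + p * (a \<bullet> (G *\<^sub>v b))"
    unfolding Kb using Gc a b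
    by (simp add: mult_add_distrib_mat_vec[of G n n] mult_mat_vec[of G n n] scalar_prod_add_distrib[of _ n])
  moreover have "a \<bullet> (G *\<^sub>v b) = b \<bullet> (G *\<^sub>v a)" by (rule form_sym[OF Gc Gs a b])
  ultimately have 0: "q * (a \<bullet> (G *\<^sub>v a) + b \<bullet> (G *\<^sub>v b)) = 0" by (simp add: algebra_simps)
  have "a \<bullet> (G *\<^sub>v a) \<ge> 0" "b \<bullet> (G *\<^sub>v b) \<ge> 0"
    using spsd_of_spd[OF G] a b unfolding spsd_def by auto
  moreover have "a \<bullet> (G *\<^sub>v a) \<noteq> 0 \<or> b \<bullet> (G *\<^sub>v b) \<noteq> 0"
    using ab spd_eq_zero_iff[OF G a] spd_eq_zero_iff[OF G b] by simp
  ultimately have "q = 0" using 0 by auto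
  hence z: "z = complex_of_real p" and "K *\<^sub>v a = p \<cdot>\<^sub>v a" "K *\<^sub>v b = p \<cdot>\<^sub>v b"
    using Ka Kb a b by (auto simp: p_def q_def complex_eq_iff)
  thus ?thesis using ab a b by metis
qed

section \<open>Diagonalization over the reals\<close>

lemma selfadjoint_char_poly_splits:
  fixes K :: "real mat"
  assumes K: "K \<in> carrier_mat n n" and G: "spd n G" and GK: "(G * K)\<^sup>T = G * K"
  shows "\<exists>rs. char_poly K = (\<Prod>r\<leftarrow>rs. [:- r, 1:])"
proof -
  let ?K = "map_mat complex_of_real K"
  have Kc: "?K \<in> carrier_mat n n" using K by simp
  interpret h: map_poly_inj_idom_hom complex_of_real ..
  obtain as where as: "char_poly ?K = (\<Prod>a\<leftarrow>as. [:- a, 1:])" using char_poly_factorized[OF Kc] by blast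
  have re: "complex_of_real (Re a) = a" if "a \<in> set as" for a
  proof -
    have "poly (char_poly ?K) a = 0" unfolding as using that
      by (auto simp: poly_prod_list prod_list_zero_iff)
    hence "a \<in> eigvals K" unfolding eigvals_def spectrum_root_char_poly[OF Kc] by simp
    then obtain l where "a = complex_of_real l" using selfadjoint_eigval_real[OF K G GK] by blast
    thus ?thesis by simp
  qed
  \<comment> \<open>The complex factorization is the image of a real one under an injective map of
    polynomials, so it descends to the reals, as the existence of a real Jordan form
    requires.\<close>
  have "map_poly complex_of_real (char_poly K) = char_poly ?K"
    by (simp add: of_real_hom.char_poly_hom[OF K])
  also have "\<dots> = (\<Prod>r\<leftarrow>map Re as. [:- complex_of_real r, 1:])"
    unfolding as using re by (auto intro!: arg_cong[of _ _ prod_list] simp: o_def)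
  also have "\<dots> = map_poly complex_of_real (\<Prod>r\<leftarrow>map Re as. [:- r, 1:])"
    by (simp add: h.hom_prod_list o_def)
  finally have "char_poly K = (\<Prod>r\<leftarrow>map Re as. [:- r, 1:])" by simp
  thus ?thesis by blast
qed

lemma jordan_matrix_diagonal:
  fixes n_as :: "(nat \<times> real) list"
  assumes "\<forall>x \<in> set n_as. fst x = 1"
  shows "jordan_matrix n_as = mat_diag (length n_as) (\<lambda>i. snd (n_as ! i))"
  using assms
proof (induct n_as)
  case Nil
  show ?case by (rule eq_matI) (auto simp: jordan_matrix_def mat_diag_def)
next
  case (Cons x n_as)
  obtain a where x: "x = (1, a)" using Cons(2) by (cases x) auto
  have s: "sum_list (map fst n_as) = length n_as" using Cons(2)
    by (induct n_as) auto
  have "jordan_matrix n_as = mat_diag (length n_as) (\<lambda>i. snd (n_as ! i))" using Cons by simp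
  thus ?case unfolding x jordan_matrix_Cons s
    by (intro eq_matI) (auto simp: mat_diag_def jordan_block_def nth_Cons' four_block_mat_def Let_def)
qed

text \<open>A Jordan block of size at least two would give a vector that is killed by the square of
  \<open>C = char_matrix K e\<close> but not by \<open>C\<close>. Definiteness of \<open>G\<close>
  excludes this: if \<open>C * C\<close> kills \<open>v\<close>, symmetry of \<open>G * C\<close>
  makes the \<open>G\<close>-energy of \<open>C *\<^sub>v v\<close> zero.\<close>

lemma selfadjoint_diagonalizable:
  fixes K :: "real mat"
  assumes K: "K \<in> carrier_mat n n" and G: "spd n G" and GK: "(G * K)\<^sup>T = G * K"
  shows "\<exists>P Q l. similar_mat_wit K (mat_diag n l) P Q"
proof -
  have Gc: "G \<in> carrier_mat n n" and Gs: "G\<^sup>T = G" using G by (auto simp: spd_def)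
  obtain n_as where jnf: "jordan_nf K n_as"
    using selfadjoint_char_poly_splits[OF K G GK] jordan_nf_exists[OF K] by blast
  have one: "fst x = 1" if x: "x \<in> set n_as" for x
  proof -
    obtain k e where ke: "x = (k, e)" by (cases x)
    define C where "C = char_matrix K e"
    have C: "C \<in> carrier_mat n n" unfolding C_def using K by simp
    have GC: "(G * C)\<^sup>T = G * C"
    proof -
      have "G * C = G * K + (- e) \<cdot>\<^sub>m G" unfolding C_def char_matrix_def using K Gc
        by (simp add: mult_add_distrib_mat[of _ n n _ n] mult_smult_distrib[of _ n n _ n])
      moreover have "((- e) \<cdot>\<^sub>m G)\<^sup>T = (- e) \<cdot>\<^sub>m G\<^sup>T" by (rule eq_matI) auto
      ultimately show ?thesis using GK Gs K Gc by (simp add: transpose_add[of _ n n])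
    qed
    have ker: "mat_kernel (C * C) = mat_kernel C"
    proof (intro equalityI subsetI)
      fix v assume "v \<in> mat_kernel (C * C)"
      hence v: "v \<in> carrier_vec n" and "C *\<^sub>v (C *\<^sub>v v) = 0\<^sub>v n" using C unfolding mat_kernel_def by auto
      hence "(C *\<^sub>v v) \<bullet> (G * C *\<^sub>v v) = 0"
        using form_sym[OF _ GC, of n "C *\<^sub>v v" v] C Gc
        by (simp add: mult_mat_vec_carrier[of C n n] mult_mat_zero_vec[of G n n])
      hence "(C *\<^sub>v v) \<bullet> (G *\<^sub>v (C *\<^sub>v v)) = 0" using C Gc v by simp
      hence "C *\<^sub>v v = 0\<^sub>v n" using spd_eq_zero_iff[OF G] C v mult_mat_vec_carrier by blast
      thus "v \<in> mat_kernel C" using v C unfolding mat_kernel_def by auto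
    next
      fix v assume "v \<in> mat_kernel C"
      hence v: "v \<in> carrier_vec n" and "C *\<^sub>v v = 0\<^sub>v n" using C unfolding mat_kernel_def by auto
      thus "v \<in> mat_kernel (C * C)" using C mult_mat_zero_vec[OF C] unfolding mat_kernel_def by simp
    qed
    have pow: "C ^\<^sub>m 1 = C" "C ^\<^sub>m 2 = C * C" using C by (auto simp: numeral_2_eq_2)
    have dim: "dim_gen_eigenspace K e 1 = dim_gen_eigenspace K e 2"
      unfolding dim_gen_eigenspace_def C_def[symmetric] kernel_dim_def pow index_mult_mat(3) ker ..
    \<comment> \<open>A block of size \<open>n\<close> contributes \<open>min j n\<close> to the
      kernel of the \<open>j\<close>-th power, so equal kernels for the first two powers equate
      these sums.\<close>
    have eq: "(\<Sum>n\<leftarrow>map fst [(n, e') \<leftarrow> n_as. e' = e]. min 1 n) = (\<Sum>n\<leftarrow>map fst [(n, e') \<leftarrow> n_as. e' = e]. min 2 n)"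
      using dim unfolding dim_gen_eigenspace[OF jnf] .
    have pos: "0 \<notin> fst ` set n_as" using jnf unfolding jordan_nf_def by (rule conjunct1)
    have mem: "k \<in> set (map fst [(n, e') \<leftarrow> n_as. e' = e])"
      using x unfolding ke by (auto intro!: rev_image_eqI[of "(k, e)"])
    \<comment> \<open>The two sums are ordered term by term, so their equality forces equality in
      every block.\<close>
    have all: "(\<Sum>n\<leftarrow>xs. min 1 n) = (\<Sum>n\<leftarrow>xs. min 2 n) \<Longrightarrow> k \<in> set xs \<Longrightarrow> min 1 k = min 2 k"
      for xs :: "nat list"
    proof -
      have le: "(\<Sum>n\<leftarrow>ys. min 1 n) \<le> (\<Sum>n\<leftarrow>ys. min 2 n)" for ys :: "nat list"
        by (rule sum_list_mono) simp
      show "(\<Sum>n\<leftarrow>xs. min 1 n) = (\<Sum>n\<leftarrow>xs. min 2 n) \<Longrightarrow> k \<in> set xs \<Longrightarrow> min 1 k = min 2 k"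
      proof (induct xs)
        case (Cons y ys)
        have "min 1 y \<le> min 2 y" by simp
        with Cons le[of ys] show ?case by auto
      qed simp
    qed
    have "min 1 k = min 2 k" by (rule all[OF eq mem])
    moreover have "k \<noteq> 0" using pos imageI[OF x, of fst] unfolding ke fst_conv by metis
    ultimately show ?thesis unfolding ke by (cases k) auto
  qed
  obtain P Q where w: "similar_mat_wit K (jordan_matrix n_as) P Q"
    using jnf unfolding jordan_nf_def similar_mat_def by blast
  have d: "jordan_matrix n_as = mat_diag (length n_as) (\<lambda>i. snd (n_as ! i))"
    using jordan_matrix_diagonal one by blast
  have "jordan_matrix n_as \<in> carrier_mat n n"
    using similar_mat_witD(5)[OF _ w] carrier_matD(1)[OF K] by metis
  hence "length n_as = n" unfolding d mat_diag_def using carrier_matD(1) by fastforce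
  thus ?thesis using w d by metis
qed

section \<open>Functional calculus and generalized eigenproblems\<close>

lemma lin_span_add: "S \<subseteq> carrier_vec m \<Longrightarrow> x \<in> lin_span m S \<Longrightarrow> y \<in> lin_span m S \<Longrightarrow> x + y \<in> lin_span m S"
proof -
  interpret vec_space "TYPE(real)" m .
  show "S \<subseteq> carrier_vec m \<Longrightarrow> x \<in> lin_span m S \<Longrightarrow> y \<in> lin_span m S \<Longrightarrow> x + y \<in> lin_span m S"
    by (rule span_add1) auto
qed

lemma lin_span_smult: "S \<subseteq> carrier_vec m \<Longrightarrow> x \<in> lin_span m S \<Longrightarrow> c \<cdot>\<^sub>v x \<in> lin_span m S"
proof -
  interpret vec_space "TYPE(real)" m .
  show "S \<subseteq> carrier_vec m \<Longrightarrow> x \<in> lin_span m S \<Longrightarrow> c \<cdot>\<^sub>v x \<in> lin_span m S"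
    by (rule smult_in_span)
qed

lemma lin_span_zero: "0\<^sub>v m \<in> lin_span m S"
proof -
  interpret vec_space "TYPE(real)" m .
  show ?thesis by (rule in_spanI[of _ "\<lambda>_. 0" "{}"]) auto
qed

lemma lin_span_superset: "S \<subseteq> carrier_vec m \<Longrightarrow> x \<in> S \<Longrightarrow> x \<in> lin_span m S"
proof -
  interpret vec_space "TYPE(real)" m .
  show "S \<subseteq> carrier_vec m \<Longrightarrow> x \<in> S \<Longrightarrow> x \<in> lin_span m S"
    by (rule span_mem) auto
qed

lemma sum_vecs_carrier: "(\<And>i. i \<in> I \<Longrightarrow> f i \<in> carrier_vec m) \<Longrightarrow> sum_vecs m f I \<in> carrier_vec m"
  by (rule finsum_vec_closed) auto

lemma sum_vecs_insert:
  "finite I \<Longrightarrow> i \<notin> I \<Longrightarrow> (\<And>j. j \<in> insert i I \<Longrightarrow> f j \<in> carrier_vec m) \<Longrightarrow>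
    sum_vecs m f (insert i I) = f i + sum_vecs m f I"
  by (rule finsum_vec_insert) auto

lemma sum_vecs_induct:
  assumes "finite I" "\<And>i. i \<in> I \<Longrightarrow> f i \<in> carrier_vec m" "P (0\<^sub>v m)"
    "\<And>i x. i \<in> I \<Longrightarrow> x \<in> carrier_vec m \<Longrightarrow> P x \<Longrightarrow> P (f i + x)"
  shows "P (sum_vecs m f I)"
proof -
  have "J \<subseteq> I \<Longrightarrow> P (sum_vecs m f J)" if "finite J" for J
    using that
  proof (induct J)
    case empty
    show ?case using assms(3) by (simp add: finsum_vec_empty)
  next
    case (insert i J)
    have c: "f j \<in> carrier_vec m" if "j \<in> insert i J" for j using insert that assms(2) by auto
    have "sum_vecs m f J \<in> carrier_vec m" using c by (intro sum_vecs_carrier) auto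
    moreover have "sum_vecs m f (insert i J) = f i + sum_vecs m f J"
      by (rule sum_vecs_insert[OF insert(1,2)]) (use c in blast)
    ultimately show ?case using insert c assms(4) by simp
  qed
  thus ?thesis using assms(1) by blast
qed

lemma scalar_prod_sum_vecs:
  fixes f :: "nat \<Rightarrow> real vec"
  assumes "finite I" "\<And>i. i \<in> I \<Longrightarrow> f i \<in> carrier_vec m" "x \<in> carrier_vec m"
  shows "x \<bullet> sum_vecs m f I = (\<Sum>i\<in>I. x \<bullet> f i)"
  using assms(1,2)
proof (induct I)
  case (insert i I)
  show ?case using insert assms(3)
    by (subst sum_vecs_insert) (auto simp: scalar_prod_add_distrib[of _ m] sum_vecs_carrier)
qed (use assms(3) in \<open>simp add: finsum_vec_empty\<close>)

lemma mult_mat_sum_vecs: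
  fixes f :: "nat \<Rightarrow> real vec"
  assumes "finite I" "\<And>i. i \<in> I \<Longrightarrow> f i \<in> carrier_vec m" "B \<in> carrier_mat k m"
  shows "B *\<^sub>v sum_vecs m f I = sum_vecs k (\<lambda>i. B *\<^sub>v f i) I"
  using assms(1,2)
proof (induct I)
  case empty
  show ?case using mult_mat_zero_vec[OF assms(3)] by (simp add: finsum_vec_empty)
next
  case (insert i I)
  have c: "f j \<in> carrier_vec m" "B *\<^sub>v f j \<in> carrier_vec k" if "j \<in> insert i I" for j
    using insert that assms(3) by auto
  have "sum_vecs m f I \<in> carrier_vec m" using c by (intro sum_vecs_carrier) auto
  moreover have "sum_vecs m f (insert i I) = f i + sum_vecs m f I"
    "sum_vecs k (\<lambda>i. B *\<^sub>v f i) (insert i I) = B *\<^sub>v f i + sum_vecs k (\<lambda>i. B *\<^sub>v f i) I"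
    by (rule sum_vecs_insert[OF insert(1,2)]; use c in blast)+
  ultimately show ?case using insert(3) c assms(3)
    by (simp add: mult_add_distrib_mat_vec[of B k m])
qed

lemma sum_mats_carrier_mult:
  fixes F :: "nat \<Rightarrow> real mat"
  assumes "finite I" "\<And>i. i \<in> I \<Longrightarrow> F i \<in> carrier_mat m m"
  shows "sum_mats m F I \<in> carrier_mat m m"
    "x \<in> carrier_vec m \<Longrightarrow> sum_mats m F I *\<^sub>v x = sum_vecs m (\<lambda>i. F i *\<^sub>v x) I"
proof -
  interpret matrix_vs m m "TYPE(real)" .
  have c: "sum_mats m F J \<in> carrier_mat m m" if "finite J" "J \<subseteq> I" for J
  proof -
    have "F \<in> J \<rightarrow> carrier_mat m m" using assms(2) that by auto
    thus ?thesis by (rule finsum_closed)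
  qed
  show "sum_mats m F I \<in> carrier_mat m m" using c assms(1) by blast
  assume x: "x \<in> carrier_vec m"
  have "J \<subseteq> I \<Longrightarrow> sum_mats m F J *\<^sub>v x = sum_vecs m (\<lambda>i. F i *\<^sub>v x) J" if "finite J" for J
    using that
  proof (induct J)
    case empty
    have "0\<^sub>m m m *\<^sub>v x = 0\<^sub>v m" using x by (intro eq_vecI) auto
    thus ?case by (simp add: finsum_vec_empty)
  next
    case (insert i J)
    have Fc: "F \<in> J \<rightarrow> carrier_mat m m" "F i \<in> carrier_mat m m" using insert assms(2) by auto
    have "sum_mats m F (insert i J) = F i + sum_mats m F J"
      using finsum_insert[OF insert(1,2)] Fc by simp
    moreover have "sum_vecs m (\<lambda>i. F i *\<^sub>v x) (insert i J) = F i *\<^sub>v x + sum_vecs m (\<lambda>i. F i *\<^sub>v x) J"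
      by (rule sum_vecs_insert) (use insert assms(2) x in \<open>auto intro!: mult_mat_vec_carrier\<close>)
    ultimately show ?case using insert Fc c[of J] x by (simp add: add_mult_distrib_mat_vec[of _ m m])
  qed
  thus "sum_mats m F I *\<^sub>v x = sum_vecs m (\<lambda>i. F i *\<^sub>v x) I" using assms(1) by blast
qed

lemma mult_mat_vec_eq_sum_vecs:
  fixes P :: "real mat"
  assumes P: "P \<in> carrier_mat m k" and c: "c \<in> carrier_vec k"
  shows "P *\<^sub>v c = sum_vecs m (\<lambda>i. c $ i \<cdot>\<^sub>v col P i) {..<k}"
proof (rule eq_vecI)
  have cols: "col P i \<in> carrier_vec m" if "i < k" for i using P that by auto
  have S: "sum_vecs m (\<lambda>i. c $ i \<cdot>\<^sub>v col P i) {..<k} \<in> carrier_vec m"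
    using cols by (intro sum_vecs_carrier) auto
  show "dim_vec (P *\<^sub>v c) = dim_vec (sum_vecs m (\<lambda>i. c $ i \<cdot>\<^sub>v col P i) {..<k})" using P S by simp
  fix i assume "i < dim_vec (sum_vecs m (\<lambda>i. c $ i \<cdot>\<^sub>v col P i) {..<k})"
  hence i: "i < m" using S by simp
  have "sum_vecs m (\<lambda>i. c $ i \<cdot>\<^sub>v col P i) {..<k} $ i = unit_vec m i \<bullet> sum_vecs m (\<lambda>i. c $ i \<cdot>\<^sub>v col P i) {..<k}"
    using i S by simp
  also have "\<dots> = (\<Sum>j<k. c $ j * P $$ (i, j))"
    using cols i P by (subst scalar_prod_sum_vecs) auto
  also have "\<dots> = (P *\<^sub>v c) $ i" using i P c
    by (auto simp: scalar_prod_def mult.commute atLeast0LessThan intro!: sum.cong)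
  finally show "(P *\<^sub>v c) $ i = sum_vecs m (\<lambda>i. c $ i \<cdot>\<^sub>v col P i) {..<k} $ i" by simp
qed

lemma zero_smult_vec: "x \<in> carrier_vec m \<Longrightarrow> (0::real) \<cdot>\<^sub>v x = 0\<^sub>v m"
  by (rule eq_vecI) auto

text \<open>Columns with coefficient zero may lie outside \<open>S\<close>. This matters because a
  spectral projection annihilates the coefficients of the excluded eigenvectors.\<close>

lemma mult_mat_vec_in_span:
  fixes P :: "real mat"
  assumes P: "P \<in> carrier_mat m k" and c: "c \<in> carrier_vec k" and S: "S \<subseteq> carrier_vec m"
    and "\<And>i. i < k \<Longrightarrow> c $ i \<noteq> 0 \<Longrightarrow> col P i \<in> S"
  shows "P *\<^sub>v c \<in> lin_span m S"
  unfolding mult_mat_vec_eq_sum_vecs[OF P c]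
proof (rule sum_vecs_induct)
  show "0\<^sub>v m \<in> lin_span m S" by (rule lin_span_zero)
  fix i x assume i: "i \<in> {..<k}" and x: "x \<in> carrier_vec m" "x \<in> lin_span m S"
  have "col P i \<in> carrier_vec m" using P i by auto
  hence "0 \<cdot>\<^sub>v col P i = 0\<^sub>v m" by (rule zero_smult_vec)
  hence "c $ i \<cdot>\<^sub>v col P i \<in> lin_span m S"
    using lin_span_smult[OF S lin_span_superset[OF S assms(4)[of i]], of "c $ i"] i lin_span_zero[of m S]
    by (cases "c $ i = 0") auto
  thus "c $ i \<cdot>\<^sub>v col P i + x \<in> lin_span m S" using lin_span_add[OF S] x by blast
qed (use P in auto)

lemma mat_diag_mult_vec:
  fixes c :: "real vec"
  assumes "c \<in> carrier_vec m"
  shows "mat_diag m d *\<^sub>v c = vec m (\<lambda>i. d i * c $ i)"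
proof (rule eq_vecI)
  fix i assume "i < dim_vec (vec m (\<lambda>i. d i * c $ i))"
  hence i: "i < m" by simp
  have "(mat_diag m d *\<^sub>v c) $ i = (\<Sum>j = 0..<m. (if i = j then d j else 0) * c $ j)"
    using i assms by (simp add: mat_diag_def scalar_prod_def)
  also have "\<dots> = (\<Sum>j = 0..<m. if i = j then d j * c $ j else 0)" by (rule sum.cong) auto
  also have "\<dots> = d i * c $ i" using i by simp
  finally show "(mat_diag m d *\<^sub>v c) $ i = vec m (\<lambda>i. d i * c $ i) $ i" using i by simp
qed (simp add: mat_diag_def)

lemma smult_mat_mult_vec:
  fixes B :: "real mat"
  assumes "B \<in> carrier_mat m k" "x \<in> carrier_vec k"
  shows "(a \<cdot>\<^sub>m B) *\<^sub>v x = a \<cdot>\<^sub>v (B *\<^sub>v x)"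
  using assms by (intro eq_vecI) auto

text \<open>Functional calculus \<open>f \<mapsto> F f\<close> of an operator \<open>K\<close> that is self-adjoint for the inner
  product given by \<open>G\<close>.\<close>

locale selfadjoint_op =
  fixes m :: nat and K G P Q :: "real mat" and l :: "nat \<Rightarrow> real"
  assumes G: "spd m G" and K: "K \<in> carrier_mat m m" and GK: "(G * K)\<^sup>T = G * K"
    and wit: "similar_mat_wit K (mat_diag m l) P Q"
begin

definition F :: "(real \<Rightarrow> real) \<Rightarrow> real mat" where
  "F f = P * mat_diag m (\<lambda>i. f (l i)) * Q"

lemma Gc: "G \<in> carrier_mat m m" and Gs: "G\<^sup>T = G"
  using G by (auto simp: spd_def)

lemma P: "P \<in> carrier_mat m m" and Q: "Q \<in> carrier_mat m m" and PQ: "P * Q = 1\<^sub>m m"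
  and QP: "Q * P = 1\<^sub>m m" and K_eq: "K = P * mat_diag m l * Q"
  using similar_mat_witD[OF carrier_matD(1)[OF K, symmetric] wit] by blast+

lemma F_carrier[simp]: "F f \<in> carrier_mat m m"
  unfolding F_def using P Q by auto

lemma F_id: "F (\<lambda>x. x) = K"
  unfolding F_def K_eq ..

lemma F_one: "F (\<lambda>x. 1) = 1\<^sub>m m"
  unfolding F_def using P PQ by simp

lemma F_mult: "F f * F g = F (\<lambda>x. f x * g x)"
proof -
  have "F f * F g = P * mat_diag m (\<lambda>i. f (l i)) * (Q * P) * mat_diag m (\<lambda>i. g (l i)) * Q"
    unfolding F_def using P Q by (simp add: assoc_mult_mat[of _ m m _ m _ m] mult_carrier_mat[of _ m m _ m])
  also have "\<dots> = P * (mat_diag m (\<lambda>i. f (l i)) * mat_diag m (\<lambda>i. g (l i))) * Q"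
    unfolding QP using P Q by (simp add: left_mult_one_mat[of _ m m] assoc_mult_mat[of _ m m _ m _ m] mult_carrier_mat[of _ m m _ m] del: mat_diag_diag)
  finally show ?thesis unfolding F_def by simp
qed

lemma F_lin: "F (\<lambda>x. f x + a * g x) = F f + a \<cdot>\<^sub>m F g"
proof -
  have "mat_diag m (\<lambda>i. f (l i) + a * g (l i)) = mat_diag m (\<lambda>i. f (l i)) + a \<cdot>\<^sub>m mat_diag m (\<lambda>i. g (l i))"
    by (rule eq_matI) (auto simp: mat_diag_def)
  thus ?thesis unfolding F_def using P Q
    by (simp add: mult_add_distrib_mat[of _ m m _ m] add_mult_distrib_mat[of _ m m _ _ m]
        mult_smult_distrib[of _ m m _ m] mult_smult_assoc_mat[of _ m m _ m])
qed

text \<open>The Gram matrix of the eigenvectors commutes with the eigenvalue matrix, hence has no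
  entries between distinct eigenvalues and commutes with every function of the eigenvalue matrix.\<close>

lemma F_selfadjoint: "(G * F f)\<^sup>T = G * F f"
proof -
  define T where "T = P\<^sup>T * G * P"
  have T: "T \<in> carrier_mat m m" unfolding T_def using P Gc by simp
  have Ts: "T\<^sup>T = T" unfolding T_def using P Gc Gs
    by (simp add: transpose_mult[of _ m m _ m] assoc_mult_mat[of _ m m _ m _ m] mult_carrier_mat[of _ m m _ m])
  have GF: "P\<^sup>T * (G * F g) * P = T * mat_diag m (\<lambda>i. g (l i))" for g
  proof -
    have "P\<^sup>T * (G * F g) * P = T * mat_diag m (\<lambda>i. g (l i)) * (Q * P)"
      unfolding F_def T_def using P Q Gc by (simp add: assoc_mult_mat[of _ m m _ m _ m] mult_carrier_mat[of _ m m _ m])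
    thus ?thesis using T QP by (simp add: right_mult_one_mat[of _ m m])
  qed
  have sym: "(P\<^sup>T * X * P)\<^sup>T = P\<^sup>T * X\<^sup>T * P" if "X \<in> carrier_mat m m" for X
    using that P by (simp add: transpose_mult[of _ m m _ m] assoc_mult_mat[of _ m m _ m _ m] mult_carrier_mat[of _ m m _ m])
  have Dt: "(mat_diag m d)\<^sup>T = mat_diag m d" for d :: "nat \<Rightarrow> real"
    by (rule eq_matI) (auto simp: mat_diag_def)
  have "(T * mat_diag m l)\<^sup>T = T * mat_diag m l"
    using sym[of "G * K"] GK GF[of "\<lambda>x. x"] Gc K unfolding F_id by simp
  hence com: "mat_diag m l * T = T * mat_diag m l"
    using T Ts Dt by (simp add: transpose_mult[of _ m m _ m])
  have com_f: "mat_diag m (\<lambda>i. f (l i)) * T = T * mat_diag m (\<lambda>i. f (l i))"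
  proof (rule eq_matI)
    fix i j assume "i < dim_row (T * mat_diag m (\<lambda>i. f (l i)))" "j < dim_col (T * mat_diag m (\<lambda>i. f (l i)))"
    hence i: "i < m" and j: "j < m" using T by (auto simp: mat_diag_def)
    have "l i * T $$ (i,j) = T $$ (i,j) * l j"
      using arg_cong[OF com, of "\<lambda>X. X $$ (i,j)"] i j T by (simp add: mat_diag_mult_left mat_diag_mult_right)
    hence "l i = l j \<or> T $$ (i,j) = 0" by auto
    thus "(mat_diag m (\<lambda>i. f (l i)) * T) $$ (i,j) = (T * mat_diag m (\<lambda>i. f (l i))) $$ (i,j)"
      using i j T by (auto simp: mat_diag_mult_left mat_diag_mult_right)
  qed (use T in \<open>auto simp: mat_diag_def\<close>)
  have "P\<^sup>T * (G * F f)\<^sup>T * P = P\<^sup>T * (G * F f) * P"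
    using sym[of "G * F f"] Gc unfolding GF using com_f T Ts Dt by (simp add: transpose_mult[of _ m m _ m])
  hence "Q\<^sup>T * (P\<^sup>T * (G * F f)\<^sup>T * P) * Q = Q\<^sup>T * (P\<^sup>T * (G * F f) * P) * Q" by simp
  moreover have "Q\<^sup>T * (P\<^sup>T * X * P) * Q = X" if X: "X \<in> carrier_mat m m" for X
  proof -
    have "Q\<^sup>T * (P\<^sup>T * X * P) * Q = (P * Q)\<^sup>T * X * (P * Q)"
      using X P Q by (simp add: transpose_mult[of _ m m _ m] assoc_mult_mat[of _ m m _ m _ m] mult_carrier_mat[of _ m m _ m])
    thus ?thesis unfolding PQ using X by simp
  qed
  ultimately show ?thesis using Gc by simp
qed

lemma eigvec: 
  assumes "i < m"
  shows "col P i \<in> carrier_vec m" "col P i \<noteq> 0\<^sub>v m" "K *\<^sub>v col P i = l i \<cdot>\<^sub>v col P i"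
proof -
  show c: "col P i \<in> carrier_vec m" using P assms by auto
  have "Q *\<^sub>v col P i = col (Q * P) i" by (rule col_mult2[symmetric]) (use P Q assms in auto)
  also have "\<dots> = unit_vec m i" unfolding QP using assms by simp
  finally have "Q *\<^sub>v col P i = unit_vec m i" .
  thus "col P i \<noteq> 0\<^sub>v m" using mult_mat_zero_vec[OF Q] assms unit_vec_nonzero[of i m] by metis
  have KP: "K * P = P * mat_diag m l"
    unfolding K_eq using P Q QP by (simp add: right_mult_one_mat[of _ m m] assoc_mult_mat[of _ m m _ m _ m] mult_carrier_mat[of _ m m _ m])
  have "K *\<^sub>v col P i = col (K * P) i" by (rule col_mult2[symmetric]) (use P K assms in auto)
  also have "\<dots> = l i \<cdot>\<^sub>v col P i" unfolding KP using P assms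
    by (intro eq_vecI) (auto simp: mat_diag_mult_right)
  finally show "K *\<^sub>v col P i = l i \<cdot>\<^sub>v col P i" .
qed

text \<open>In the eigenbasis given by \<open>P\<close>, the coordinates of
  \<open>F f *\<^sub>v y\<close> are those of \<open>y\<close> multiplied by \<open>f (l i)\<close>.
  An indicator function \<open>f\<close> thus projects onto the span of the selected
  eigenvectors.\<close>

lemma F_in_span:
  assumes y: "y \<in> carrier_vec m" and S: "S \<subseteq> carrier_vec m"
    and "\<And>i. i < m \<Longrightarrow> f (l i) \<noteq> 0 \<Longrightarrow> col P i \<in> S"
  shows "F f *\<^sub>v y \<in> lin_span m S"
proof -
  have Qy: "Q *\<^sub>v y \<in> carrier_vec m" using Q y by simp
  define c where "c = mat_diag m (\<lambda>i. f (l i)) *\<^sub>v (Q *\<^sub>v y)"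
  have c: "c \<in> carrier_vec m" unfolding c_def by (rule mult_mat_vec_carrier[OF mat_diag_dim Qy])
  have F: "F f *\<^sub>v y = P *\<^sub>v c" unfolding F_def c_def using P Q y Qy
    by (simp add: assoc_mult_mat_vec[of _ m m _ m] mult_mat_vec_carrier[of _ m m] mult_carrier_mat[of _ m m _ m])
  have "c $ i = f (l i) * (Q *\<^sub>v y) $ i" if "i < m" for i
    unfolding c_def mat_diag_mult_vec[OF Qy] using that by simp
  thus ?thesis unfolding F by (intro mult_mat_vec_in_span[OF P c S]) (use assms(3) in auto)
qed

text \<open>Self-adjointness moves \<open>F f\<close> across the form, where it merges with
  \<open>F g\<close>. The energy of a spectral part of \<open>y\<close> thereby becomes a form in
  \<open>y\<close> itself.\<close>

lemma form_F_F:
  assumes y: "y \<in> carrier_vec m"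
  shows "(F f *\<^sub>v y) \<bullet> (G *\<^sub>v (F g *\<^sub>v y)) = y \<bullet> (G *\<^sub>v (F (\<lambda>x. f x * g x) *\<^sub>v y))"
proof -
  have c: "F g *\<^sub>v y \<in> carrier_vec m" "F f *\<^sub>v y \<in> carrier_vec m"
    using y by (auto intro!: mult_mat_vec_carrier)
  have "(F f *\<^sub>v y) \<bullet> (G *\<^sub>v (F g *\<^sub>v y)) = (F g *\<^sub>v y) \<bullet> (G * F f *\<^sub>v y)"
    using form_sym[OF Gc Gs c(2,1)] Gc y by (simp add: assoc_mult_mat_vec[of _ m m _ m] mult_mat_vec_carrier[of _ m m] mult_carrier_mat[of _ m m _ m])
  also have "\<dots> = y \<bullet> (G * F f *\<^sub>v (F g *\<^sub>v y))"
    by (rule form_sym[OF _ F_selfadjoint]) (use Gc c y in auto)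
  also have "G * F f *\<^sub>v (F g *\<^sub>v y) = G *\<^sub>v ((F f * F g) *\<^sub>v y)"
    using Gc c y by (simp add: assoc_mult_mat_vec[of _ m m _ m] mult_mat_vec_carrier[of _ m m] mult_carrier_mat[of _ m m _ m])
  finally show ?thesis unfolding F_mult .
qed

lemma F_cong: "(\<And>i. i < m \<Longrightarrow> f (l i) = g (l i)) \<Longrightarrow> F f = F g"
proof -
  assume "\<And>i. i < m \<Longrightarrow> f (l i) = g (l i)"
  hence "mat_diag m (\<lambda>i. f (l i)) = mat_diag m (\<lambda>i. g (l i))" by (intro eq_matI) (auto simp: mat_diag_def)
  thus "F f = F g" unfolding F_def by simp
qed

text \<open>On the spectrum \<open>f\<close> is the square of its root, which makes the form a
  \<open>G\<close>-energy. Off the spectrum \<open>f\<close> may be negative, as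
  \<open>F_cong\<close> compares functions on the spectrum only.\<close>

lemma form_F_nonneg:
  assumes y: "y \<in> carrier_vec m" and f: "\<And>i. i < m \<Longrightarrow> 0 \<le> f (l i)"
  shows "0 \<le> y \<bullet> (G *\<^sub>v (F f *\<^sub>v y))"
proof -
  have "F f = F (\<lambda>x. sqrt (f x) * sqrt (f x))" using f by (intro F_cong) auto
  hence "y \<bullet> (G *\<^sub>v (F f *\<^sub>v y)) = (F (\<lambda>x. sqrt (f x)) *\<^sub>v y) \<bullet> (G *\<^sub>v (F (\<lambda>x. sqrt (f x)) *\<^sub>v y))"
    using form_F_F[OF y] by simp
  also have "\<dots> \<ge> 0" using spsd_of_spd[OF G] mult_mat_vec_carrier[OF F_carrier y] unfolding spsd_def by blast
  finally show ?thesis .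
qed

text \<open>Pointwise inequalities on the spectrum become energy inequalities by applying positivity
  to the difference \<open>h\<close>.\<close>

lemma form_F_mono:
  assumes y: "y \<in> carrier_vec m" and fg: "\<And>i. i < m \<Longrightarrow> f (l i) \<le> a * g (l i)"
  shows "y \<bullet> (G *\<^sub>v (F f *\<^sub>v y)) \<le> a * (y \<bullet> (G *\<^sub>v (F g *\<^sub>v y)))"
proof -
  have c: "F h *\<^sub>v y \<in> carrier_vec m" for h using y by (auto intro!: mult_mat_vec_carrier)
  define h where "h = (\<lambda>x. a * g x - f x)"
  have nn: "0 \<le> y \<bullet> (G *\<^sub>v (F h *\<^sub>v y))" by (rule form_F_nonneg[OF y]) (use fg h_def in auto)
  \<comment> \<open>The terms \<open>1 * f x\<close> and \<open>0 * g x\<close> bring both sides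
    into the shape of \<open>F_lin\<close>, so that this one rule yields the sum as well as the pure
    multiple.\<close>
  have "F (\<lambda>x. h x + 1 * f x) = F (\<lambda>x. 0 * g x + a * g x)"
    by (rule F_cong) (auto simp: h_def)
  hence e: "F h + 1 \<cdot>\<^sub>m F f = F (\<lambda>x. 0 * g x) + a \<cdot>\<^sub>m F g" unfolding F_lin .
  have "mat_diag m (\<lambda>i. 0 * g (l i)) = 0\<^sub>m m m" by (rule eq_matI) (auto simp: mat_diag_def)
  hence z: "F (\<lambda>x. 0 * g x) = 0\<^sub>m m m" unfolding F_def using P Q by simp
  have "F h *\<^sub>v y + F f *\<^sub>v y = (F h + 1 \<cdot>\<^sub>m F f) *\<^sub>v y"
    using y by (simp add: add_mult_distrib_mat_vec[of _ m m] smult_mat_mult_vec[of _ m m])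
  also have "\<dots> = a \<cdot>\<^sub>v (F g *\<^sub>v y)"
    unfolding e z using y by (simp add: smult_mat_mult_vec[of _ m m])
  finally have "y \<bullet> (G *\<^sub>v (F h *\<^sub>v y + F f *\<^sub>v y)) = y \<bullet> (G *\<^sub>v (a \<cdot>\<^sub>v (F g *\<^sub>v y)))" by simp
  hence "y \<bullet> (G *\<^sub>v (F h *\<^sub>v y)) + y \<bullet> (G *\<^sub>v (F f *\<^sub>v y)) = a * (y \<bullet> (G *\<^sub>v (F g *\<^sub>v y)))"
    using c y Gc by (simp add: mult_add_distrib_mat_vec[of G m m] mult_mat_vec[of G m m]
      scalar_prod_add_distrib[of _ m] mult_mat_vec_carrier[of G m m])
  with nn show ?thesis by linarith
qed

end

section \<open>Splitting a vector along a generalized eigenproblem\<close>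

lemma spd_has_inverse:
  assumes "spd m B"
  shows "\<exists>C. C \<in> carrier_mat m m \<and> B * C = 1\<^sub>m m \<and> C * B = 1\<^sub>m m"
proof -
  have B: "B \<in> carrier_mat m m" using assms by (simp add: spd_def)
  have "det B \<noteq> 0"
  proof
    assume "det B = 0"
    then obtain v where v: "v \<in> carrier_vec m" "v \<noteq> 0\<^sub>v m" "B *\<^sub>v v = 0\<^sub>v m"
      using det_0_iff_vec_prod_zero_field[OF B] by blast
    have "0 < v \<bullet> (B *\<^sub>v v)" using assms v(1,2) unfolding spd_def by blast
    thus False unfolding v(3) using v(1) by simp
  qed
  hence "B \<in> Units (ring_mat TYPE(real) m ())" by (rule det_non_zero_imp_unit[OF B])
  thus ?thesis unfolding Units_def ring_mat_simps by blast
qed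

text \<open>Multiplying \<open>MA\<close> by the inverse of \<open>MB\<close> gives an operator
  \<open>K\<close> that is self-adjoint for \<open>MB\<close>. The indicator functions
  \<open>f\<close> and \<open>g\<close> of the spectrum below \<tau> and from \<tau> on produce
  \<open>k\<close> and \<open>h\<close>. The two estimates are the pointwise bounds
  \<open>g x \<le> x / \<tau>\<close> and \<open>x * f x \<le> \<tau>\<close>, valid on the spectrum
  because the eigenvalues are nonnegative.\<close>

lemma generalized_eigen_split:
  assumes MA: "spsd m MA" and MB: "spd m MB" and tau: "\<tau> > 0" and y: "y \<in> carrier_vec m"
  shows "\<exists>k h. k \<in> carrier_vec m \<and> h \<in> carrier_vec m \<and> k \<in> Y_L \<tau> MA MB \<and> h \<in> Y_H \<tau> MA MB \<and> y = k + h \<and>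
    \<tau> * (h \<bullet> (MB *\<^sub>v h)) \<le> y \<bullet> (MA *\<^sub>v y) \<and> k \<bullet> (MA *\<^sub>v k) \<le> \<tau> * (y \<bullet> (MB *\<^sub>v y))"
proof -
  have MAc: "MA \<in> carrier_mat m m" and MAs: "MA\<^sup>T = MA" using MA by (auto simp: spsd_def)
  have MBc: "MB \<in> carrier_mat m m" and MBs: "MB\<^sup>T = MB" using MB by (auto simp: spd_def)
  obtain C where C: "C \<in> carrier_mat m m" "MB * C = 1\<^sub>m m"
    using spd_has_inverse[OF MB] by blast
  define K where "K = C * MA"
  have K: "K \<in> carrier_mat m m" unfolding K_def using C MAc by simp
  have MBK: "MB * K = MA" unfolding K_def using C MBc MAc by (simp add: assoc_mult_mat[of MB m m C m MA m, symmetric])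
  hence sym: "(MB * K)\<^sup>T = MB * K" using MAs by simp
  obtain P Q l where wit: "similar_mat_wit K (mat_diag m l) P Q"
    using selfadjoint_diagonalizable[OF K MB sym] by blast
  interpret selfadjoint_op m K MB P Q l by unfold_locales (fact MB K sym wit)+
  have MAv: "MA *\<^sub>v v = MB *\<^sub>v (K *\<^sub>v v)" if "v \<in> carrier_vec m" for v
    unfolding MBK[symmetric] by (rule assoc_mult_mat_vec[OF MBc K that])
  have eig: "MA *\<^sub>v col P i = l i \<cdot>\<^sub>v (MB *\<^sub>v col P i)" if "i < m" for i
    unfolding MAv[OF eigvec(1)[OF that]] eigvec(3)[OF that] by (rule mult_mat_vec[OF MBc eigvec(1)[OF that]])
  have l0: "0 \<le> l i" if "i < m" for i
  proof -
    have "0 \<le> col P i \<bullet> (MA *\<^sub>v col P i)" using MA eigvec(1)[OF that] unfolding spsd_def by blast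
    also have "\<dots> = l i * (col P i \<bullet> (MB *\<^sub>v col P i))"
      unfolding eig[OF that] using eigvec(1)[OF that] MBc by (simp add: mult_mat_vec_carrier[of MB m m])
    finally have "0 \<le> l i * (col P i \<bullet> (MB *\<^sub>v col P i))" .
    moreover have "0 < col P i \<bullet> (MB *\<^sub>v col P i)" using eigvec(1,2)[OF that] MB unfolding spd_def by blast
    ultimately show ?thesis by (simp add: zero_le_mult_iff)
  qed
  define f where "f = (\<lambda>x::real. if x < \<tau> then 1 else 0 :: real)"
  define g where "g = (\<lambda>x::real. if x < \<tau> then 0 else 1 :: real)"
  define k where "k = F f *\<^sub>v y"
  define h where "h = F g *\<^sub>v y"
  have kc: "k \<in> carrier_vec m" and hc: "h \<in> carrier_vec m"
    unfolding k_def h_def using y by (auto intro!: mult_mat_vec_carrier)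
  have "F (\<lambda>x. f x + 1 * g x) = F (\<lambda>x. 1)" by (rule F_cong) (auto simp: f_def g_def)
  hence "F f + 1 \<cdot>\<^sub>m F g = 1\<^sub>m m" unfolding F_lin F_one .
  hence "(F f + 1 \<cdot>\<^sub>m F g) *\<^sub>v y = y" using one_mult_mat_vec[OF y] by metis
  hence ykh: "y = k + h" unfolding k_def h_def using y
    by (simp add: add_mult_distrib_mat_vec[of _ m m] smult_mat_mult_vec[of _ m m])
  have kL: "k \<in> Y_L \<tau> MA MB" unfolding Y_L_def k_def carrier_matD(2)[OF MAc]
  proof (rule F_in_span[OF y])
    fix i assume i: "i < m" and "f (l i) \<noteq> 0"
    hence "l i < \<tau>" unfolding f_def by (simp split: if_splits)
    thus "col P i \<in> {y \<in> carrier_vec m. \<exists>l<\<tau>. MA *\<^sub>v y = l \<cdot>\<^sub>v (MB *\<^sub>v y)}"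
      using eigvec(1)[OF i] eig[OF i] by blast
  qed blast
  have hH: "h \<in> Y_H \<tau> MA MB" unfolding Y_H_def h_def carrier_matD(2)[OF MAc]
  proof (rule F_in_span[OF y])
    fix i assume i: "i < m" and "g (l i) \<noteq> 0"
    hence "l i \<ge> \<tau>" unfolding g_def by (simp split: if_splits)
    thus "col P i \<in> {y \<in> carrier_vec m. \<exists>l\<ge>\<tau>. MA *\<^sub>v y = l \<cdot>\<^sub>v (MB *\<^sub>v y)}"
      using eigvec(1)[OF i] eig[OF i] by blast
  qed blast
  have 1: "h \<bullet> (MB *\<^sub>v h) \<le> inverse \<tau> * (y \<bullet> (MA *\<^sub>v y))"
    unfolding h_def form_F_F[OF y] MAv[OF y] F_id[symmetric]
    by (rule form_F_mono[OF y]) (use l0 tau g_def in \<open>auto simp: field_simps\<close>)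
  have Kk: "K *\<^sub>v k = F (\<lambda>x. x * f x) *\<^sub>v y"
    unfolding k_def F_mult[symmetric] F_id using y K
    by (simp add: assoc_mult_mat_vec[of _ m m _ m] mult_mat_vec_carrier[of _ m m] mult_carrier_mat[of _ m m _ m])
  have "k \<bullet> (MA *\<^sub>v k) = (F f *\<^sub>v y) \<bullet> (MB *\<^sub>v (F (\<lambda>x. x * f x) *\<^sub>v y))"
    unfolding MAv[OF kc] Kk by (simp add: k_def)
  also have "\<dots> \<le> \<tau> * (y \<bullet> (MB *\<^sub>v (F (\<lambda>x. 1) *\<^sub>v y)))"
    unfolding form_F_F[OF y]
    by (rule form_F_mono[OF y]) (use l0 tau f_def in auto)
  also have "F (\<lambda>x. 1) *\<^sub>v y = y" using y by (simp add: F_one)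
  finally have 2: "k \<bullet> (MA *\<^sub>v k) \<le> \<tau> * (y \<bullet> (MB *\<^sub>v y))" .
  have 1: "\<tau> * (h \<bullet> (MB *\<^sub>v h)) \<le> y \<bullet> (MA *\<^sub>v y)" using 1 tau by (simp add: field_simps)
  show ?thesis using kc hc kL hH ykh 1 2 by blast
qed

section \<open>The Moore-Penrose inverse\<close>

lemma is_pinv_unique:
  assumes "is_pinv B X" "is_pinv B Y"
  shows "X = Y"
proof -
  define r c where "r = dim_row B" and "c = dim_col B"
  have B: "B \<in> carrier_mat r c" and X: "X \<in> carrier_mat c r" and Y: "Y \<in> carrier_mat c r"
    using assms unfolding is_pinv_def r_def c_def by auto
  note x = assms(1)[unfolded is_pinv_def] and y = assms(2)[unfolded is_pinv_def]
  have BXr: "B * X \<in> carrier_mat r r" "B * Y \<in> carrier_mat r r" "X * B \<in> carrier_mat c c" "Y * B \<in> carrier_mat c c"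
    using B X Y by auto
  \<comment> \<open>\<open>B * X\<close> and \<open>B * Y\<close> are symmetric idempotents with the
    same range, and \<open>X * B\<close> and \<open>Y * B\<close> are symmetric idempotents with the
    same kernel. These absorption rules, combined with transposition, show that the members of each
    pair coincide.\<close>
  have proj: "(B * Z) * (B * W) = B * W" "(W * B) * (Z * B) = W * B"
    if "W \<in> carrier_mat c r" "Z \<in> carrier_mat c r" "B * Z * B = B" for W Z
  proof -
    have "(B * Z) * (B * W) = (B * Z * B) * W"
      by (rule assoc_mult_mat[symmetric, of _ r r _ c _ r]) (use B that in auto)
    thus "(B * Z) * (B * W) = B * W" using that by simp
    have "(W * B) * (Z * B) = W * (B * (Z * B))"
      by (rule assoc_mult_mat[of _ c r _ c _ c]) (use B that in auto)
    also have "B * (Z * B) = B * Z * B"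
      by (rule assoc_mult_mat[symmetric, of _ r c _ r _ c]) (use B that in auto)
    finally show "(W * B) * (Z * B) = W * B" using that by simp
  qed
  have BXB: "B * X * B = B" and BYB: "B * Y * B = B" using x y by blast+
  have "B * X = (B * Y) * (B * X)" using proj(1)[OF X Y BYB] by (rule sym)
  hence "(B * X)\<^sup>T = (B * X)\<^sup>T * (B * Y)\<^sup>T" unfolding transpose_mult[OF BXr(2) BXr(1), symmetric] by (rule arg_cong)
  hence "B * X = (B * X) * (B * Y)" using x y by simp
  also have "\<dots> = B * Y" by (rule proj(1)[OF Y X BXB])
  finally have BX: "B * X = B * Y" .
  have "X * B = (X * B) * (Y * B)" using proj(2)[OF X Y BYB] by (rule sym)
  hence "(X * B)\<^sup>T = (Y * B)\<^sup>T * (X * B)\<^sup>T" unfolding transpose_mult[OF BXr(3) BXr(4), symmetric] by (rule arg_cong)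
  hence "X * B = (Y * B) * (X * B)" using x y by simp
  also have "\<dots> = Y * B" by (rule proj(2)[OF Y X BXB])
  finally have XB: "X * B = Y * B" .
  have "X = X * B * X" using x by simp
  also have "\<dots> = Y * (B * X)" unfolding XB by (rule assoc_mult_mat[OF Y B X])
  also have "\<dots> = Y * B * Y" unfolding BX by (rule assoc_mult_mat[OF Y B Y, symmetric])
  also have "\<dots> = Y" using y by blast
  finally show ?thesis .
qed

text \<open>The pseudo-inverse of a symmetric matrix is the reciprocal function applied to it. The
  convention \<open>inverse 0 = 0\<close> sends the kernel to zero, exactly as the Penrose equations
  demand. Being a function of \<open>B\<close>, it also commutes with \<open>B\<close>.\<close>

lemma pinv_spsd:
  assumes B: "spsd m B"
  shows "pinv B \<in> carrier_mat m m" "(pinv B)\<^sup>T = pinv B" "B * pinv B * B = B" "pinv B * B * pinv B = pinv B"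
    "B * pinv B = pinv B * B"
proof -
  have Bc: "B \<in> carrier_mat m m" and Bs: "B\<^sup>T = B" using B by (auto simp: spsd_def)
  have sym: "(1\<^sub>m m * B)\<^sup>T = 1\<^sub>m m * B" using Bc Bs by simp
  obtain P Q l where wit: "similar_mat_wit B (mat_diag m l) P Q"
    using selfadjoint_diagonalizable[OF Bc spd_one sym] by blast
  interpret selfadjoint_op m B "1\<^sub>m m" P Q l by unfold_locales (fact spd_one Bc sym wit)+
  have s: "(F f)\<^sup>T = F f" for f using F_selfadjoint[of f] by (simp add: left_mult_one_mat[of _ m m])
  have inv: "x * inverse x * x = x" "inverse x * x * inverse x = inverse x" for x :: real
    by (cases "x = 0"; simp)+
  have 1: "B * F inverse * B = B" "F inverse * B * F inverse = F inverse"
    unfolding F_id[symmetric] F_mult inv by (rule refl)+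
  have 2: "B * F inverse = F inverse * B" 
    unfolding F_id[symmetric] F_mult by (simp add: mult.commute)
  have 3: "(B * F inverse)\<^sup>T = B * F inverse" "(F inverse * B)\<^sup>T = F inverse * B"
    unfolding F_id[symmetric] F_mult s by (rule refl)+
  have ip: "is_pinv B (F inverse)" unfolding is_pinv_def using 1 3 Bc by simp
  have "pinv B = F inverse" unfolding pinv_def
    using ip is_pinv_unique by (intro the_equality) auto
  thus "pinv B \<in> carrier_mat m m" "(pinv B)\<^sup>T = pinv B" "B * pinv B * B = B" "pinv B * B * pinv B = pinv B"
    "B * pinv B = pinv B * B"
    using 1 2 s by auto
qed

section \<open>The coarse projection and the two-level eigenvalues\<close>

lemma sym_mat_of_form:
  fixes B :: "real mat"
  assumes B: "B \<in> carrier_mat m m"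
    and sym: "\<And>x y. x \<in> carrier_vec m \<Longrightarrow> y \<in> carrier_vec m \<Longrightarrow> x \<bullet> (B *\<^sub>v y) = y \<bullet> (B *\<^sub>v x)"
  shows "B\<^sup>T = B"
proof -
  have e: "unit_vec m i \<bullet> (B *\<^sub>v unit_vec m j) = B $$ (i, j)" if "i < m" "j < m" for i j
    using that B by simp
  show ?thesis
  proof (rule eq_matI)
    fix i j assume "i < dim_row B" "j < dim_col B"
    hence ij: "i < m" "j < m" using B by auto
    have "unit_vec m i \<bullet> (B *\<^sub>v unit_vec m j) = unit_vec m j \<bullet> (B *\<^sub>v unit_vec m i)"
      by (rule sym) auto
    hence "B $$ (i, j) = B $$ (j, i)" unfolding e[OF ij] e[OF ij(2,1)] .
    thus "B\<^sup>T $$ (i, j) = B $$ (i, j)" using ij B by simp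
  qed (use B in auto)
qed

lemma congruence_form:
  fixes A R :: "real mat"
  assumes A: "A \<in> carrier_mat n n" and R: "R \<in> carrier_mat m n"
    and x: "x \<in> carrier_vec m" and y: "y \<in> carrier_vec m"
  shows "x \<bullet> (R * A * R\<^sup>T *\<^sub>v y) = (R\<^sup>T *\<^sub>v x) \<bullet> (A *\<^sub>v (R\<^sup>T *\<^sub>v y))"
proof -
  have Rt: "R\<^sup>T \<in> carrier_mat n m" using R by simp
  have Ry: "R\<^sup>T *\<^sub>v y \<in> carrier_vec n" using Rt y by simp
  have "R * A * R\<^sup>T *\<^sub>v y = R *\<^sub>v (A *\<^sub>v (R\<^sup>T *\<^sub>v y))"
    unfolding assoc_mult_mat_vec[OF mult_carrier_mat[OF R A] Rt y] by (rule assoc_mult_mat_vec[OF R A Ry])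
  thus ?thesis using transpose_vec_mult_scalar[OF R _ x, of "A *\<^sub>v (R\<^sup>T *\<^sub>v y)"] A Ry by simp
qed

lemma spsd_congruence:
  assumes A: "spsd n A" and R: "R \<in> carrier_mat m n"
  shows "spsd m (R * A * R\<^sup>T)"
proof -
  have Ac: "A \<in> carrier_mat n n" and As: "A\<^sup>T = A" using A by (auto simp: spsd_def)
  note form = congruence_form[OF Ac R]
  have RAR: "R * A * R\<^sup>T \<in> carrier_mat m m" using R Ac by simp
  have Rc: "R\<^sup>T *\<^sub>v x \<in> carrier_vec n" if "x \<in> carrier_vec m" for x using R that by simp
  have sym: "(R * A * R\<^sup>T)\<^sup>T = R * A * R\<^sup>T"
  proof (rule sym_mat_of_form[OF RAR])
    fix x y :: "real vec" assume xy: "x \<in> carrier_vec m" "y \<in> carrier_vec m"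
    show "x \<bullet> (R * A * R\<^sup>T *\<^sub>v y) = y \<bullet> (R * A * R\<^sup>T *\<^sub>v x)"
      unfolding form[OF xy] form[OF xy(2,1)] by (rule form_sym[OF Ac As Rc[OF xy(1)] Rc[OF xy(2)]])
  qed
  have "0 \<le> x \<bullet> (R * A * R\<^sup>T *\<^sub>v x)" if x: "x \<in> carrier_vec m" for x
    unfolding form[OF x x] using A Rc[OF x] unfolding spsd_def by blast
  thus ?thesis unfolding spsd_def using RAR sym by blast
qed

lemma spd_of_spsd:
  assumes "spsd m B" "\<And>x. x \<in> carrier_vec m \<Longrightarrow> x \<bullet> (B *\<^sub>v x) = 0 \<Longrightarrow> x = 0\<^sub>v m"
  shows "spd m B"
  using assms unfolding spd_def spsd_def by (auto simp: order_less_le)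

lemma spd_congruence:
  assumes A: "spd n A" and R: "R \<in> carrier_mat m n"
    and inj: "\<And>c. c \<in> carrier_vec m \<Longrightarrow> R\<^sup>T *\<^sub>v c = 0\<^sub>v n \<Longrightarrow> c = 0\<^sub>v m"
  shows "spd m (R * A * R\<^sup>T)"
proof (rule spd_of_spsd[OF spsd_congruence[OF spsd_of_spd[OF A] R]])
  have Ac: "A \<in> carrier_mat n n" using A by (simp add: spd_def)
  fix x assume x: "x \<in> carrier_vec m" and "x \<bullet> (R * A * R\<^sup>T *\<^sub>v x) = 0"
  hence "(R\<^sup>T *\<^sub>v x) \<bullet> (A *\<^sub>v (R\<^sup>T *\<^sub>v x)) = 0" unfolding congruence_form[OF Ac R x x] by simp
  moreover have "R\<^sup>T *\<^sub>v x \<in> carrier_vec n" using R x by simp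
  ultimately show "x = 0\<^sub>v m" using spd_eq_zero_iff[OF A] inj[OF x] by blast
qed

lemma invertible_matE:
  assumes B: "B \<in> carrier_mat m m" and inv: "invertible_mat B"
  obtains C where "C \<in> carrier_mat m m" "B * C = 1\<^sub>m m" "C * B = 1\<^sub>m m"
proof -
  obtain C where C: "B * C = 1\<^sub>m (dim_row B)" "C * B = 1\<^sub>m (dim_row C)"
    using inv unfolding invertible_mat_def inverts_mat_def by blast
  \<comment> \<open>The shape of the inverse is not given; it is recovered by comparing column
    counts in the two product equations.\<close>
  have r: "dim_row C = m" using arg_cong[OF C(2), of dim_col] B by simp
  moreover have "dim_col C = m" using arg_cong[OF C(1), of dim_col] B by simp
  ultimately show ?thesis using C B by (intro that[of C]) auto
qed

lemma invertible_spsd_spd: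
  assumes B: "spsd m B" and inv: "invertible_mat B"
  shows "spd m B"
proof (rule spd_of_spsd[OF B])
  have Bc: "B \<in> carrier_mat m m" using B by (simp add: spsd_def)
  obtain C where C: "C \<in> carrier_mat m m" "C * B = 1\<^sub>m m" by (rule invertible_matE[OF Bc inv])
  fix x assume x: "x \<in> carrier_vec m" and "x \<bullet> (B *\<^sub>v x) = 0"
  hence "C *\<^sub>v (B *\<^sub>v x) = 0\<^sub>v m" using spsd_form_zero[OF B] mult_mat_zero_vec[OF C(1)] by simp
  thus "x = 0\<^sub>v m" using x unfolding assoc_mult_mat_vec[OF C(1) Bc x, symmetric] C(2) by simp
qed

text \<open>Writing \<open>x\<close> as \<open>H *\<^sub>v (G *\<^sub>v x)\<close> turns the form of
  \<open>G\<close> into the form of \<open>H\<close> at the transformed vectors, so symmetry and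
  positivity are inherited. Applied to the preconditioner, this supplies the inner product for its
  product with \<open>A * P\<close>.\<close>

lemma spd_of_inverse:
  assumes H: "spsd n H" and G: "G \<in> carrier_mat n n" "H * G = 1\<^sub>m n" "G * H = 1\<^sub>m n"
  shows "spd n G"
proof -
  have Hc: "H \<in> carrier_mat n n" and Hs: "H\<^sup>T = H" using H by (auto simp: spsd_def)
  have HG: "H *\<^sub>v (G *\<^sub>v x) = x" if "x \<in> carrier_vec n" for x
    unfolding assoc_mult_mat_vec[OF Hc G(1) that, symmetric] G(2) using that by simp
  have Gx: "G *\<^sub>v x \<in> carrier_vec n" if "x \<in> carrier_vec n" for x using G(1) that by simp
  have form: "x \<bullet> (G *\<^sub>v y) = (G *\<^sub>v y) \<bullet> (H *\<^sub>v (G *\<^sub>v x))"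
    if "x \<in> carrier_vec n" "y \<in> carrier_vec n" for x y
    unfolding HG[OF that(1)] by (rule comm_scalar_prod[OF that(1) Gx[OF that(2)]])
  have sym: "G\<^sup>T = G"
  proof (rule sym_mat_of_form[OF G(1)])
    fix x y :: "real vec" assume xy: "x \<in> carrier_vec n" "y \<in> carrier_vec n"
    show "x \<bullet> (G *\<^sub>v y) = y \<bullet> (G *\<^sub>v x)"
      unfolding form[OF xy] form[OF xy(2,1)] by (rule form_sym[OF Hc Hs Gx[OF xy(2)] Gx[OF xy(1)]])
  qed
  have pos: "0 < x \<bullet> (G *\<^sub>v x)" if x: "x \<in> carrier_vec n" "x \<noteq> 0\<^sub>v n" for x
  proof -
    have "0 \<le> x \<bullet> (G *\<^sub>v x)" unfolding form[OF x(1) x(1)] using H Gx[OF x(1)] unfolding spsd_def by blast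
    moreover have "x \<bullet> (G *\<^sub>v x) \<noteq> 0"
    proof
      assume "x \<bullet> (G *\<^sub>v x) = 0"
      hence "H *\<^sub>v (G *\<^sub>v x) = 0\<^sub>v n" unfolding form[OF x(1) x(1)]
        by (rule spsd_form_zero[OF H Gx[OF x(1)]])
      thus False using HG x by simp
    qed
    ultimately show ?thesis by linarith
  qed
  show ?thesis unfolding spd_def using G(1) sym pos by blast
qed

lemma minv_spd:
  assumes B: "spd m B"
  shows "minv B \<in> carrier_mat m m" "B * minv B = 1\<^sub>m m" "minv B * B = 1\<^sub>m m" "(minv B)\<^sup>T = minv B"
proof -
  have Bc: "B \<in> carrier_mat m m" using B by (simp add: spd_def)
  obtain C where C: "C \<in> carrier_mat m m" "B * C = 1\<^sub>m m" "C * B = 1\<^sub>m m"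
    using spd_has_inverse[OF B] by blast
  hence "B \<in> Units (ring_mat TYPE(real) m ())" unfolding Units_def ring_mat_simps using Bc by blast
  then obtain X where X: "mat_inverse B = Some X" using mat_inverse(1)[OF Bc, of "()"]
    by (cases "mat_inverse B") auto
  have m: "minv B = X" unfolding minv_def X by simp
  show 1: "minv B \<in> carrier_mat m m" "B * minv B = 1\<^sub>m m" "minv B * B = 1\<^sub>m m"
    unfolding m using mat_inverse(2)[OF Bc X] by blast+
  have "spd m (minv B)" by (rule spd_of_inverse[OF spsd_of_spd[OF B] 1])
  thus "(minv B)\<^sup>T = minv B" unfolding spd_def by blast
qed

section \<open>Bases and the coarse projection\<close>

lemma lin_span_cols:
  fixes W :: "real mat"
  assumes W: "W \<in> carrier_mat n k" and x: "x \<in> lin_span n (set (cols W))"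
  shows "\<exists>c \<in> carrier_vec k. x = W *\<^sub>v c"
proof -
  interpret vec_space "TYPE(real)" n .
  have cl: "set (cols W) \<subseteq> carrier_vec n" using W cols_dim by blast
  have "x \<in> span_list (cols W)" unfolding span_list_as_span[OF cl] by (rule x)
  then obtain f where "x = lincomb_list f (cols W)" by (rule in_span_listE)
  also have "\<dots> = mat_of_cols n (cols W) *\<^sub>v vec (length (cols W)) f"
    by (rule lincomb_list_as_mat_mult) (use cl in auto)
  also have "mat_of_cols n (cols W) = W" using W by (auto simp: mat_of_cols_cols)
  finally have "x = W *\<^sub>v vec k f" using W by simp
  thus ?thesis by (intro bexI[of _ "vec k f"]) auto
qed

text \<open>\<open>is_basis\<close> sees only the set of columns, so distinctness is a separate
  hypothesis: a repeated column would destroy injectivity without changing that set.\<close>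

lemma basis_cols_inj:
  fixes W :: "real mat"
  assumes W: "W \<in> carrier_mat n k" and b: "is_basis n (set (cols W)) V" and d: "distinct (cols W)"
    and c: "c \<in> carrier_vec k" "W *\<^sub>v c = 0\<^sub>v n"
  shows "c = 0\<^sub>v k"
proof (rule ccontr)
  assume "c \<noteq> 0\<^sub>v k"
  interpret vec_space "TYPE(real)" n .
  have "lin_dep (set (cols W))" by (rule lin_depI[OF W c(1) \<open>c \<noteq> 0\<^sub>v k\<close> c(2) d])
  thus False using b unfolding is_basis_def by simp
qed

lemma card_basis_sdim:
  assumes V: "is_subspace n V" and b: "is_basis n S V" and fin: "finite S"
  shows "card S = sdim n V"
proof -
  interpret vec_space "TYPE(real)" n .
  have sub: "VectorSpace.subspace class_ring V (euclid n)" using V unfolding is_subspace_def .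
  hence sm: "submodule class_ring V (euclid n)" unfolding VectorSpace.subspace_def by blast
  interpret W: vectorspace class_ring "(euclid n)\<lparr>carrier := V\<rparr>" by (rule subspace_is_vs[OF sub])
  have Vc: "V \<subseteq> carrier_vec n" using sm unfolding submodule_def by auto
  have SV: "S \<subseteq> V" using b unfolding is_basis_def by blast
  \<comment> \<open>Span and independence do not change when \<open>V\<close> is regarded as a
    vector space of its own, which is where its dimension is defined.\<close>
  have bS: "W.basis S" unfolding W.basis_def
    using b span_li_not_depend[OF SV sm] SV unfolding is_basis_def by simp
  thus ?thesis unfolding sdim_def using W.dim_basis[OF fin bS] b SV Vc unfolding is_basis_def by auto
qed

text \<open>The key identity is \<open>C * A * R0\<^sup>T = R0\<^sup>T\<close>: it makes
  \<open>C * A\<close> idempotent and the identity on \<open>V0\<close>, so the complement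
  \<open>P\<close> kills \<open>V0\<close>. Symmetry of \<open>C\<close> makes
  \<open>A * (C * A)\<close> symmetric, and with it \<open>A * P\<close>.\<close>

lemma coarse_projection:
  assumes A: "spd n A" and co: "coarse_setting n V0 R0"
  shows "P0 n A R0 \<in> carrier_mat n n" "(A * P0 n A R0)\<^sup>T = A * P0 n A R0"
    "P0 n A R0 * P0 n A R0 = P0 n A R0" "\<And>v. v \<in> V0 \<Longrightarrow> P0 n A R0 *\<^sub>v v = 0\<^sub>v n"
    "V0 \<subseteq> carrier_vec n" "coarse_solve A R0 \<in> carrier_mat n n"
    "coarse_solve A R0 * A = 1\<^sub>m n - P0 n A R0"
proof -
  define k where "k = sdim n V0"
  have Ac: "A \<in> carrier_mat n n" and As: "A\<^sup>T = A" using A by (auto simp: spd_def)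
  have R: "R0 \<in> carrier_mat k n" and sub: "is_subspace n V0" and b: "is_basis n (set (rows R0)) V0"
    using co unfolding coarse_setting_def k_def by auto
  have Rt: "R0\<^sup>T \<in> carrier_mat n k" using R by simp
  have b': "is_basis n (set (cols R0\<^sup>T)) V0" using b by simp
  \<comment> \<open>\<open>R0\<close> has \<open>k\<close> rows and their set has \<open>k\<close>
    elements, so no row repeats. Hence \<open>R0\<^sup>T\<close> is injective and the coarse matrix
    \<open>E\<close> is definite.\<close>
  have "card (set (rows R0)) = k" unfolding k_def by (rule card_basis_sdim[OF sub b]) simp
  hence "distinct (rows R0)" using R by (intro card_distinct) simp
  hence d: "distinct (cols R0\<^sup>T)" by simp
  have inj: "c = 0\<^sub>v k" if "c \<in> carrier_vec k" "R0\<^sup>T *\<^sub>v c = 0\<^sub>v n" for c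
    by (rule basis_cols_inj[OF Rt b' d that])
  define E where "E = R0 * A * R0\<^sup>T"
  have E: "spd k E" unfolding E_def by (rule spd_congruence[OF A R inj])
  define X where "X = minv E"
  note X = minv_spd[OF E, folded X_def]
  define C where "C = R0\<^sup>T * X * R0"
  have C_eq: "coarse_solve A R0 = C" unfolding coarse_solve_def C_def X_def E_def ..
  have Cc: "C \<in> carrier_mat n n" unfolding C_def using R X(1) by simp
  define P where "P = 1\<^sub>m n - C * A"
  have P_eq: "P0 n A R0 = P" unfolding P0_def C_eq P_def ..
  have CA: "C * A \<in> carrier_mat n n" using Cc Ac by simp
  have Pc: "P \<in> carrier_mat n n" unfolding P_def using CA by (intro minus_carrier_mat)
  have Ct: "C\<^sup>T = C"
  proof -
    have "C\<^sup>T = R0\<^sup>T * (R0\<^sup>T * X)\<^sup>T" unfolding C_def by (rule transpose_mult) (use R X(1) in auto)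
    also have "(R0\<^sup>T * X)\<^sup>T = X\<^sup>T * R0" using transpose_mult[OF Rt X(1)] by simp
    also have "R0\<^sup>T * (X\<^sup>T * R0) = C" unfolding C_def X(4)
      by (rule assoc_mult_mat[OF Rt X(1) R, symmetric])
    finally show ?thesis .
  qed
  have CAR: "C * A * R0\<^sup>T = R0\<^sup>T"
  proof -
    have "C * A * R0\<^sup>T = C * (A * R0\<^sup>T)" by (rule assoc_mult_mat[OF Cc Ac Rt])
    also have "\<dots> = R0\<^sup>T * X * (R0 * (A * R0\<^sup>T))" unfolding C_def
      by (rule assoc_mult_mat) (use Rt X(1) R Ac in auto)
    also have "R0 * (A * R0\<^sup>T) = E" unfolding E_def by (rule assoc_mult_mat[OF R Ac Rt, symmetric])
    also have "R0\<^sup>T * X * E = R0\<^sup>T * (X * E)"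
      by (rule assoc_mult_mat) (use Rt X(1) E in \<open>auto simp: spd_def\<close>)
    finally show ?thesis unfolding X(3) using Rt by simp
  qed
  have CAC: "C * A * C = C"
  proof -
    have CR: "C = R0\<^sup>T * (X * R0)" unfolding C_def by (rule assoc_mult_mat[OF Rt X(1) R])
    hence "C * A * C = C * A * (R0\<^sup>T * (X * R0))" by (rule arg_cong)
    also have "\<dots> = C * A * R0\<^sup>T * (X * R0)"
      by (rule assoc_mult_mat[symmetric]) (use CA Rt X(1) R in auto)
    also have "\<dots> = C" unfolding CAR by (rule CR[symmetric])
    finally show ?thesis .
  qed
  have AP: "A * P = A - A * (C * A)" unfolding P_def
    using mult_minus_distrib_mat[OF Ac one_carrier_mat CA] Ac by simp
  have "(A * (C * A))\<^sup>T = A * (C * A)"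
  proof -
    have "(A * (C * A))\<^sup>T = (A\<^sup>T * C\<^sup>T) * A\<^sup>T"
      unfolding transpose_mult[OF Ac CA] transpose_mult[OF Cc Ac] ..
    thus ?thesis unfolding As Ct using assoc_mult_mat[OF Ac Cc Ac] by simp
  qed
  hence "(A * P)\<^sup>T = A * P" unfolding AP using transpose_minus[OF Ac mult_carrier_mat[OF Ac CA]] As by simp
  moreover have "P * P = P"
  proof -
    have "C * A * (C * A) = C * A" using assoc_mult_mat[OF CA Cc Ac] CAC by simp
    hence "C * A * P = C * A - C * A" unfolding P_def
      using mult_minus_distrib_mat[OF CA one_carrier_mat CA] right_mult_one_mat[OF CA] by simp
    also have "\<dots> = 0\<^sub>m n n" using CA by (rule minus_r_inv_mat)
    finally have z: "C * A * P = 0\<^sub>m n n" .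
    have "P * P = 1\<^sub>m n * P - C * A * P" using minus_mult_distrib_mat[OF one_carrier_mat CA Pc]
      unfolding P_def .
    thus ?thesis unfolding z using Pc by (auto intro!: eq_matI)
  qed
  moreover have "P *\<^sub>v v = 0\<^sub>v n" if "v \<in> V0" for v
  proof -
    have "v \<in> lin_span n (set (cols R0\<^sup>T))" using that b' unfolding is_basis_def by blast
    then obtain c where c: "c \<in> carrier_vec k" and v: "v = R0\<^sup>T *\<^sub>v c" using lin_span_cols[OF Rt] by blast
    have vc: "v \<in> carrier_vec n" unfolding v using Rt c by simp
    have "C * A *\<^sub>v v = v" unfolding v
      unfolding assoc_mult_mat_vec[OF CA Rt c, symmetric] CAR ..
    hence "P *\<^sub>v v = v - v" unfolding P_def
      using minus_mult_distrib_mat_vec[OF one_carrier_mat CA vc] vc by simp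
    thus ?thesis using vc by simp
  qed
  moreover have "V0 \<subseteq> carrier_vec n"
  proof -
    interpret vec_space "TYPE(real)" n .
    show ?thesis using sub unfolding is_subspace_def VectorSpace.subspace_def submodule_def by auto
  qed
  moreover have "C * A = 1\<^sub>m n - P" unfolding P_def using CA by (intro eq_matI) auto
  ultimately show "P0 n A R0 \<in> carrier_mat n n" "(A * P0 n A R0)\<^sup>T = A * P0 n A R0"
    "P0 n A R0 * P0 n A R0 = P0 n A R0" "\<And>v. v \<in> V0 \<Longrightarrow> P0 n A R0 *\<^sub>v v = 0\<^sub>v n"
    "V0 \<subseteq> carrier_vec n" "coarse_solve A R0 \<in> carrier_mat n n"
    "coarse_solve A R0 * A = 1\<^sub>m n - P0 n A R0"
    unfolding P_eq C_eq using Pc Cc by blast+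
qed

section \<open>Eigenvectors of the two preconditioned operators\<close>

lemma preconditioned_eigval:
  assumes A: "spd n A" and Pc: "P \<in> carrier_mat n n" and AP: "(A * P)\<^sup>T = A * P" and PP: "P * P = P"
    and H: "spsd n H" and inv: "invertible_mat H" and z: "z \<in> eigvals (H * A * P)"
  shows "\<exists>l. z = complex_of_real l \<and> (l = 0 \<or> (\<exists>w \<in> carrier_vec n. w \<noteq> 0\<^sub>v n \<and> P *\<^sub>v w = w \<and>
    l * (w \<bullet> (A *\<^sub>v w)) = (A *\<^sub>v w) \<bullet> (H *\<^sub>v (A *\<^sub>v w))))"
proof -
  have Ac: "A \<in> carrier_mat n n" and As: "A\<^sup>T = A" using A by (auto simp: spd_def)
  have Hc: "H \<in> carrier_mat n n" and Hs: "H\<^sup>T = H" using H by (auto simp: spsd_def)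
  obtain G where G: "G \<in> carrier_mat n n" "H * G = 1\<^sub>m n" "G * H = 1\<^sub>m n"
    by (rule invertible_matE[OF Hc inv])
  have Gs: "spd n G" by (rule spd_of_inverse[OF H G])
  have APc: "A * P \<in> carrier_mat n n" using Ac Pc by simp
  have K: "H * A * P \<in> carrier_mat n n" using Hc Ac Pc by simp
  \<comment> \<open>In the inner product of the inverse preconditioner \<open>G\<close> the factor
    \<open>H\<close> cancels, which leaves the symmetric matrix \<open>A * P\<close>.\<close>
  have GK: "G * (H * A * P) = A * P"
    unfolding assoc_mult_mat[OF Hc Ac Pc] assoc_mult_mat[OF G(1) Hc APc, symmetric] G(3)
    by (rule left_mult_one_mat[OF APc])
  obtain l v where l: "z = complex_of_real l" and v: "v \<in> carrier_vec n" "v \<noteq> 0\<^sub>v n"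
    and ev: "H * A * P *\<^sub>v v = l \<cdot>\<^sub>v v"
    using selfadjoint_eigval_real[OF K Gs _ z] AP unfolding GK by blast
  define w where "w = P *\<^sub>v v"
  have w: "w \<in> carrier_vec n" unfolding w_def using Pc v by simp
  have Aw: "A *\<^sub>v w \<in> carrier_vec n" using Ac w by simp
  have HAw: "H *\<^sub>v (A *\<^sub>v w) = l \<cdot>\<^sub>v v"
    using ev unfolding w_def assoc_mult_mat_vec[OF mult_carrier_mat[OF Hc Ac] Pc v(1)]
      assoc_mult_mat_vec[OF Hc Ac w[unfolded w_def]] .
  have Pw: "P *\<^sub>v w = w" unfolding w_def assoc_mult_mat_vec[OF Pc Pc v(1), symmetric] PP ..
  \<comment> \<open>The eigenvector itself need not be \<open>A\<close>-orthogonal to the kernel of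
    \<open>P\<close>; its projection \<open>w\<close> is, and it can vanish only for the eigenvalue
    0.\<close>
  have "w \<noteq> 0\<^sub>v n" if "l \<noteq> 0"
  proof
    assume "w = 0\<^sub>v n"
    hence "l \<cdot>\<^sub>v v = 0\<^sub>v n" using HAw mult_mat_zero_vec[OF Ac] mult_mat_zero_vec[OF Hc] by simp
    hence "inverse l \<cdot>\<^sub>v (l \<cdot>\<^sub>v v) = inverse l \<cdot>\<^sub>v 0\<^sub>v n" by simp
    moreover have "inverse l \<cdot>\<^sub>v 0\<^sub>v n = 0\<^sub>v n" by (rule eq_vecI) auto
    ultimately show False using that v by (simp add: smult_smult_assoc)
  qed
  moreover have "l * (w \<bullet> (A *\<^sub>v w)) = (A *\<^sub>v w) \<bullet> (H *\<^sub>v (A *\<^sub>v w))"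
  proof -
    have "(A *\<^sub>v w) \<bullet> (H *\<^sub>v (A *\<^sub>v w)) = l * ((A *\<^sub>v w) \<bullet> v)"
      unfolding HAw by (rule scalar_prod_smult_distrib[OF Aw v(1)])
    also have "(A *\<^sub>v w) \<bullet> v = v \<bullet> (A *\<^sub>v (P *\<^sub>v w))" unfolding Pw by (rule comm_scalar_prod[OF Aw v(1)])
    also have "\<dots> = v \<bullet> (A * P *\<^sub>v w)" unfolding assoc_mult_mat_vec[OF Ac Pc w] ..
    also have "\<dots> = w \<bullet> (A * P *\<^sub>v v)" by (rule form_sym[OF APc AP v(1) w])
    also have "\<dots> = w \<bullet> (A *\<^sub>v w)" unfolding assoc_mult_mat_vec[OF Ac Pc v(1)] w_def ..
    finally show ?thesis by simp
  qed
  ultimately show ?thesis using l w Pw by blast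
qed

text \<open>Because \<open>P\<^sup>T * A = A * P\<close>, the operator is
  \<open>P * H * A * P\<close> plus the complementary projection. Applying \<open>P\<close> to the
  eigenvector equation removes the complementary part and leaves an equation for
  \<open>w = P *\<^sub>v v\<close>. If \<open>w\<close> vanishes, only the complementary projection
  acts on \<open>v\<close>, with eigenvalue 1.\<close>

lemma hybrid_eigval:
  assumes A: "spd n A" and Pc: "P \<in> carrier_mat n n" and AP: "(A * P)\<^sup>T = A * P" and PP: "P * P = P"
    and H: "spsd n H" and C: "C \<in> carrier_mat n n" "C * A = 1\<^sub>m n - P"
    and z: "z \<in> eigvals ((P * H * P\<^sup>T + C) * A)"
  shows "\<exists>l. z = complex_of_real l \<and> (l = 1 \<or> (\<exists>w \<in> carrier_vec n. w \<noteq> 0\<^sub>v n \<and> P *\<^sub>v w = w \<and>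
    l * (w \<bullet> (A *\<^sub>v w)) = (A *\<^sub>v w) \<bullet> (H *\<^sub>v (A *\<^sub>v w))))"
proof -
  have Ac: "A \<in> carrier_mat n n" and As: "A\<^sup>T = A" using A by (auto simp: spd_def)
  have Hc: "H \<in> carrier_mat n n" and Hs: "H\<^sup>T = H" using H by (auto simp: spsd_def)
  have Pt: "P\<^sup>T \<in> carrier_mat n n" using Pc by simp
  have APc: "A * P \<in> carrier_mat n n" using Ac Pc by simp
  have PtA: "P\<^sup>T * A = A * P" using AP transpose_mult[OF Ac Pc] As by simp
  define K where "K = (P * H * P\<^sup>T + C) * A"
  have PH: "P * H \<in> carrier_mat n n" using Pc Hc by simp
  have Kc: "K \<in> carrier_mat n n" unfolding K_def
    by (intro mult_carrier_mat[OF _ Ac] add_carrier_mat C(1))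
  have Kv: "K *\<^sub>v x = P *\<^sub>v (H *\<^sub>v (A *\<^sub>v (P *\<^sub>v x))) + (x - P *\<^sub>v x)" if x: "x \<in> carrier_vec n" for x
  proof -
    have Px: "P *\<^sub>v x \<in> carrier_vec n" using Pc x by simp
    have APx: "A *\<^sub>v (P *\<^sub>v x) \<in> carrier_vec n" using Ac Px by simp
    have "K = P * H * P\<^sup>T * A + C * A" unfolding K_def
      by (rule add_mult_distrib_mat) (use PH Pt C(1) Ac in auto)
    also have "P * H * P\<^sup>T * A = P * H * (A * P)" unfolding PtA[symmetric]
      by (rule assoc_mult_mat[OF PH Pt Ac])
    finally have "K = P * H * (A * P) + (1\<^sub>m n - P)" unfolding C(2) .
    hence "K *\<^sub>v x = P * H * (A * P) *\<^sub>v x + (1\<^sub>m n - P) *\<^sub>v x"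
      using add_mult_distrib_mat_vec[of "P * H * (A * P)" n n "1\<^sub>m n - P" x] PH APc Pc x
      by (simp add: minus_carrier_mat)
    also have "(1\<^sub>m n - P) *\<^sub>v x = x - P *\<^sub>v x"
      using minus_mult_distrib_mat_vec[OF one_carrier_mat Pc x] x by simp
    also have "P * H * (A * P) *\<^sub>v x = P * H *\<^sub>v (A *\<^sub>v (P *\<^sub>v x))"
      unfolding assoc_mult_mat_vec[OF PH APc x] assoc_mult_mat_vec[OF Ac Pc x] ..
    also have "\<dots> = P *\<^sub>v (H *\<^sub>v (A *\<^sub>v (P *\<^sub>v x)))" by (rule assoc_mult_mat_vec[OF Pc Hc APx])
    finally show ?thesis .
  qed
  note mc = mult_mat_vec_carrier[OF Ac] mult_mat_vec_carrier[OF Hc] mult_mat_vec_carrier[OF Pc]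
  have APv: "x \<bullet> (A *\<^sub>v (P *\<^sub>v y)) = y \<bullet> (A *\<^sub>v (P *\<^sub>v x))" if "x \<in> carrier_vec n" "y \<in> carrier_vec n" for x y
    using form_sym[OF APc AP that] that unfolding assoc_mult_mat_vec[OF Ac Pc that(1)] assoc_mult_mat_vec[OF Ac Pc that(2)] by simp
  have AK: "(A * K)\<^sup>T = A * K"
  proof (rule sym_mat_of_form)
    show AKc: "A * K \<in> carrier_mat n n" using Ac Kc by simp
    fix x y :: "real vec" assume x: "x \<in> carrier_vec n" and y: "y \<in> carrier_vec n"
    \<comment> \<open>In this shape every summand is visibly symmetric in \<open>x\<close> and
      \<open>y\<close>, so \<open>K\<close> is self-adjoint for \<open>A\<close>.\<close>
    have e: "x \<bullet> (A * K *\<^sub>v y) = (A *\<^sub>v (P *\<^sub>v x)) \<bullet> (H *\<^sub>v (A *\<^sub>v (P *\<^sub>v y))) + (x \<bullet> (A *\<^sub>v y) - x \<bullet> (A *\<^sub>v (P *\<^sub>v y)))"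
      if x: "x \<in> carrier_vec n" and y: "y \<in> carrier_vec n" for x y
    proof -
      have c: "P *\<^sub>v (H *\<^sub>v (A *\<^sub>v (P *\<^sub>v y))) \<in> carrier_vec n" "y - P *\<^sub>v y \<in> carrier_vec n"
        using y by (auto intro!: mc minus_carrier_vec)
      have "x \<bullet> (A * K *\<^sub>v y) = x \<bullet> (A *\<^sub>v (P *\<^sub>v (H *\<^sub>v (A *\<^sub>v (P *\<^sub>v y))))) + x \<bullet> (A *\<^sub>v (y - P *\<^sub>v y))"
        unfolding assoc_mult_mat_vec[OF Ac Kc y] Kv[OF y] mult_add_distrib_mat_vec[OF Ac c]
        by (rule scalar_prod_add_distrib[OF x mc(1)[OF c(1)] mc(1)[OF c(2)]])
      also have "x \<bullet> (A *\<^sub>v (y - P *\<^sub>v y)) = x \<bullet> (A *\<^sub>v y) - x \<bullet> (A *\<^sub>v (P *\<^sub>v y))"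
        unfolding mult_minus_distrib_mat_vec[OF Ac y mc(3)[OF y]]
        by (rule scalar_prod_minus_distrib[OF x mc(1)[OF y] mc(1)[OF mc(3)[OF y]]])
      also have "x \<bullet> (A *\<^sub>v (P *\<^sub>v (H *\<^sub>v (A *\<^sub>v (P *\<^sub>v y))))) = (H *\<^sub>v (A *\<^sub>v (P *\<^sub>v y))) \<bullet> (A *\<^sub>v (P *\<^sub>v x))"
        using x y by (intro APv) (auto intro!: mc)
      also have "\<dots> = (A *\<^sub>v (P *\<^sub>v x)) \<bullet> (H *\<^sub>v (A *\<^sub>v (P *\<^sub>v y)))"
        using x y by (intro comm_scalar_prod[of _ n]) (auto intro!: mc)
      finally show ?thesis .
    qed
    have "(A *\<^sub>v (P *\<^sub>v x)) \<bullet> (H *\<^sub>v (A *\<^sub>v (P *\<^sub>v y))) = (A *\<^sub>v (P *\<^sub>v y)) \<bullet> (H *\<^sub>v (A *\<^sub>v (P *\<^sub>v x)))"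
      using x y by (intro form_sym[OF Hc Hs]) (auto intro!: mc)
    thus "x \<bullet> (A * K *\<^sub>v y) = y \<bullet> (A * K *\<^sub>v x)"
      unfolding e[OF x y] e[OF y x] using form_sym[OF Ac As x y] APv[OF x y] by simp
  qed
  obtain l v where l: "z = complex_of_real l" and v: "v \<in> carrier_vec n" "v \<noteq> 0\<^sub>v n"
    and ev: "K *\<^sub>v v = l \<cdot>\<^sub>v v"
    using selfadjoint_eigval_real[OF Kc A AK] z unfolding K_def by blast
  define w where "w = P *\<^sub>v v"
  have w: "w \<in> carrier_vec n" unfolding w_def using mc v by blast
  have Pw: "P *\<^sub>v w = w" unfolding w_def assoc_mult_mat_vec[OF Pc Pc v(1), symmetric] PP ..
  define u where "u = H *\<^sub>v (A *\<^sub>v w)"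
  have u: "u \<in> carrier_vec n" unfolding u_def using mc w by blast
  have eq: "P *\<^sub>v u + (v - w) = l \<cdot>\<^sub>v v" using ev unfolding Kv[OF v(1)] u_def w_def .
  show ?thesis
  proof (cases "w = 0\<^sub>v n")
    case True
    have "u = 0\<^sub>v n" unfolding u_def True mult_mat_zero_vec[OF Ac] by (rule mult_mat_zero_vec[OF Hc])
    hence e: "v = l \<cdot>\<^sub>v v" using eq True v mult_mat_zero_vec[OF Pc] by simp
    have "l = 1"
    proof (rule ccontr)
      assume "l \<noteq> 1"
      have "v = 0\<^sub>v n"
      proof (rule eq_vecI)
        fix i assume "i < dim_vec (0\<^sub>v n)"
        thus "v $ i = 0\<^sub>v n $ i" using arg_cong[OF e, of "\<lambda>x. x $ i"] v \<open>l \<noteq> 1\<close> by simp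
      qed (use v in simp)
      thus False using v by simp
    qed
    thus ?thesis using l by blast
  next
    case False
    have Pu: "P *\<^sub>v u \<in> carrier_vec n" using mc u by blast
    have PPu: "P *\<^sub>v (P *\<^sub>v u) = P *\<^sub>v u" unfolding assoc_mult_mat_vec[OF Pc Pc u, symmetric] PP ..
    have vw: "v - w \<in> carrier_vec n" using v w by (intro minus_carrier_vec)
    have "P *\<^sub>v (P *\<^sub>v u + (v - w)) = P *\<^sub>v u + (w - w)"
      unfolding mult_add_distrib_mat_vec[OF Pc Pu vw] mult_minus_distrib_mat_vec[OF Pc v(1) w] PPu Pw
      unfolding w_def ..
    also have "\<dots> = P *\<^sub>v u" using Pu w by simp
    finally have "P *\<^sub>v (l \<cdot>\<^sub>v v) = P *\<^sub>v u" unfolding eq .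
    hence Pul: "P *\<^sub>v u = l \<cdot>\<^sub>v w" using mult_mat_vec[OF Pc v(1), of l] unfolding w_def by simp
    have "(A *\<^sub>v w) \<bullet> u = u \<bullet> (A *\<^sub>v (P *\<^sub>v w))" unfolding Pw by (rule comm_scalar_prod[OF mc(1)[OF w] u])
    also have "\<dots> = w \<bullet> (A *\<^sub>v (P *\<^sub>v u))" by (rule APv[OF u w])
    also have "\<dots> = l * (w \<bullet> (A *\<^sub>v w))" unfolding Pul mult_mat_vec[OF Ac w]
      by (rule scalar_prod_smult_distrib[OF w mc(1)[OF w]])
    finally show ?thesis using l w False Pw unfolding u_def by metis
  qed
qed

section \<open>Energy estimates\<close>

text \<open>The coefficient \<open>a\<close> is left free so that one value of it can serve all
  subdomains at once and the inequalities can be summed.\<close>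

lemma spsd_form_diff:
  assumes B: "spsd m B" and x: "x \<in> carrier_vec m" and y: "y \<in> carrier_vec m"
  shows "2 * a * (x \<bullet> (B *\<^sub>v y)) \<le> x \<bullet> (B *\<^sub>v x) + a * a * (y \<bullet> (B *\<^sub>v y))"
proof -
  have Bc: "B \<in> carrier_mat m m" and Bs: "B\<^sup>T = B" using B by (auto simp: spsd_def)
  have ay: "(- a) \<cdot>\<^sub>v y \<in> carrier_vec m" using y by simp
  have Bx: "B *\<^sub>v x \<in> carrier_vec m" and By: "B *\<^sub>v y \<in> carrier_vec m" using Bc x y by auto
  have "0 \<le> (x + (- a) \<cdot>\<^sub>v y) \<bullet> (B *\<^sub>v (x + (- a) \<cdot>\<^sub>v y))"
    using B add_carrier_vec[OF x ay] unfolding spsd_def by blast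
  also have "\<dots> = x \<bullet> (B *\<^sub>v x) + (- a) * (x \<bullet> (B *\<^sub>v y)) + ((- a) * (y \<bullet> (B *\<^sub>v x)) + (- a) * ((- a) * (y \<bullet> (B *\<^sub>v y))))"
    unfolding mult_add_distrib_mat_vec[OF Bc x ay] mult_mat_vec[OF Bc y]
    using x y Bx By by (simp add: add_scalar_prod_distrib[of _ m] scalar_prod_add_distrib[of _ m])
  also have "y \<bullet> (B *\<^sub>v x) = x \<bullet> (B *\<^sub>v y)" by (rule form_sym[OF Bc Bs y x])
  finally show ?thesis by (simp add: algebra_simps)
qed

text \<open>A Penrose identity inserts \<open>B\<close> between two pseudo-inverses, one of which is
  moved across the form. No solution of \<open>B *\<^sub>v p = g\<close> is involved, so
  \<open>g\<close> may have a component in the kernel of \<open>B\<close>.\<close>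

lemma pinv_form:
  assumes B: "spsd m B" and g: "g \<in> carrier_vec m"
  shows "g \<bullet> (pinv B *\<^sub>v g) = (pinv B *\<^sub>v g) \<bullet> (B *\<^sub>v (pinv B *\<^sub>v g))"
proof -
  have Bc: "B \<in> carrier_mat m m" using B by (auto simp: spsd_def)
  note X = pinv_spsd[OF B]
  have Xg: "pinv B *\<^sub>v g \<in> carrier_vec m" using X(1) g by simp
  have BXg: "B *\<^sub>v (pinv B *\<^sub>v g) \<in> carrier_vec m" using Bc Xg by simp
  have "pinv B *\<^sub>v g = pinv B *\<^sub>v (B *\<^sub>v (pinv B *\<^sub>v g))"
    unfolding assoc_mult_mat_vec[OF Bc X(1) g, symmetric]
    using assoc_mult_mat_vec[OF X(1) mult_carrier_mat[OF Bc X(1)] g] assoc_mult_mat[OF X(1) Bc X(1)] X(4) by simp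
  hence "g \<bullet> (pinv B *\<^sub>v g) = g \<bullet> (pinv B *\<^sub>v (B *\<^sub>v (pinv B *\<^sub>v g)))" by (rule arg_cong)
  also have "\<dots> = (B *\<^sub>v (pinv B *\<^sub>v g)) \<bullet> (pinv B *\<^sub>v g)" by (rule form_sym[OF X(1,2) g BXg])
  also have "\<dots> = (pinv B *\<^sub>v g) \<bullet> (B *\<^sub>v (pinv B *\<^sub>v g))" by (rule comm_scalar_prod[OF BXg Xg])
  finally show ?thesis .
qed

text \<open>\<open>B * pinv B\<close> projects orthogonally onto the range of \<open>B\<close>.
  Since \<open>pinv B\<close> commutes with \<open>B\<close>, the residual \<open>r\<close> lies in
  the kernel; it is therefore orthogonal to \<open>g\<close> and to the range, hence to
  itself.\<close>

lemma mult_pinv_of_orthogonal_kernel: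
  assumes B: "spsd m B" and g: "g \<in> carrier_vec m"
    and orth: "\<And>k. k \<in> carrier_vec m \<Longrightarrow> B *\<^sub>v k = 0\<^sub>v m \<Longrightarrow> g \<bullet> k = 0"
  shows "B *\<^sub>v (pinv B *\<^sub>v g) = g"
proof -
  have Bc: "B \<in> carrier_mat m m" and Bs: "B\<^sup>T = B" using B by (auto simp: spsd_def)
  note X = pinv_spsd[OF B]
  define p where "p = pinv B *\<^sub>v g"
  have p: "p \<in> carrier_vec m" unfolding p_def using X(1) g by simp
  have Bp: "B *\<^sub>v p \<in> carrier_vec m" using Bc p by simp
  define r where "r = g - B *\<^sub>v p"
  have r: "r \<in> carrier_vec m" unfolding r_def using g Bp by simp
  have "B *\<^sub>v (B *\<^sub>v p) = B * pinv B * B *\<^sub>v g"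
  proof -
    have "B *\<^sub>v p = B * pinv B *\<^sub>v g" unfolding p_def by (rule assoc_mult_mat_vec[OF Bc X(1) g, symmetric])
    also have "\<dots> = pinv B *\<^sub>v (B *\<^sub>v g)" unfolding X(5) by (rule assoc_mult_mat_vec[OF X(1) Bc g])
    finally show ?thesis
      using assoc_mult_mat_vec[OF Bc X(1) mult_mat_vec_carrier[OF Bc g]]
        assoc_mult_mat_vec[OF mult_carrier_mat[OF Bc X(1)] Bc g] by simp
  qed
  hence "B *\<^sub>v (B *\<^sub>v p) = B *\<^sub>v g" unfolding X(3) .
  hence Br: "B *\<^sub>v r = 0\<^sub>v m" unfolding r_def mult_minus_distrib_mat_vec[OF Bc g Bp] using Bc g by simp
  have "r \<bullet> r = r \<bullet> g - r \<bullet> (B *\<^sub>v p)" unfolding r_def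
    by (rule scalar_prod_minus_distrib[OF r[unfolded r_def] g Bp])
  also have "r \<bullet> g = 0" using orth[OF r Br] comm_scalar_prod[OF r g] by simp
  also have "r \<bullet> (B *\<^sub>v p) = 0" using form_sym[OF Bc Bs r p] Br p by simp
  finally have r0: "r = 0\<^sub>v m" using scalar_prod_self_eq_0[OF r] by simp
  have "g $ i = (B *\<^sub>v p) $ i" if "i < m" for i
    using arg_cong[OF r0, of "\<lambda>x. x $ i"] that g Bp Bc by (simp add: r_def)
  thus ?thesis unfolding p_def[symmetric] using g Bp Bc by (intro eq_vecI) auto
qed

lemma sum_vecs_scalar_prod:
  fixes f :: "nat \<Rightarrow> real vec"
  assumes "finite I" "\<And>i. i \<in> I \<Longrightarrow> f i \<in> carrier_vec m" "x \<in> carrier_vec m"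
  shows "sum_vecs m f I \<bullet> x = (\<Sum>i\<in>I. f i \<bullet> x)"
proof -
  have "sum_vecs m f I \<bullet> x = x \<bullet> sum_vecs m f I"
    by (rule comm_scalar_prod[OF sum_vecs_carrier assms(3)]) (rule assms(2))
  also have "\<dots> = (\<Sum>i\<in>I. x \<bullet> f i)" by (intro scalar_prod_sum_vecs assms)
  also have "\<dots> = (\<Sum>i\<in>I. f i \<bullet> x)" by (intro sum.cong refl comm_scalar_prod[OF assms(3,2)])
  finally show ?thesis .
qed

lemma form_sum_right:
  fixes B :: "real mat"
  assumes "finite J" "\<And>i. i \<in> J \<Longrightarrow> g i \<in> carrier_vec m" "B \<in> carrier_mat m m" "x \<in> carrier_vec m"
  shows "x \<bullet> (B *\<^sub>v sum_vecs m g J) = (\<Sum>j\<in>J. x \<bullet> (B *\<^sub>v g j))"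
proof -
  have "B *\<^sub>v sum_vecs m g J = sum_vecs m (\<lambda>j. B *\<^sub>v g j) J"
    by (intro mult_mat_sum_vecs assms)
  moreover have "x \<bullet> sum_vecs m (\<lambda>j. B *\<^sub>v g j) J = (\<Sum>j\<in>J. x \<bullet> (B *\<^sub>v g j))"
    by (intro scalar_prod_sum_vecs mult_mat_vec_carrier[OF assms(3)] assms)
  ultimately show ?thesis by simp
qed

lemma form_sum_sum:
  fixes B :: "real mat"
  assumes "finite I" "\<And>i. i \<in> I \<Longrightarrow> f i \<in> carrier_vec m" "finite J" "\<And>i. i \<in> J \<Longrightarrow> g i \<in> carrier_vec m"
    "B \<in> carrier_mat m m"
  shows "sum_vecs m f I \<bullet> (B *\<^sub>v sum_vecs m g J) = (\<Sum>i\<in>I. \<Sum>j\<in>J. f i \<bullet> (B *\<^sub>v g j))"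
proof -
  have "B *\<^sub>v sum_vecs m g J \<in> carrier_vec m"
    by (rule mult_mat_vec_carrier[OF assms(5) sum_vecs_carrier]) (rule assms(4))
  hence "sum_vecs m f I \<bullet> (B *\<^sub>v sum_vecs m g J) = (\<Sum>i\<in>I. f i \<bullet> (B *\<^sub>v sum_vecs m g J))"
    using assms(1,2) by (intro sum_vecs_scalar_prod)
  also have "\<dots> = (\<Sum>i\<in>I. \<Sum>j\<in>J. f i \<bullet> (B *\<^sub>v g j))"
    using assms by (intro sum.cong refl form_sum_right)
  finally show ?thesis .
qed

text \<open>One colour per index: within a colour class the energies add up exactly, and across the
  \<open>Nc\<close> classes they add up to within a factor \<open>Nc\<close>.\<close>

lemma coloring_bound:
  fixes f :: "nat \<Rightarrow> real vec"
  assumes A: "spsd n A" and f: "\<And>s. s \<in> I \<Longrightarrow> f s \<in> carrier_vec n" and fin: "finite I"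
    and c: "\<And>s. s \<in> I \<Longrightarrow> c s \<in> {1..Nc::nat}"
    and orth: "\<And>s t. s \<in> I \<Longrightarrow> t \<in> I \<Longrightarrow> s \<noteq> t \<Longrightarrow> c s = c t \<Longrightarrow> f s \<bullet> (A *\<^sub>v f t) = 0"
  shows "sum_vecs n f I \<bullet> (A *\<^sub>v sum_vecs n f I) \<le> real Nc * (\<Sum>s\<in>I. f s \<bullet> (A *\<^sub>v f s))"
proof -
  have Ac: "A \<in> carrier_mat n n" using A by (auto simp: spsd_def)
  define b where "b s t = f s \<bullet> (A *\<^sub>v f t)" for s t
  define S where "S j = {s \<in> I. c s = j}" for j
  define q where "q j = (\<Sum>s\<in>S j. b s s)" for j
  define g where "g j = sum_vecs n f (S j)" for j
  have Sf: "finite (S j)" "S j \<subseteq> I" for j unfolding S_def using fin by auto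
  have g: "g j \<in> carrier_vec n" for j unfolding g_def using f Sf by (intro sum_vecs_carrier) auto
  have group: "(\<Sum>s\<in>I. h s) = (\<Sum>j\<in>{1..Nc}. \<Sum>s\<in>S j. h s)" for h :: "nat \<Rightarrow> real"
    unfolding S_def by (rule sum.group[symmetric]) (use fin c in auto)
  have gg: "g j \<bullet> (A *\<^sub>v g k) = (\<Sum>s\<in>S j. \<Sum>t\<in>S k. b s t)" for j k
    unfolding g_def b_def by (rule form_sum_sum) (use Sf f Ac in auto)
  have gj: "g j \<bullet> (A *\<^sub>v g j) = q j" for j
    unfolding gg q_def
  proof (rule sum.cong[OF refl])
    fix s assume s: "s \<in> S j"
    have "(\<Sum>t\<in>S j. b s t) = (\<Sum>t\<in>S j. if t = s then b s s else 0)"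
      using s orth unfolding b_def S_def by (intro sum.cong) auto
    thus "(\<Sum>t\<in>S j. b s t) = b s s" using s Sf by simp
  qed
  have "sum_vecs n f I \<bullet> (A *\<^sub>v sum_vecs n f I) = (\<Sum>s\<in>I. \<Sum>t\<in>I. b s t)"
    unfolding b_def by (rule form_sum_sum) (use fin f Ac in auto)
  also have "\<dots> = (\<Sum>j\<in>{1..Nc}. \<Sum>s\<in>S j. \<Sum>k\<in>{1..Nc}. \<Sum>t\<in>S k. b s t)"
    by (simp only: group)
  also have "\<dots> = (\<Sum>j\<in>{1..Nc}. \<Sum>k\<in>{1..Nc}. g j \<bullet> (A *\<^sub>v g k))"
    unfolding gg by (intro sum.cong refl sum.swap)
  \<comment> \<open>Each mixed term is at most the mean of the two energies, so every
    \<open>q j\<close> ends up with total weight \<open>Nc\<close>.\<close>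
  also have "\<dots> \<le> (\<Sum>j\<in>{1..Nc}. \<Sum>k\<in>{1..Nc}. (q j + q k) / 2)"
  proof (intro sum_mono)
    fix j k
    show "g j \<bullet> (A *\<^sub>v g k) \<le> (q j + q k) / 2"
      using spsd_form_diff[OF A g[of j] g[of k], of 1] unfolding gj by simp
  qed
  also have "\<dots> = real Nc * (\<Sum>j\<in>{1..Nc}. q j)"
    by (simp add: sum.distrib sum_divide_distrib[symmetric] sum_distrib_left[symmetric] algebra_simps)
  also have "(\<Sum>j\<in>{1..Nc}. q j) = (\<Sum>s\<in>I. b s s)" unfolding q_def group[of "\<lambda>s. b s s"] ..
  finally show ?thesis unfolding b_def .
qed

section \<open>The one-level preconditioner and the two global estimates\<close>

lemma local_settingD:
  assumes "local_setting n N ns R At" "s \<in> {1..N}"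
  shows "R s \<in> carrier_mat (ns s) n" "R s * (R s)\<^sup>T = 1\<^sub>m (ns s)" "spsd (ns s) (At s)"
  using assms unfolding local_setting_def by blast+

lemma one_level_form:
  assumes loc: "local_setting n N ns R At"
  shows "one_level n N R At \<in> carrier_mat n n"
    "\<And>x y. x \<in> carrier_vec n \<Longrightarrow> y \<in> carrier_vec n \<Longrightarrow>
      x \<bullet> (one_level n N R At *\<^sub>v y) = (\<Sum>s\<in>{1..N}. (R s *\<^sub>v x) \<bullet> (pinv (At s) *\<^sub>v (R s *\<^sub>v y)))"
    "spsd n (one_level n N R At)"
proof -
  note L = local_settingD[OF loc]
  note X = pinv_spsd[OF L(3)]
  let ?H = "one_level n N R At"
  have Tc: "(R s)\<^sup>T * pinv (At s) * R s \<in> carrier_mat n n" if "s \<in> {1..N}" for s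
    using L[OF that] X(1)[OF that] by simp
  note S = sum_mats_carrier_mult[of "{1..N}" "\<lambda>s. (R s)\<^sup>T * pinv (At s) * R s" n, OF _ Tc, folded one_level_def]
  show Hc: "?H \<in> carrier_mat n n" by (rule S(1)) simp
  have local_form: "x \<bullet> ((R s)\<^sup>T * pinv (At s) * R s *\<^sub>v y) = (R s *\<^sub>v x) \<bullet> (pinv (At s) *\<^sub>v (R s *\<^sub>v y))"
    if s: "s \<in> {1..N}" and x: "x \<in> carrier_vec n" and y: "y \<in> carrier_vec n" for s x y
  proof -
    note Rs = L(1)[OF s]
    have Rt: "(R s)\<^sup>T \<in> carrier_mat n (ns s)" using Rs by simp
    have Ry: "R s *\<^sub>v y \<in> carrier_vec (ns s)" using Rs y by simp
    have XRy: "pinv (At s) *\<^sub>v (R s *\<^sub>v y) \<in> carrier_vec (ns s)" by (rule mult_mat_vec_carrier[OF X(1)[OF s] Ry])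
    have "(R s)\<^sup>T * pinv (At s) * R s *\<^sub>v y = (R s)\<^sup>T *\<^sub>v (pinv (At s) *\<^sub>v (R s *\<^sub>v y))"
      unfolding assoc_mult_mat_vec[OF mult_carrier_mat[OF Rt X(1)[OF s]] Rs y]
      by (rule assoc_mult_mat_vec[OF Rt X(1)[OF s] Ry])
    thus ?thesis using form_transpose[OF Rt x XRy] comm_scalar_prod[OF XRy mult_mat_vec_carrier[OF Rs x]] by simp
  qed
  show form: "x \<bullet> (?H *\<^sub>v y) = (\<Sum>s\<in>{1..N}. (R s *\<^sub>v x) \<bullet> (pinv (At s) *\<^sub>v (R s *\<^sub>v y)))"
    if x: "x \<in> carrier_vec n" and y: "y \<in> carrier_vec n" for x y
  proof -
    have "?H *\<^sub>v y = sum_vecs n (\<lambda>s. (R s)\<^sup>T * pinv (At s) * R s *\<^sub>v y) {1..N}" by (rule S(2)[OF _ _ y]) auto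
    hence "x \<bullet> (?H *\<^sub>v y) = (\<Sum>s\<in>{1..N}. x \<bullet> ((R s)\<^sup>T * pinv (At s) * R s *\<^sub>v y))"
      using scalar_prod_sum_vecs[OF _ mult_mat_vec_carrier[OF Tc y] x, of "{1..N}"] by simp
    thus ?thesis using local_form[OF _ x y] by simp
  qed
  have Rx: "R s *\<^sub>v x \<in> carrier_vec (ns s)" if "s \<in> {1..N}" "x \<in> carrier_vec n" for s x
    using L(1) that by (intro mult_mat_vec_carrier)
  have sym: "?H\<^sup>T = ?H"
  proof (rule sym_mat_of_form[OF Hc])
    fix x y :: "real vec" assume xy: "x \<in> carrier_vec n" "y \<in> carrier_vec n"
    show "x \<bullet> (?H *\<^sub>v y) = y \<bullet> (?H *\<^sub>v x)" unfolding form[OF xy] form[OF xy(2,1)]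
    proof (rule sum.cong[OF refl])
      fix s assume s: "s \<in> {1..N}"
      show "(R s *\<^sub>v x) \<bullet> (pinv (At s) *\<^sub>v (R s *\<^sub>v y)) = (R s *\<^sub>v y) \<bullet> (pinv (At s) *\<^sub>v (R s *\<^sub>v x))"
        by (rule form_sym[OF X(1,2)[OF s] Rx[OF s xy(1)] Rx[OF s xy(2)]])
    qed
  qed
  have "0 \<le> x \<bullet> (?H *\<^sub>v x)" if x: "x \<in> carrier_vec n" for x
    unfolding form[OF x x]
  proof (rule sum_nonneg)
    fix s assume s: "s \<in> {1..N}"
    show "0 \<le> (R s *\<^sub>v x) \<bullet> (pinv (At s) *\<^sub>v (R s *\<^sub>v x))"
      unfolding pinv_form[OF L(3)[OF s] Rx[OF s x]]
      using L(3)[OF s] mult_mat_vec_carrier[OF X(1)[OF s] Rx[OF s x]] unfolding spsd_def by blast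
  qed
  thus "spsd n ?H" unfolding spsd_def using Hc sym by blast
qed

text \<open>The energy \<open>Q\<close> of the preconditioner is the sum of the local energies of
  \<open>u s\<close>. As \<open>w\<close> does not see \<open>V0\<close>, it is also the pairing of
  \<open>w\<close> with the vector \<open>z\<close> assembled from the modified \<open>u' s\<close>.
  Colouring and \<open>dec\<close> bound the energy of \<open>z\<close> by a multiple of
  \<open>Q\<close>, so \<open>Q\<close> appears on both sides and can be absorbed.\<close>

lemma upper_bound:
  assumes A: "spd n A" and loc: "local_setting n N ns R At" and col: "coloring_constant A N ns R Nc"
    and w: "w \<in> carrier_vec n" and orth: "\<And>v. v \<in> V0 \<Longrightarrow> w \<bullet> (A *\<^sub>v v) = 0" and c: "c > 0"
    and dec: "\<And>s u. s \<in> {1..N} \<Longrightarrow> u \<in> carrier_vec (ns s) \<Longrightarrow> \<exists>u' \<in> carrier_vec (ns s).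
      (R s)\<^sup>T *\<^sub>v (u - u') \<in> V0 \<and>
      c * (((R s)\<^sup>T *\<^sub>v u') \<bullet> (A *\<^sub>v ((R s)\<^sup>T *\<^sub>v u'))) \<le> u \<bullet> (At s *\<^sub>v u)"
  shows "(A *\<^sub>v w) \<bullet> (one_level n N R At *\<^sub>v (A *\<^sub>v w)) \<le> real Nc * inverse c * (w \<bullet> (A *\<^sub>v w))"
proof -
  note L = local_settingD[OF loc]
  have Ac: "A \<in> carrier_mat n n" and As: "A\<^sup>T = A" using A by (auto simp: spd_def)
  have Aw: "A *\<^sub>v w \<in> carrier_vec n" using Ac w by simp
  define u where "u s = pinv (At s) *\<^sub>v (R s *\<^sub>v (A *\<^sub>v w))" for s
  have g: "R s *\<^sub>v (A *\<^sub>v w) \<in> carrier_vec (ns s)" if "s \<in> {1..N}" for s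
    by (rule mult_mat_vec_carrier[OF L(1)[OF that] Aw])
  have u: "u s \<in> carrier_vec (ns s)" if "s \<in> {1..N}" for s
    unfolding u_def by (rule mult_mat_vec_carrier[OF pinv_spsd(1)[OF L(3)[OF that]] g[OF that]])
  have "\<forall>s\<in>{1..N}. \<exists>u'. u' \<in> carrier_vec (ns s) \<and> (R s)\<^sup>T *\<^sub>v (u s - u') \<in> V0 \<and>
      c * (((R s)\<^sup>T *\<^sub>v u') \<bullet> (A *\<^sub>v ((R s)\<^sup>T *\<^sub>v u'))) \<le> u s \<bullet> (At s *\<^sub>v u s)"
    using dec u by blast
  from bchoice[OF this] obtain u' where u': "\<And>s. s \<in> {1..N} \<Longrightarrow> u' s \<in> carrier_vec (ns s)"
    and V: "\<And>s. s \<in> {1..N} \<Longrightarrow> (R s)\<^sup>T *\<^sub>v (u s - u' s) \<in> V0"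
    and le: "\<And>s. s \<in> {1..N} \<Longrightarrow> c * (((R s)\<^sup>T *\<^sub>v u' s) \<bullet> (A *\<^sub>v ((R s)\<^sup>T *\<^sub>v u' s))) \<le> u s \<bullet> (At s *\<^sub>v u s)"
    by blast
  have Rt: "(R s)\<^sup>T \<in> carrier_mat n (ns s)" if "s \<in> {1..N}" for s using L(1)[OF that] by simp
  define f where "f s = (R s)\<^sup>T *\<^sub>v u' s" for s
  have f: "f s \<in> carrier_vec n" if "s \<in> {1..N}" for s
    unfolding f_def by (rule mult_mat_vec_carrier[OF Rt[OF that] u'[OF that]])
  define z where "z = sum_vecs n f {1..N}"
  have z: "z \<in> carrier_vec n" unfolding z_def using f by (rule sum_vecs_carrier)
  define Q where "Q = (A *\<^sub>v w) \<bullet> (one_level n N R At *\<^sub>v (A *\<^sub>v w))"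
  define W where "W = w \<bullet> (A *\<^sub>v w)"
  have W: "W \<ge> 0" unfolding W_def using spsd_of_spd[OF A] w unfolding spsd_def by blast
  have Qu: "Q = (\<Sum>s\<in>{1..N}. (R s *\<^sub>v (A *\<^sub>v w)) \<bullet> u s)" unfolding Q_def u_def
    by (rule one_level_form(2)[OF loc Aw Aw])
  have QE: "Q = (\<Sum>s\<in>{1..N}. u s \<bullet> (At s *\<^sub>v u s))" unfolding Qu u_def
    by (rule sum.cong[OF refl], rule pinv_form[OF L(3) g])
  have "(R s *\<^sub>v (A *\<^sub>v w)) \<bullet> u s = w \<bullet> (A *\<^sub>v f s)" if s: "s \<in> {1..N}" for s
  proof -
    have Ru: "(R s)\<^sup>T *\<^sub>v u s \<in> carrier_vec n" by (rule mult_mat_vec_carrier[OF Rt[OF s] u[OF s]])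
    have "(R s *\<^sub>v (A *\<^sub>v w)) \<bullet> u s = u s \<bullet> (R s *\<^sub>v (A *\<^sub>v w))" by (rule comm_scalar_prod[OF g[OF s] u[OF s]])
    also have "\<dots> = (A *\<^sub>v w) \<bullet> ((R s)\<^sup>T *\<^sub>v u s)" by (rule form_transpose[OF L(1)[OF s] u[OF s] Aw])
    also have "\<dots> = ((R s)\<^sup>T *\<^sub>v u s) \<bullet> (A *\<^sub>v w)" by (rule comm_scalar_prod[OF Aw Ru])
    also have "\<dots> = w \<bullet> (A *\<^sub>v ((R s)\<^sup>T *\<^sub>v u s))" by (rule form_sym[OF Ac As Ru w])
    finally have 1: "(R s *\<^sub>v (A *\<^sub>v w)) \<bullet> u s = w \<bullet> (A *\<^sub>v ((R s)\<^sup>T *\<^sub>v u s))" .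
    have "w \<bullet> (A *\<^sub>v ((R s)\<^sup>T *\<^sub>v (u s - u' s))) = 0" by (rule orth[OF V[OF s]])
    hence "w \<bullet> (A *\<^sub>v ((R s)\<^sup>T *\<^sub>v u s)) - w \<bullet> (A *\<^sub>v f s) = 0"
      unfolding mult_minus_distrib_mat_vec[OF Rt[OF s] u[OF s] u'[OF s]] f_def[symmetric] mult_minus_distrib_mat_vec[OF Ac Ru f[OF s]]
        scalar_prod_minus_distrib[OF w mult_mat_vec_carrier[OF Ac Ru] mult_mat_vec_carrier[OF Ac f[OF s]]] .
    thus ?thesis using 1 by simp
  qed
  hence "Q = (\<Sum>s\<in>{1..N}. w \<bullet> (A *\<^sub>v f s))" unfolding Qu by (rule sum.cong[OF refl])
  also have "\<dots> = w \<bullet> (A *\<^sub>v z)" unfolding z_def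
    by (rule form_sum_right[symmetric]) (use f Ac w in auto)
  finally have Qz: "Q = w \<bullet> (A *\<^sub>v z)" .
  obtain C where C: "{1..N} = (\<Union>j\<in>{1..Nc}. C j)"
    "\<forall>j\<in>{1..Nc}. \<forall>s\<in>C j. \<forall>t\<in>C j. s \<noteq> t \<longrightarrow> R s * A * (R t)\<^sup>T = 0\<^sub>m (ns s) (ns t)"
    using col unfolding coloring_constant_def by (elim exE conjE)
  \<comment> \<open>The colour sets may overlap, so one colour is chosen for each index.\<close>
  define k where "k s = (SOME j. j \<in> {1..Nc} \<and> s \<in> C j)" for s
  have k: "k s \<in> {1..Nc}" "s \<in> C (k s)" if "s \<in> {1..N}" for s
  proof -
    have "s \<in> (\<Union>j\<in>{1..Nc}. C j)" using that C(1) by (rule back_subst)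
    hence "\<exists>j. j \<in> {1..Nc} \<and> s \<in> C j" by blast
    from someI_ex[OF this] show "k s \<in> {1..Nc}" "s \<in> C (k s)" unfolding k_def by blast+
  qed
  have f0: "f s \<bullet> (A *\<^sub>v f t) = 0" if s: "s \<in> {1..N}" and t: "t \<in> {1..N}" and "s \<noteq> t" "k s = k t" for s t
  proof -
    have 0: "R s * A * (R t)\<^sup>T = 0\<^sub>m (ns s) (ns t)" by (rule C(2)[rule_format, OF k(1,2)[OF s] k(2)[OF t, folded that(4)] that(3)])
    have Aft: "A *\<^sub>v f t \<in> carrier_vec n" by (rule mult_mat_vec_carrier[OF Ac f[OF t]])
    have "R s *\<^sub>v (A *\<^sub>v f t) = 0\<^sub>m (ns s) (ns t) *\<^sub>v u' t"
      unfolding 0[symmetric] f_def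
      using assoc_mult_mat_vec[OF mult_carrier_mat[OF L(1)[OF s] Ac] Rt[OF t] u'[OF t]]
        assoc_mult_mat_vec[OF L(1)[OF s] Ac f[OF t]] unfolding f_def by simp
    also have "\<dots> = 0\<^sub>v (ns s)" using u'[OF t] by (intro eq_vecI) auto
    finally have z: "R s *\<^sub>v (A *\<^sub>v f t) = 0\<^sub>v (ns s)" .
    have "f s \<bullet> (A *\<^sub>v f t) = (A *\<^sub>v f t) \<bullet> ((R s)\<^sup>T *\<^sub>v u' s)" unfolding f_def[of s]
      by (rule comm_scalar_prod[OF f[OF s, unfolded f_def] Aft])
    also have "\<dots> = u' s \<bullet> (R s *\<^sub>v (A *\<^sub>v f t))"
      by (rule form_transpose[OF L(1)[OF s] u'[OF s] Aft, symmetric])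
    also have "\<dots> = 0" unfolding z using u'[OF s] by simp
    finally show ?thesis .
  qed
  have "z \<bullet> (A *\<^sub>v z) \<le> real Nc * (\<Sum>s\<in>{1..N}. f s \<bullet> (A *\<^sub>v f s))" unfolding z_def
    by (rule coloring_bound[where c = k, OF spsd_of_spd[OF A]]) (use f k(1) f0 in auto)
  also have "\<dots> \<le> real Nc * (\<Sum>s\<in>{1..N}. inverse c * (u s \<bullet> (At s *\<^sub>v u s)))"
  proof (intro mult_left_mono sum_mono)
    fix s assume s: "s \<in> {1..N}"
    have "a \<le> inverse c * b" if "c * a \<le> b" for a b :: real using that c by (simp add: field_simps)
    from this[OF le[OF s]] show "f s \<bullet> (A *\<^sub>v f s) \<le> inverse c * (u s \<bullet> (At s *\<^sub>v u s))"
      unfolding f_def .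
  qed simp
  also have "\<dots> = real Nc * inverse c * Q" unfolding QE by (simp add: sum_distrib_left mult.assoc)
  finally have zz: "z \<bullet> (A *\<^sub>v z) \<le> real Nc * inverse c * Q" .
  define K where "K = real Nc * inverse c"
  have K: "K \<ge> 0" unfolding K_def using c by simp
  have zw: "z \<bullet> (A *\<^sub>v w) = Q" unfolding Qz by (rule form_sym[OF Ac As z w])
  \<comment> \<open>The energy of \<open>z\<close> is at most \<open>K * Q\<close>, which absorbs
    one of the two copies of \<open>K * Q\<close> and leaves a common factor
    \<open>K\<close>.\<close>
  have "2 * K * Q \<le> z \<bullet> (A *\<^sub>v z) + K * K * W"
    using spsd_form_diff[OF spsd_of_spd[OF A] z w, of K] unfolding zw W_def .
  hence "K * Q \<le> K * (K * W)" using zz unfolding K_def[symmetric] by simp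
  \<comment> \<open>\<open>K = 0\<close> means that there are no colours, and the common factor
    cannot be cancelled. In that case \<open>z\<close> has no energy, so \<open>z\<close> and
    \<open>Q\<close> vanish.\<close>
  moreover have "Q \<le> 0" if "K = 0"
  proof -
    have "z \<bullet> (A *\<^sub>v z) \<le> 0" using zz that unfolding K_def[symmetric] by simp
    moreover have "0 < z \<bullet> (A *\<^sub>v z)" if "z \<noteq> 0\<^sub>v n" using A z that unfolding spd_def by blast
    ultimately have "z = 0\<^sub>v n" by linarith
    thus ?thesis unfolding Qz using mult_mat_zero_vec[OF Ac] w by simp
  qed
  ultimately have "Q \<le> K * W" using K by (cases "K = 0") auto
  thus ?thesis unfolding Q_def K_def W_def .
qed

text \<open>Pairing \<open>w\<close> with its own splitting writes \<open>W\<close> as a sum of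
  local pairings of \<open>y' s\<close> with solutions \<open>p s\<close> of the local problems. The
  energies of the \<open>y' s\<close> add up to at most \<open>K * W\<close>, those of the
  \<open>p s\<close> to \<open>Q\<close>. The alternative \<open>k = 0\<^sub>v (ns s)\<close> in
  \<open>ker\<close> is for non-singular local matrices, since \<open>V0\<close> is an arbitrary set
  here.\<close>

lemma lower_bound:
  assumes A: "spd n A" and loc: "local_setting n N ns R At" and spl: "splitting n A N ns R M Nh"
    and w: "w \<in> carrier_vec n" and orth: "\<And>v. v \<in> V0 \<Longrightarrow> w \<bullet> (A *\<^sub>v v) = 0"
    and Nh: "Nh > 0" and tau: "\<tau> > 0"
    and ker: "\<And>s k. s \<in> {1..N} \<Longrightarrow> k \<in> carrier_vec (ns s) \<Longrightarrow> At s *\<^sub>v k = 0\<^sub>v (ns s) \<Longrightarrow>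
      (R s)\<^sup>T *\<^sub>v k \<in> V0 \<or> k = 0\<^sub>v (ns s)"
    and dec: "\<And>s y. s \<in> {1..N} \<Longrightarrow> y \<in> carrier_vec (ns s) \<Longrightarrow> \<exists>y' \<in> carrier_vec (ns s).
      (R s)\<^sup>T *\<^sub>v (y - y') \<in> V0 \<and> y' \<bullet> (At s *\<^sub>v y') \<le> \<tau> * (y \<bullet> (M s *\<^sub>v y))"
  shows "w \<bullet> (A *\<^sub>v w) \<le> \<tau> * Nh * ((A *\<^sub>v w) \<bullet> (one_level n N R At *\<^sub>v (A *\<^sub>v w)))"
proof -
  note L = local_settingD[OF loc]
  have Ac: "A \<in> carrier_mat n n" and As: "A\<^sup>T = A" using A by (auto simp: spd_def)
  have Aw: "A *\<^sub>v w \<in> carrier_vec n" using Ac w by simp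
  have Rt: "(R s)\<^sup>T \<in> carrier_mat n (ns s)" if "s \<in> {1..N}" for s using L(1)[OF that] by simp
  define g where "g s = R s *\<^sub>v (A *\<^sub>v w)" for s
  have g: "g s \<in> carrier_vec (ns s)" if "s \<in> {1..N}" for s
    unfolding g_def by (rule mult_mat_vec_carrier[OF L(1)[OF that] Aw])
  have wA: "w \<bullet> (A *\<^sub>v ((R s)\<^sup>T *\<^sub>v y)) = g s \<bullet> y" if s: "s \<in> {1..N}" and y: "y \<in> carrier_vec (ns s)" for s y
  proof -
    have Ry: "(R s)\<^sup>T *\<^sub>v y \<in> carrier_vec n" by (rule mult_mat_vec_carrier[OF Rt[OF s] y])
    have "w \<bullet> (A *\<^sub>v ((R s)\<^sup>T *\<^sub>v y)) = ((R s)\<^sup>T *\<^sub>v y) \<bullet> (A *\<^sub>v w)" by (rule form_sym[OF Ac As w Ry])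
    also have "\<dots> = y \<bullet> g s" unfolding g_def by (rule transpose_vec_mult_scalar[OF L(1)[OF s] Aw y])
    also have "\<dots> = g s \<bullet> y" by (rule comm_scalar_prod[OF y g[OF s]])
    finally show ?thesis .
  qed
  obtain y where y: "\<And>s. s \<in> {1..N} \<Longrightarrow> y s \<in> carrier_vec (ns s)"
    and wy: "w = sum_vecs n (\<lambda>s. (R s)\<^sup>T *\<^sub>v y s) {1..N}"
    and My: "(\<Sum>s\<in>{1..N}. y s \<bullet> (M s *\<^sub>v y s)) \<le> Nh * (w \<bullet> (A *\<^sub>v w))"
    using spl w unfolding splitting_def by blast
  obtain y' where y': "\<And>s. s \<in> {1..N} \<Longrightarrow> y' s \<in> carrier_vec (ns s)"
    and V: "\<And>s. s \<in> {1..N} \<Longrightarrow> (R s)\<^sup>T *\<^sub>v (y s - y' s) \<in> V0"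
    and le: "\<And>s. s \<in> {1..N} \<Longrightarrow> y' s \<bullet> (At s *\<^sub>v y' s) \<le> \<tau> * (y s \<bullet> (M s *\<^sub>v y s))"
    using dec[OF _ y] by metis
  define p where "p s = pinv (At s) *\<^sub>v g s" for s
  have p: "p s \<in> carrier_vec (ns s)" if "s \<in> {1..N}" for s
    unfolding p_def by (rule mult_mat_vec_carrier[OF pinv_spsd(1)[OF L(3)[OF that]] g[OF that]])
  \<comment> \<open>A kernel vector is zero or extends into \<open>V0\<close>, to which
    \<open>w\<close> is \<open>A\<close>-orthogonal. Either way \<open>g s\<close> annihilates it,
    so the local problem is solvable.\<close>
  have gp: "At s *\<^sub>v p s = g s" if s: "s \<in> {1..N}" for s
    unfolding p_def
  proof (rule mult_pinv_of_orthogonal_kernel[OF L(3)[OF s] g[OF s]])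
    fix k assume k: "k \<in> carrier_vec (ns s)" "At s *\<^sub>v k = 0\<^sub>v (ns s)"
    show "g s \<bullet> k = 0" using ker[OF s k] wA[OF s k(1)] orth g[OF s] by auto
  qed
  define Q where "Q = (A *\<^sub>v w) \<bullet> (one_level n N R At *\<^sub>v (A *\<^sub>v w))"
  define W where "W = w \<bullet> (A *\<^sub>v w)"
  have QE: "Q = (\<Sum>s\<in>{1..N}. p s \<bullet> (At s *\<^sub>v p s))"
    unfolding Q_def one_level_form(2)[OF loc Aw Aw] g_def[symmetric] p_def
    by (rule sum.cong[OF refl], rule pinv_form[OF L(3) g])
  have "W = w \<bullet> (A *\<^sub>v sum_vecs n (\<lambda>s. (R s)\<^sup>T *\<^sub>v y s) {1..N})" unfolding W_def
    using arg_cong[OF wy, of "\<lambda>x. w \<bullet> (A *\<^sub>v x)"] .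
  also have "\<dots> = (\<Sum>s\<in>{1..N}. w \<bullet> (A *\<^sub>v ((R s)\<^sup>T *\<^sub>v y s)))"
    by (intro form_sum_right[OF _ _ Ac w] finite_atLeastAtMost mult_mat_vec_carrier[OF Rt y])
  also have "\<dots> = (\<Sum>s\<in>{1..N}. y' s \<bullet> (At s *\<^sub>v p s))"
  proof (rule sum.cong[OF refl])
    fix s assume s: "s \<in> {1..N}"
    \<comment> \<open>Passing from \<open>y s\<close> to \<open>y' s\<close> changes the extension
      only by an element of \<open>V0\<close>.\<close>
    have "g s \<bullet> (y s - y' s) = 0" using orth[OF V[OF s]] wA[OF s] y[OF s] y'[OF s] by simp
    hence "g s \<bullet> y s = g s \<bullet> y' s"
      unfolding scalar_prod_minus_distrib[OF g[OF s] y[OF s] y'[OF s]] by simp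
    thus "w \<bullet> (A *\<^sub>v ((R s)\<^sup>T *\<^sub>v y s)) = y' s \<bullet> (At s *\<^sub>v p s)"
      unfolding wA[OF s y[OF s]] gp[OF s] using comm_scalar_prod[OF g[OF s] y'[OF s]] by simp
  qed
  finally have WE: "W = (\<Sum>s\<in>{1..N}. y' s \<bullet> (At s *\<^sub>v p s))" .
  \<comment> \<open>The reciprocal of the eigenvalue bound: \<tau> is the local loss in passing from
    \<open>M s\<close> to \<open>At s\<close>, and \<open>Nh\<close> is the cost of the
    splitting.\<close>
  define K where "K = \<tau> * Nh"
  have K: "K > 0" unfolding K_def using tau Nh by simp
  have "2 * K * W = (\<Sum>s\<in>{1..N}. 2 * K * (y' s \<bullet> (At s *\<^sub>v p s)))" unfolding WE by (simp add: sum_distrib_left)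
  also have "\<dots> \<le> (\<Sum>s\<in>{1..N}. \<tau> * (y s \<bullet> (M s *\<^sub>v y s)) + K * K * (p s \<bullet> (At s *\<^sub>v p s)))"
  proof (rule sum_mono)
    fix s assume s: "s \<in> {1..N}"
    show "2 * K * (y' s \<bullet> (At s *\<^sub>v p s)) \<le> \<tau> * (y s \<bullet> (M s *\<^sub>v y s)) + K * K * (p s \<bullet> (At s *\<^sub>v p s))"
      using spsd_form_diff[OF L(3)[OF s] y'[OF s] p[OF s], of K] le[OF s] by simp
  qed
  also have "\<dots> = \<tau> * (\<Sum>s\<in>{1..N}. y s \<bullet> (M s *\<^sub>v y s)) + K * K * Q"
    unfolding QE by (simp add: sum.distrib sum_distrib_left)
  also have "\<dots> \<le> K * W + K * K * Q"
    using mult_left_mono[OF My, of \<tau>] tau unfolding K_def W_def by simp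
  finally have "K * W \<le> K * (K * Q)" by simp
  hence "W \<le> K * Q" using K by simp
  thus ?thesis unfolding W_def Q_def K_def .
qed

lemma energy_norm_sq: "spsd m B \<Longrightarrow> x \<in> carrier_vec m \<Longrightarrow> (energy_norm B x)\<^sup>2 = x \<bullet> (B *\<^sub>v x)"
  unfolding energy_norm_def spsd_def by simp

lemma pou_splitting_splitting:
  assumes loc: "local_setting n N ns R At" and pou: "pou_splitting n A N ns R M Nh"
  shows "splitting n A N ns R M Nh"
proof -
  note L = local_settingD[OF loc]
  obtain D where D: "\<forall>s\<in>{1..N}. spd (ns s) (D s)"
    and one: "1\<^sub>m n = sum_mats n (\<lambda>s. (R s)\<^sup>T * D s * R s) {1..N}"
    and le: "\<forall>x \<in> carrier_vec n. (\<Sum>s \<in> {1..N}. (D s *\<^sub>v (R s *\<^sub>v x)) \<bullet> (M s *\<^sub>v (D s *\<^sub>v (R s *\<^sub>v x))))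
             \<le> Nh * (x \<bullet> (A *\<^sub>v x))"
    using pou unfolding pou_splitting_def by (elim exE conjE)
  have Dc: "D s \<in> carrier_mat (ns s) (ns s)" if "s \<in> {1..N}" for s using D that unfolding spd_def by blast
  show ?thesis unfolding splitting_def
  proof
    fix x :: "real vec" assume x: "x \<in> carrier_vec n"
    define y where "y s = D s *\<^sub>v (R s *\<^sub>v x)" for s
    have Rx: "R s *\<^sub>v x \<in> carrier_vec (ns s)" if "s \<in> {1..N}" for s by (rule mult_mat_vec_carrier[OF L(1)[OF that] x])
    have y: "y s \<in> carrier_vec (ns s)" if "s \<in> {1..N}" for s
      unfolding y_def by (rule mult_mat_vec_carrier[OF Dc[OF that] Rx[OF that]])
    have Tc: "(R s)\<^sup>T * D s * R s \<in> carrier_mat n n" if "s \<in> {1..N}" for s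
      using L(1)[OF that] Dc[OF that] by simp
    have Ry: "(R s)\<^sup>T *\<^sub>v y s = (R s)\<^sup>T * D s * R s *\<^sub>v x" if s: "s \<in> {1..N}" for s
    proof -
      have Rt: "(R s)\<^sup>T \<in> carrier_mat n (ns s)" using L(1)[OF s] by simp
      show ?thesis unfolding y_def assoc_mult_mat_vec[OF mult_carrier_mat[OF Rt Dc[OF s]] L(1)[OF s] x]
        by (rule assoc_mult_mat_vec[OF Rt Dc[OF s] Rx[OF s], symmetric])
    qed
    have "x = 1\<^sub>m n *\<^sub>v x" using x by simp
    also have "\<dots> = sum_vecs n (\<lambda>s. (R s)\<^sup>T * D s * R s *\<^sub>v x) {1..N}"
      unfolding one by (rule sum_mats_carrier_mult(2)) (use Tc x in auto)
    also have "\<dots> = sum_vecs n (\<lambda>s. (R s)\<^sup>T *\<^sub>v y s) {1..N}"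
    proof -
      interpret vec_space "TYPE(real)" n .
      show ?thesis using Ry mult_mat_vec_carrier[OF Tc x] unfolding finsum_vec by (intro finsum_cong2) auto
    qed
    finally have "x = sum_vecs n (\<lambda>s. (R s)\<^sup>T *\<^sub>v y s) {1..N}" .
    moreover have "(\<Sum>s \<in> {1..N}. y s \<bullet> (M s *\<^sub>v y s)) \<le> Nh * (x \<bullet> (A *\<^sub>v x))"
      unfolding y_def by (rule le[rule_format, OF x])
    ultimately show "\<exists>y. (\<forall>s \<in> {1..N}. y s \<in> carrier_vec (ns s)) \<and>
        x = sum_vecs n (\<lambda>s. (R s)\<^sup>T *\<^sub>v y s) {1..N} \<and>
        (\<Sum>s \<in> {1..N}. y s \<bullet> (M s *\<^sub>v y s)) \<le> Nh * (x \<bullet> (A *\<^sub>v x))"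
      using y by (intro exI[of _ y] conjI ballI)
  qed
qed

section \<open>Local decompositions for the individual coarse spaces\<close>

lemma vec_add_diff_cancel:
  fixes k h :: "real vec"
  assumes "k \<in> carrier_vec m" "h \<in> carrier_vec m"
  shows "k + h - h = k" "k + h - k = h"
  using assms by (auto intro!: eq_vecI)

text \<open>What the projection \<open>P\<close> removes from the extension of \<open>u\<close> lies
  in \<open>mat_kernel P\<close>, so it is the extension of a kernel vector \<open>k\<close> of
  \<open>At s\<close>. With \<open>u' = u - k\<close> the extension of \<open>u'\<close> is exactly
  the projected vector whose energy the constant \<open>Cs\<close> controls.\<close>

lemma natural_local:
  assumes loc: "local_setting n N ns R At" and A: "spd n A" and Cs: "C_sharp_constant n A N ns R At Cs"
    and V: "\<forall>s \<in> {1..N}. (\<lambda>y. (R s)\<^sup>T *\<^sub>v y) ` mat_kernel (At s) \<subseteq> V0"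
    and s: "s \<in> {1..N}" and u: "u \<in> carrier_vec (ns s)"
  shows "\<exists>u' \<in> carrier_vec (ns s). (R s)\<^sup>T *\<^sub>v (u - u') \<in> V0 \<and>
      Cs * (((R s)\<^sup>T *\<^sub>v u') \<bullet> (A *\<^sub>v ((R s)\<^sup>T *\<^sub>v u'))) \<le> u \<bullet> (At s *\<^sub>v u)"
proof -
  note L = local_settingD[OF loc s]
  have Rt: "(R s)\<^sup>T \<in> carrier_mat n (ns s)" using L(1) by simp
  have Atc: "At s \<in> carrier_mat (ns s) (ns s)" using L(3) by (simp add: spsd_def)
  have pos: "0 < Cs" using Cs unfolding C_sharp_constant_def by blast
  obtain P where P: "is_orth_proj n A ((\<lambda>y. (R s)\<^sup>T *\<^sub>v y) ` mat_kernel (At s)) P"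
    and le: "\<forall>x \<in> carrier_vec (ns s).
      (energy_norm A (P *\<^sub>v ((R s)\<^sup>T *\<^sub>v x)))\<^sup>2 \<le> inverse Cs * (energy_norm (At s) x)\<^sup>2"
    using Cs s unfolding C_sharp_constant_def by blast
  have Pc: "P \<in> carrier_mat n n" and PP: "P * P = P"
    and ker: "mat_kernel P = (\<lambda>y. (R s)\<^sup>T *\<^sub>v y) ` mat_kernel (At s)" using P unfolding is_orth_proj_def by blast+
  define x where "x = (R s)\<^sup>T *\<^sub>v u"
  have x: "x \<in> carrier_vec n" unfolding x_def by (rule mult_mat_vec_carrier[OF Rt u])
  have Px: "P *\<^sub>v x \<in> carrier_vec n" by (rule mult_mat_vec_carrier[OF Pc x])
  have "P *\<^sub>v (x - P *\<^sub>v x) = P *\<^sub>v x - P *\<^sub>v x"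
    unfolding mult_minus_distrib_mat_vec[OF Pc x Px] assoc_mult_mat_vec[OF Pc Pc x, symmetric] PP ..
  hence "x - P *\<^sub>v x \<in> mat_kernel P" using Px x Pc unfolding mat_kernel_def by simp
  then obtain k where k: "k \<in> mat_kernel (At s)" "x - P *\<^sub>v x = (R s)\<^sup>T *\<^sub>v k" unfolding ker by blast
  have kc: "k \<in> carrier_vec (ns s)" using k(1) Atc unfolding mat_kernel_def by simp
  define u' where "u' = u - k"
  have u': "u' \<in> carrier_vec (ns s)" unfolding u'_def using u kc by simp
  have "u - u' = k" unfolding u'_def using u kc by (intro eq_vecI) auto
  hence 1: "(R s)\<^sup>T *\<^sub>v (u - u') \<in> V0" using V s k(1) by blast
  have "(R s)\<^sup>T *\<^sub>v u' = x - (R s)\<^sup>T *\<^sub>v k" unfolding u'_def x_def by (rule mult_minus_distrib_mat_vec[OF Rt u kc])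
  also have "\<dots> = x - (x - P *\<^sub>v x)" unfolding k(2) ..
  also have "\<dots> = P *\<^sub>v x" using x Px Pc by (intro eq_vecI) auto
  finally have Ru': "(R s)\<^sup>T *\<^sub>v u' = P *\<^sub>v x" .
  have "(P *\<^sub>v x) \<bullet> (A *\<^sub>v (P *\<^sub>v x)) \<le> inverse Cs * (u \<bullet> (At s *\<^sub>v u))"
    using le[rule_format, OF u] unfolding x_def[symmetric] energy_norm_sq[OF spsd_of_spd[OF A] Px] energy_norm_sq[OF L(3) u] .
  moreover have "Cs * a \<le> b" if "a \<le> inverse Cs * b" for a b using that pos by (simp add: field_simps)
  ultimately have "Cs * (((R s)\<^sup>T *\<^sub>v u') \<bullet> (A *\<^sub>v ((R s)\<^sup>T *\<^sub>v u'))) \<le> u \<bullet> (At s *\<^sub>v u)" unfolding Ru' by blast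
  thus ?thesis using u' 1 by blast
qed

text \<open>\<open>u'\<close> is the high part of \<open>u\<close>, and \<open>V0\<close> absorbs
  the low part. As \<open>R s\<close> is a left inverse of its transpose, the transpose is
  injective, which makes the right-hand matrix of the eigenproblem definite.\<close>

lemma geneo_max_local:
  assumes loc: "local_setting n N ns R At" and A: "spd n A" and tau: "\<tau> > 0"
    and V: "\<forall>s \<in> {1..N}. (\<lambda>y. (R s)\<^sup>T *\<^sub>v y) ` Y_L \<tau> (At s) (R s * A * (R s)\<^sup>T) \<subseteq> V0"
    and s: "s \<in> {1..N}" and u: "u \<in> carrier_vec (ns s)"
  shows "\<exists>u' \<in> carrier_vec (ns s). (R s)\<^sup>T *\<^sub>v (u - u') \<in> V0 \<and>
      \<tau> * (((R s)\<^sup>T *\<^sub>v u') \<bullet> (A *\<^sub>v ((R s)\<^sup>T *\<^sub>v u'))) \<le> u \<bullet> (At s *\<^sub>v u)"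
proof -
  note L = local_settingD[OF loc s]
  have Rt: "(R s)\<^sup>T \<in> carrier_mat n (ns s)" using L(1) by simp
  have Ac: "A \<in> carrier_mat n n" using A by (simp add: spd_def)
  have inj: "c = 0\<^sub>v (ns s)" if c: "c \<in> carrier_vec (ns s)" "(R s)\<^sup>T *\<^sub>v c = 0\<^sub>v n" for c
  proof -
    have "R s *\<^sub>v ((R s)\<^sup>T *\<^sub>v c) = c" unfolding assoc_mult_mat_vec[OF L(1) Rt c(1), symmetric] L(2) using c(1) by simp
    thus ?thesis unfolding c(2) mult_mat_zero_vec[OF L(1)] by (rule sym)
  qed
  have B: "spd (ns s) (R s * A * (R s)\<^sup>T)" by (rule spd_congruence[OF A L(1) inj])
  obtain k h where kh: "k \<in> carrier_vec (ns s)" "h \<in> carrier_vec (ns s)"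
    "k \<in> Y_L \<tau> (At s) (R s * A * (R s)\<^sup>T)" "u = k + h"
    "\<tau> * (h \<bullet> (R s * A * (R s)\<^sup>T *\<^sub>v h)) \<le> u \<bullet> (At s *\<^sub>v u)"
    using generalized_eigen_split[OF L(3) B tau u] by blast
  have "u - h = k" unfolding kh(4) by (rule vec_add_diff_cancel(1)[OF kh(1,2)])
  hence "(R s)\<^sup>T *\<^sub>v (u - h) \<in> V0" using V s kh(3) by blast
  thus ?thesis using kh(2,5) unfolding congruence_form[OF Ac L(1) kh(2,2)] by blast
qed

lemma Y_H_zero: "MA \<in> carrier_mat m m \<Longrightarrow> 0\<^sub>v m \<in> Y_H \<tau> MA MB"
  unfolding Y_H_def by (simp only: carrier_matD(2) lin_span_zero)

text \<open>The definite matrix is now \<open>At\<close>, so the eigenproblem is reversed and the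
  threshold becomes \<open>inverse \<tau>\<close>. \<open>V0\<close> absorbs the low part, and the
  kept high part obeys the first estimate of \<open>generalized_eigen_split\<close>.\<close>

lemma geneo_min_local_a:
  assumes At: "spsd m At" and M: "spsd m M" and tau: "\<tau> > 0" and inv: "invertible_mat At"
    and V: "(\<lambda>y. B *\<^sub>v y) ` Y_L (inverse \<tau>) M At \<subseteq> V0"
    and y: "y \<in> carrier_vec m"
  shows "\<exists>y' \<in> carrier_vec m. B *\<^sub>v (y - y') \<in> V0 \<and> y' \<bullet> (At *\<^sub>v y') \<le> \<tau> * (y \<bullet> (M *\<^sub>v y))"
proof -
  have it: "inverse \<tau> > 0" using tau by simp
  obtain k h where kh: "k \<in> carrier_vec m" "h \<in> carrier_vec m"
    "k \<in> Y_L (inverse \<tau>) M At" "y = k + h" "inverse \<tau> * (h \<bullet> (At *\<^sub>v h)) \<le> y \<bullet> (M *\<^sub>v y)"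
    using generalized_eigen_split[OF M invertible_spsd_spd[OF At inv] it y] by blast
  have "y - h = k" unfolding kh(4) by (rule vec_add_diff_cancel(1)[OF kh(1,2)])
  hence "B *\<^sub>v (y - h) \<in> V0" using subsetD[OF V imageI[OF kh(3)]] by simp
  moreover have "a \<le> \<tau> * b" if "inverse \<tau> * a \<le> b" for a b using that tau by (simp add: field_simps)
  ultimately show ?thesis using kh(2,5) by blast
qed

text \<open>With \<open>M\<close> definite on the right-hand side, the low part is kept and
  \<open>V0\<close> absorbs the high part. Zero serves as the summand from
  \<open>mat_kernel At\<close>; the kernel itself is in \<open>V0\<close> to make the local problems
  of \<open>lower_bound\<close> solvable.\<close>

lemma geneo_min_local_b:
  assumes At: "spsd m At" and M: "spsd m M" and tau: "\<tau> > 0" and inv: "invertible_mat M"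
    and V: "(\<lambda>y. B *\<^sub>v y) ` (mat_kernel At + Y_H \<tau> At M) \<subseteq> V0"
    and y: "y \<in> carrier_vec m"
  shows "\<exists>y' \<in> carrier_vec m. B *\<^sub>v (y - y') \<in> V0 \<and> y' \<bullet> (At *\<^sub>v y') \<le> \<tau> * (y \<bullet> (M *\<^sub>v y))"
proof -
  have Atc: "At \<in> carrier_mat m m" using At by (simp add: spsd_def)
  obtain k h where kh: "k \<in> carrier_vec m" "h \<in> carrier_vec m" "h \<in> Y_H \<tau> At M" "y = k + h"
    "k \<bullet> (At *\<^sub>v k) \<le> \<tau> * (y \<bullet> (M *\<^sub>v y))"
    using generalized_eigen_split[OF At invertible_spsd_spd[OF M inv] tau y] by blast
  have "y - k = h" unfolding kh(4) by (rule vec_add_diff_cancel(2)[OF kh(1,2)])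
  also have "h = 0\<^sub>v m + h" using kh(2) by simp
  also have "\<dots> \<in> mat_kernel At + Y_H \<tau> At M"
  proof (rule set_plus_intro[OF _ kh(3)])
    show "0\<^sub>v m \<in> mat_kernel At" using Atc mult_mat_zero_vec[OF Atc] unfolding mat_kernel_def by simp
  qed
  finally have "B *\<^sub>v (y - k) \<in> V0" by (rule subsetD[OF V imageI])
  thus ?thesis using kh(1,5) by blast
qed

text \<open>The orthogonal projection \<open>W W\<^sup>T\<close> onto the range of \<open>M\<close> changes neither \<open>M y\<close> nor
  the energy of \<open>y\<close>, and the compression of \<open>M\<close> to its range is definite, which reduces this case
  to a generalized eigenproblem on the range.\<close>

lemma geneo_min_local_c:
  assumes At: "spsd m At" and M: "spsd m M" and tau: "\<tau> > 0"
    and W: "W \<in> carrier_mat m r" "orthonormal_basis_mat m (mat_range M) W"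
    and V: "(\<lambda>y. B *\<^sub>v y) ` (mat_kernel At + mat_kernel M +
      (\<lambda>y. W *\<^sub>v y) ` Y_H \<tau> (W\<^sup>T * At * W) (W\<^sup>T * M * W)) \<subseteq> V0"
    and y: "y \<in> carrier_vec m"
  shows "\<exists>y' \<in> carrier_vec m. B *\<^sub>v (y - y') \<in> V0 \<and> y' \<bullet> (At *\<^sub>v y') \<le> \<tau> * (y \<bullet> (M *\<^sub>v y))"
proof -
  have Atc: "At \<in> carrier_mat m m" using At by (simp add: spsd_def)
  have Mc: "M \<in> carrier_mat m m" and Ms: "M\<^sup>T = M" using M by (auto simp: spsd_def)
  have Wt: "W\<^sup>T \<in> carrier_mat r m" using W by simp
  have span: "lin_span m (set (cols W)) = mat_range M"
    using W(2) unfolding orthonormal_basis_mat_def is_basis_def by (elim conjE)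
  have on: "\<forall>i < dim_col W. \<forall>j < dim_col W. col W i \<bullet> col W j = (if i = j then 1 else 0)"
    using W(2) unfolding orthonormal_basis_mat_def by (rule conjunct2)
  have WW: "W\<^sup>T * W = 1\<^sub>m r" using on W(1) by (intro eq_matI) auto
  have Wc: "W *\<^sub>v c \<in> carrier_vec m" if "c \<in> carrier_vec r" for c by (rule mult_mat_vec_carrier[OF W(1) that])
  have WtW: "W\<^sup>T *\<^sub>v (W *\<^sub>v c) = c" if "c \<in> carrier_vec r" for c
    unfolding assoc_mult_mat_vec[OF Wt W(1) that, symmetric] WW using that by simp
  have form: "x \<bullet> (W\<^sup>T * X * W *\<^sub>v x') = (W *\<^sub>v x) \<bullet> (X *\<^sub>v (W *\<^sub>v x'))"
    if "X \<in> carrier_mat m m" "x \<in> carrier_vec r" "x' \<in> carrier_vec r" for X x x'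
    using congruence_form[OF that(1) Wt that(2,3)] by simp
  have in_range: "\<exists>x \<in> carrier_vec m. W *\<^sub>v c = M *\<^sub>v x" if "c \<in> carrier_vec r" for c
  proof -
    have "W *\<^sub>v c \<in> lin_span m (set (cols W))"
    proof (rule mult_mat_vec_in_span[OF W(1) that])
      show "set (cols W) \<subseteq> carrier_vec m" using cols_dim[of W] W(1) by simp
      show "col W i \<in> set (cols W)" if "i < r" for i using that W(1) unfolding cols_def by auto
    qed
    thus ?thesis unfolding span mat_range_def carrier_matD(2)[OF Mc] by blast
  qed
  have MA: "spsd r (W\<^sup>T * At * W)" using spsd_congruence[OF At Wt] by simp
  have MB: "spd r (W\<^sup>T * M * W)"
  proof (rule spd_of_spsd)
    show "spsd r (W\<^sup>T * M * W)" using spsd_congruence[OF M Wt] by simp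
    fix c assume c: "c \<in> carrier_vec r" and "c \<bullet> (W\<^sup>T * M * W *\<^sub>v c) = 0"
    hence "(W *\<^sub>v c) \<bullet> (M *\<^sub>v (W *\<^sub>v c)) = 0" using form[OF Mc c c] by simp
    hence MWc: "M *\<^sub>v (W *\<^sub>v c) = 0\<^sub>v m" by (rule spsd_form_zero[OF M Wc[OF c]])
    \<comment> \<open>\<open>W *\<^sub>v c\<close> lies in the kernel of \<open>M\<close> and in its
      range, which are orthogonal because \<open>M\<close> is symmetric.\<close>
    obtain x where x: "x \<in> carrier_vec m" "W *\<^sub>v c = M *\<^sub>v x" using in_range[OF c] by blast
    have "(W *\<^sub>v c) \<bullet> (M *\<^sub>v x) = x \<bullet> (M *\<^sub>v (W *\<^sub>v c))" by (rule form_sym[OF Mc Ms Wc[OF c] x(1)])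
    hence "(W *\<^sub>v c) \<bullet> (W *\<^sub>v c) = 0" unfolding MWc x(2)[symmetric] using x(1) by simp
    hence "W *\<^sub>v c = 0\<^sub>v m" by (rule scalar_prod_self_eq_0[OF Wc[OF c]])
    thus "c = 0\<^sub>v r" using WtW[OF c] mult_mat_zero_vec[OF Wt] by simp
  qed
  define c where "c = W\<^sup>T *\<^sub>v y"
  have c: "c \<in> carrier_vec r" unfolding c_def by (rule mult_mat_vec_carrier[OF Wt y])
  define z where "z = y - W *\<^sub>v c"
  have z: "z \<in> carrier_vec m" unfolding z_def using y Wc[OF c] by simp
  have Wtz: "W\<^sup>T *\<^sub>v z = 0\<^sub>v r"
    unfolding z_def mult_minus_distrib_mat_vec[OF Wt y Wc[OF c]] WtW[OF c] c_def[symmetric] using c by simp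
  \<comment> \<open>\<open>M *\<^sub>v z\<close> is a combination of columns of \<open>W\<close>,
    all of which are orthogonal to \<open>z\<close>. Hence \<open>z\<close> has zero
    \<open>M\<close>-energy and lies in the kernel of \<open>M\<close>.\<close>
  have "M *\<^sub>v z \<in> mat_range M" unfolding mat_range_def carrier_matD(2)[OF Mc] by (rule imageI[OF z])
  then obtain d where d: "d \<in> carrier_vec r" "M *\<^sub>v z = W *\<^sub>v d"
    using lin_span_cols[OF W(1), of "M *\<^sub>v z"] unfolding span by blast
  have "z \<bullet> (M *\<^sub>v z) = d \<bullet> (W\<^sup>T *\<^sub>v z)" unfolding d(2) by (rule form_transpose[OF W(1) z d(1)])
  hence "z \<bullet> (M *\<^sub>v z) = 0" unfolding Wtz using d(1) by simp
  hence Mz: "M *\<^sub>v z = 0\<^sub>v m" by (rule spsd_form_zero[OF M z])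
  hence My: "M *\<^sub>v y = M *\<^sub>v (W *\<^sub>v c)"
  proof -
    have "y = W *\<^sub>v c + z" unfolding z_def using y Wc[OF c] W(1) by (intro eq_vecI) auto
    hence "M *\<^sub>v y = M *\<^sub>v (W *\<^sub>v c) + M *\<^sub>v z" using mult_add_distrib_mat_vec[OF Mc Wc[OF c] z] by simp
    thus ?thesis unfolding Mz using mult_mat_vec_carrier[OF Mc Wc[OF c]] by simp
  qed
  have yMy: "y \<bullet> (M *\<^sub>v y) = c \<bullet> (W\<^sup>T * M * W *\<^sub>v c)"
    unfolding form[OF Mc c c] using form_sym[OF Mc Ms y Wc[OF c]] unfolding My .
  obtain k h where kh: "k \<in> carrier_vec r" "h \<in> carrier_vec r"
    "h \<in> Y_H \<tau> (W\<^sup>T * At * W) (W\<^sup>T * M * W)" "c = k + h"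
    "k \<bullet> (W\<^sup>T * At * W *\<^sub>v k) \<le> \<tau> * (c \<bullet> (W\<^sup>T * M * W *\<^sub>v c))"
    using generalized_eigen_split[OF MA MB tau c] by blast
  \<comment> \<open>The kept vector is \<open>W *\<^sub>v k\<close>. The discarded one consists of
    \<open>z\<close>, which lies in the kernel of \<open>M\<close>, and of the lifted high
    part.\<close>
  have "y - W *\<^sub>v k = z + W *\<^sub>v h"
    unfolding z_def kh(4) mult_add_distrib_mat_vec[OF W(1) kh(1,2)] using y Wc[OF kh(1)] Wc[OF kh(2)] W(1)
    by (intro eq_vecI) auto
  also have "z + W *\<^sub>v h = (0\<^sub>v m + z) + W *\<^sub>v h" using z by simp
  also have "\<dots> \<in> mat_kernel At + mat_kernel M + (\<lambda>y. W *\<^sub>v y) ` Y_H \<tau> (W\<^sup>T * At * W) (W\<^sup>T * M * W)"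
  proof (intro set_plus_intro imageI kh(3))
    show "0\<^sub>v m \<in> mat_kernel At" using Atc mult_mat_zero_vec[OF Atc] unfolding mat_kernel_def by simp
    show "z \<in> mat_kernel M" using Mc z Mz unfolding mat_kernel_def by simp
  qed
  finally have "B *\<^sub>v (y - W *\<^sub>v k) \<in> V0" by (rule subsetD[OF V imageI])
  moreover have "(W *\<^sub>v k) \<bullet> (At *\<^sub>v (W *\<^sub>v k)) \<le> \<tau> * (y \<bullet> (M *\<^sub>v y))"
    using kh(5) unfolding form[OF Atc kh(1) kh(1)] yMy .
  ultimately show ?thesis using Wc[OF kh(1)] by blast
qed

section \<open>From energy estimates to spectral bounds\<close>

lemma coarse_orthogonal:
  assumes A: "spd n A" and co: "coarse_setting n V0 R0"
    and w: "w \<in> carrier_vec n" "P0 n A R0 *\<^sub>v w = w" and v: "v \<in> V0"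
  shows "w \<bullet> (A *\<^sub>v v) = 0"
proof -
  note P = coarse_projection[OF A co]
  have Ac: "A \<in> carrier_mat n n" and As: "A\<^sup>T = A" using A by (auto simp: spd_def)
  have vc: "v \<in> carrier_vec n" using P(5) v by blast
  have "w \<bullet> (A *\<^sub>v v) = v \<bullet> (A *\<^sub>v w)" by (rule form_sym[OF Ac As w(1) vc])
  also have "\<dots> = v \<bullet> (A *\<^sub>v (P0 n A R0 *\<^sub>v w))" unfolding w(2) ..
  also have "\<dots> = v \<bullet> (A * P0 n A R0 *\<^sub>v w)" unfolding assoc_mult_mat_vec[OF Ac P(1) w(1)] ..
  also have "\<dots> = w \<bullet> (A * P0 n A R0 *\<^sub>v v)" by (rule form_sym[OF mult_carrier_mat[OF Ac P(1)] P(2) vc w(1)])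
  also have "\<dots> = 0" unfolding assoc_mult_mat_vec[OF Ac P(1) vc] P(4)[OF v] mult_mat_zero_vec[OF Ac] using w(1) by simp
  finally show ?thesis .
qed

text \<open>The fixed-point condition on \<open>w\<close> is traded for
  \<open>A\<close>-orthogonality to \<open>V0\<close>, and \<open>w \<noteq> 0\<close> for positive
  energy; this is the form in which the global estimates use \<open>w\<close> and in which the
  energy can be divided out.\<close>

lemma two_level_eigvals:
  assumes A: "spd n A" and loc: "local_setting n N ns R At" and co: "coarse_setting n V0 R0"
    and H_eq: "H = one_level n N R At"
  shows "z \<in> eigvals (H * A * P0 n A R0) \<Longrightarrow> \<exists>l. z = complex_of_real l \<and> (l = 0 \<or>
      (\<exists>w \<in> carrier_vec n. 0 < w \<bullet> (A *\<^sub>v w) \<and> (\<forall>v\<in>V0. w \<bullet> (A *\<^sub>v v) = 0) \<and>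
        l * (w \<bullet> (A *\<^sub>v w)) = (A *\<^sub>v w) \<bullet> (H *\<^sub>v (A *\<^sub>v w))))"
    and "z \<in> eigvals (hybrid n A R0 H * A) \<Longrightarrow> \<exists>l. z = complex_of_real l \<and> (l = 1 \<or>
      (\<exists>w \<in> carrier_vec n. 0 < w \<bullet> (A *\<^sub>v w) \<and> (\<forall>v\<in>V0. w \<bullet> (A *\<^sub>v v) = 0) \<and>
        l * (w \<bullet> (A *\<^sub>v w)) = (A *\<^sub>v w) \<bullet> (H *\<^sub>v (A *\<^sub>v w))))"
proof -
  note P = coarse_projection[OF A co]
  have H: "spsd n H" unfolding H_eq by (rule one_level_form(3)[OF loc])
  have inv: "invertible_mat H" using loc unfolding local_setting_def H_eq by blast
  have pos: "0 < w \<bullet> (A *\<^sub>v w)" if "w \<in> carrier_vec n" "w \<noteq> 0\<^sub>v n" for w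
    using A that unfolding spd_def by blast
  note orth = coarse_orthogonal[OF A co]
  show "\<exists>l. z = complex_of_real l \<and> (l = 0 \<or>
      (\<exists>w \<in> carrier_vec n. 0 < w \<bullet> (A *\<^sub>v w) \<and> (\<forall>v\<in>V0. w \<bullet> (A *\<^sub>v v) = 0) \<and>
        l * (w \<bullet> (A *\<^sub>v w)) = (A *\<^sub>v w) \<bullet> (H *\<^sub>v (A *\<^sub>v w))))"
    if z: "z \<in> eigvals (H * A * P0 n A R0)"
    using preconditioned_eigval[OF A P(1,2,3) H inv z] pos orth by blast
  show "\<exists>l. z = complex_of_real l \<and> (l = 1 \<or>
      (\<exists>w \<in> carrier_vec n. 0 < w \<bullet> (A *\<^sub>v w) \<and> (\<forall>v\<in>V0. w \<bullet> (A *\<^sub>v v) = 0) \<and>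
        l * (w \<bullet> (A *\<^sub>v w)) = (A *\<^sub>v w) \<bullet> (H *\<^sub>v (A *\<^sub>v w))))"
    if z: "z \<in> eigvals (hybrid n A R0 H * A)"
    using hybrid_eigval[OF A P(1,2,3) H P(6,7) z[unfolded hybrid_def]] pos orth by blast
qed

lemma upper_spectral_bound:
  assumes A: "spd n A" and loc: "local_setting n N ns R At" and co: "coarse_setting n V0 R0"
    and H_eq: "H = one_level n N R At" and col: "coloring_constant A N ns R Nc" and c: "c > 0"
    and dec: "\<And>s u. s \<in> {1..N} \<Longrightarrow> u \<in> carrier_vec (ns s) \<Longrightarrow> \<exists>u' \<in> carrier_vec (ns s).
      (R s)\<^sup>T *\<^sub>v (u - u') \<in> V0 \<and>
      c * (((R s)\<^sup>T *\<^sub>v u') \<bullet> (A *\<^sub>v ((R s)\<^sup>T *\<^sub>v u'))) \<le> u \<bullet> (At s *\<^sub>v u)"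
  shows "(\<forall>z \<in> eigvals (H * A * P0 n A R0). z \<in> \<real> \<and> Re z \<le> real Nc * inverse c) \<and>
    (\<forall>z \<in> eigvals (hybrid n A R0 H * A). z \<in> \<real> \<and> Re z \<le> max 1 (real Nc * inverse c))"
proof -
  have bound: "l \<le> real Nc * inverse c"
    if w: "w \<in> carrier_vec n" "0 < w \<bullet> (A *\<^sub>v w)" "\<forall>v\<in>V0. w \<bullet> (A *\<^sub>v v) = 0"
      "l * (w \<bullet> (A *\<^sub>v w)) = (A *\<^sub>v w) \<bullet> (H *\<^sub>v (A *\<^sub>v w))" for l w
  proof -
    have "(A *\<^sub>v w) \<bullet> (H *\<^sub>v (A *\<^sub>v w)) \<le> real Nc * inverse c * (w \<bullet> (A *\<^sub>v w))"
      unfolding H_eq by (rule upper_bound[OF A loc col w(1) bspec[OF w(3)] c dec])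
    thus ?thesis using w(2) unfolding w(4)[symmetric] by (rule mult_right_le_imp_le)
  qed
  \<comment> \<open>Nonnegativity of the bound takes care of the trivial eigenvalue 0.\<close>
  have nn: "0 \<le> real Nc * inverse c" using c by simp
  show ?thesis
  proof (intro conjI ballI)
    fix z assume "z \<in> eigvals (H * A * P0 n A R0)"
    from two_level_eigvals(1)[OF A loc co H_eq this] bound nn
    obtain l where "z = complex_of_real l" "l \<le> real Nc * inverse c" by blast
    thus "z \<in> \<real>" "Re z \<le> real Nc * inverse c" by simp_all
  next
    fix z assume "z \<in> eigvals (hybrid n A R0 H * A)"
    from two_level_eigvals(2)[OF A loc co H_eq this] bound
    obtain l where "z = complex_of_real l" "l = 1 \<or> l \<le> real Nc * inverse c" by blast
    thus "z \<in> \<real>" "Re z \<le> max 1 (real Nc * inverse c)" by auto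
  qed
qed

lemma lower_spectral_bound:
  assumes A: "spd n A" and loc: "local_setting n N ns R At" and co: "coarse_setting n V0 R0"
    and H_eq: "H = one_level n N R At" and spl: "splitting n A N ns R M Nh"
    and Nh: "Nh > 0" and tau: "\<tau> > 0"
    and ker: "\<And>s k. s \<in> {1..N} \<Longrightarrow> k \<in> carrier_vec (ns s) \<Longrightarrow> At s *\<^sub>v k = 0\<^sub>v (ns s) \<Longrightarrow>
      (R s)\<^sup>T *\<^sub>v k \<in> V0 \<or> k = 0\<^sub>v (ns s)"
    and dec: "\<And>s y. s \<in> {1..N} \<Longrightarrow> y \<in> carrier_vec (ns s) \<Longrightarrow> \<exists>y' \<in> carrier_vec (ns s).
      (R s)\<^sup>T *\<^sub>v (y - y') \<in> V0 \<and> y' \<bullet> (At s *\<^sub>v y') \<le> \<tau> * (y \<bullet> (M s *\<^sub>v y))"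
  shows "(\<forall>z \<in> eigvals (H * A * P0 n A R0). z = 0 \<or> (z \<in> \<real> \<and> inverse (\<tau> * Nh) \<le> Re z)) \<and>
    (\<forall>z \<in> eigvals (hybrid n A R0 H * A). z \<in> \<real> \<and> min 1 (inverse (\<tau> * Nh)) \<le> Re z)"
proof -
  have bound: "inverse (\<tau> * Nh) \<le> l"
    if w: "w \<in> carrier_vec n" "0 < w \<bullet> (A *\<^sub>v w)" "\<forall>v\<in>V0. w \<bullet> (A *\<^sub>v v) = 0"
      "l * (w \<bullet> (A *\<^sub>v w)) = (A *\<^sub>v w) \<bullet> (H *\<^sub>v (A *\<^sub>v w))" for l w
  proof -
    have "w \<bullet> (A *\<^sub>v w) \<le> \<tau> * Nh * ((A *\<^sub>v w) \<bullet> (H *\<^sub>v (A *\<^sub>v w)))"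
      unfolding H_eq by (rule lower_bound[OF A loc spl w(1) bspec[OF w(3)] Nh tau ker dec])
    hence "1 * (w \<bullet> (A *\<^sub>v w)) \<le> (\<tau> * Nh * l) * (w \<bullet> (A *\<^sub>v w))" unfolding w(4)[symmetric] by (simp add: mult.assoc)
    hence "1 \<le> \<tau> * Nh * l" using w(2) by (rule mult_right_le_imp_le)
    moreover have "0 < \<tau> * Nh" using tau Nh by simp
    ultimately show ?thesis by (simp add: inverse_eq_divide pos_divide_le_eq mult.commute)
  qed
  show ?thesis
  proof (intro conjI ballI)
    fix z assume "z \<in> eigvals (H * A * P0 n A R0)"
    from two_level_eigvals(1)[OF A loc co H_eq this] bound
    obtain l where "z = complex_of_real l" "l = 0 \<or> inverse (\<tau> * Nh) \<le> l" by blast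
    thus "z = 0 \<or> z \<in> \<real> \<and> inverse (\<tau> * Nh) \<le> Re z" by auto
  next
    fix z assume "z \<in> eigvals (hybrid n A R0 H * A)"
    from two_level_eigvals(2)[OF A loc co H_eq this] bound
    obtain l where "z = complex_of_real l" "l = 1 \<or> inverse (\<tau> * Nh) \<le> l" by blast
    thus "z \<in> \<real>" "min 1 (inverse (\<tau> * Nh)) \<le> Re z" by auto
  qed
qed

theorem theorem9:
  fixes n N Nc :: nat and ns :: "nat \<Rightarrow> nat" and A R0 H :: "real mat"
    and R At :: "nat \<Rightarrow> real mat" and V0 :: "real vec set" and \<tau> :: real
  assumes A_spd: "spd n A"
    and loc: "local_setting n N ns R At"
    and coarse: "coarse_setting n V0 R0"
    and H_eq: "H = one_level n N R At"
    and coloring: "coloring_constant A N ns R Nc"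
    and tau: "\<tau> > 0"
  shows
    "(\<forall>Cs. C_sharp_constant n A N ns R At Cs \<longrightarrow>
        (\<forall>s \<in> {1..N}. (\<lambda>y. (R s)\<^sup>T *\<^sub>v y) ` mat_kernel (At s) \<subseteq> V0) \<longrightarrow>
        (\<forall>z \<in> eigvals (H * A * P0 n A R0). z \<in> \<real> \<and> Re z \<le> real Nc * inverse Cs) \<and>
        (\<forall>z \<in> eigvals (hybrid n A R0 H * A). z \<in> \<real> \<and> Re z \<le> max 1 (real Nc * inverse Cs)))
     \<and>
     ((\<forall>s \<in> {1..N}. (\<lambda>y. (R s)\<^sup>T *\<^sub>v y) ` Y_L \<tau> (At s) (R s * A * (R s)\<^sup>T) \<subseteq> V0) \<longrightarrow>
        (\<forall>z \<in> eigvals (H * A * P0 n A R0). z \<in> \<real> \<and> Re z \<le> real Nc * inverse \<tau>) \<and>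
        (\<forall>z \<in> eigvals (hybrid n A R0 H * A). z \<in> \<real> \<and> Re z \<le> max 1 (real Nc * inverse \<tau>)))
     \<and>
     (\<forall>M Nh. (\<forall>s \<in> {1..N}. spsd (ns s) (M s)) \<longrightarrow> Nh > 0 \<longrightarrow>
        splitting n A N ns R M Nh \<or> pou_splitting n A N ns R M Nh \<longrightarrow>
        (\<forall>s \<in> {1..N}.
           (invertible_mat (At s) \<and>
              (\<lambda>y. (R s)\<^sup>T *\<^sub>v y) ` Y_L (inverse \<tau>) (M s) (At s) \<subseteq> V0)
           \<or>
           (invertible_mat (M s) \<and>
              (\<lambda>y. (R s)\<^sup>T *\<^sub>v y) ` (mat_kernel (At s) + Y_H \<tau> (At s) (M s)) \<subseteq> V0)
           \<or>
           (\<exists>W \<in> carrier_mat (ns s) (vec_space.rank (ns s) (M s)).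
              orthonormal_basis_mat (ns s) (mat_range (M s)) W \<and>
              (\<lambda>y. (R s)\<^sup>T *\<^sub>v y) ` (mat_kernel (At s) + mat_kernel (M s) +
                 (\<lambda>y. W *\<^sub>v y) ` Y_H \<tau> (W\<^sup>T * At s * W) (W\<^sup>T * M s * W)) \<subseteq> V0)) \<longrightarrow>
        (\<forall>z \<in> eigvals (H * A * P0 n A R0). z = 0 \<or> (z \<in> \<real> \<and> inverse (\<tau> * Nh) \<le> Re z)) \<and>
        (\<forall>z \<in> eigvals (hybrid n A R0 H * A). z \<in> \<real> \<and> min 1 (inverse (\<tau> * Nh)) \<le> Re z))"
proof (rule conjI[OF _ conjI], goal_cases)
  case 1
  show ?case
  proof (intro allI impI, goal_cases)
    case (1 Cs)
    have "Cs > 0" using 1(1) unfolding C_sharp_constant_def by blast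
    thus ?case
      by (rule upper_spectral_bound[OF A_spd loc coarse H_eq coloring _ natural_local[OF loc A_spd 1(1,2)]])
  qed
next
  case 2
  show ?case
  proof (rule impI, goal_cases)
    case 1
    show ?case
      by (rule upper_spectral_bound[OF A_spd loc coarse H_eq coloring tau geneo_max_local[OF loc A_spd tau 1]])
  qed
next
  case 3
  show ?case
  proof (intro allI impI, goal_cases)
    case (1 M Nh)
    note L = local_settingD[OF loc]
    have spl: "splitting n A N ns R M Nh" using 1(3) pou_splitting_splitting[OF loc] by blast
    show ?case
    \<comment> \<open>The three alternatives may vary with the subdomain, so the kernel condition
      and the local replacement are checked for each \<open>s\<close> separately.\<close>
    proof (rule lower_spectral_bound[OF A_spd loc coarse H_eq spl 1(2) tau])
      fix s k assume s: "s \<in> {1..N}" and k: "k \<in> carrier_vec (ns s)" "At s *\<^sub>v k = 0\<^sub>v (ns s)"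
      have Atc: "At s \<in> carrier_mat (ns s) (ns s)" using L(3)[OF s] by (simp add: spsd_def)
      have kk: "k \<in> mat_kernel (At s)" using k Atc unfolding mat_kernel_def by auto
      have Mc: "M s \<in> carrier_mat (ns s) (ns s)" using 1(1) s unfolding spsd_def by blast
      \<comment> \<open>Alternative (a) makes the kernel of \<open>At s\<close> trivial, while (b)
        and (c) place it in \<open>V0\<close>.\<close>
      from 1(4) s consider (a) "invertible_mat (At s)"
        | (b) "(\<lambda>y. (R s)\<^sup>T *\<^sub>v y) ` (mat_kernel (At s) + Y_H \<tau> (At s) (M s)) \<subseteq> V0"
        | (c) W where "W \<in> carrier_mat (ns s) (vec_space.rank (ns s) (M s))"
          "(\<lambda>y. (R s)\<^sup>T *\<^sub>v y) ` (mat_kernel (At s) + mat_kernel (M s) +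
                 (\<lambda>y. W *\<^sub>v y) ` Y_H \<tau> (W\<^sup>T * At s * W) (W\<^sup>T * M s * W)) \<subseteq> V0"
        by blast
      thus "(R s)\<^sup>T *\<^sub>v k \<in> V0 \<or> k = 0\<^sub>v (ns s)"
      proof cases
        case a
        have "k \<bullet> (At s *\<^sub>v k) = 0" unfolding k(2) using k(1) by simp
        thus ?thesis using spd_eq_zero_iff[OF invertible_spsd_spd[OF L(3)[OF s] a] k(1)] by blast
      next
        case b
        \<comment> \<open>Padding \<open>k\<close> with a zero from the other summand shows that its
          extension belongs to \<open>V0\<close>; the next case pads twice.\<close>
        have "k + 0\<^sub>v (ns s) \<in> mat_kernel (At s) + Y_H \<tau> (At s) (M s)"
          by (rule set_plus_intro[OF kk Y_H_zero[OF Atc]])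
        hence "(R s)\<^sup>T *\<^sub>v (k + 0\<^sub>v (ns s)) \<in> V0" using b by blast
        thus ?thesis using k(1) by simp
      next
        case (c W)
        let ?r = "vec_space.rank (ns s) (M s)"
        have "W\<^sup>T * At s * W \<in> carrier_mat ?r ?r" using c(1) Atc by simp
        hence "W *\<^sub>v 0\<^sub>v ?r \<in> (\<lambda>y. W *\<^sub>v y) ` Y_H \<tau> (W\<^sup>T * At s * W) (W\<^sup>T * M s * W)"
          by (intro imageI Y_H_zero)
        moreover have "0\<^sub>v (ns s) \<in> mat_kernel (M s)"
          using Mc mult_mat_zero_vec[OF Mc] unfolding mat_kernel_def by auto
        ultimately have "k + 0\<^sub>v (ns s) + W *\<^sub>v 0\<^sub>v ?r \<in> mat_kernel (At s) + mat_kernel (M s) +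
            (\<lambda>y. W *\<^sub>v y) ` Y_H \<tau> (W\<^sup>T * At s * W) (W\<^sup>T * M s * W)"
          by (intro set_plus_intro kk)
        hence "(R s)\<^sup>T *\<^sub>v (k + 0\<^sub>v (ns s) + W *\<^sub>v 0\<^sub>v ?r) \<in> V0" using c(2) by blast
        thus ?thesis unfolding mult_mat_zero_vec[OF c(1)] using k(1) by simp
      qed
    next
      fix s and y :: "real vec" assume s: "s \<in> {1..N}" and y: "y \<in> carrier_vec (ns s)"
      have M: "spsd (ns s) (M s)" using 1(1) s by blast
      note a = geneo_min_local_a[OF L(3)[OF s] M tau _ _ y, of "(R s)\<^sup>T" V0]
      note b = geneo_min_local_b[OF L(3)[OF s] M tau _ _ y, of "(R s)\<^sup>T" V0]
      note c = geneo_min_local_c[OF L(3)[OF s] M tau _ _ _ y, of _ _ "(R s)\<^sup>T" V0]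
      from bspec[OF 1(4) s] show "\<exists>y' \<in> carrier_vec (ns s).
          (R s)\<^sup>T *\<^sub>v (y - y') \<in> V0 \<and> y' \<bullet> (At s *\<^sub>v y') \<le> \<tau> * (y \<bullet> (M s *\<^sub>v y))"
        using a b c by (elim disjE conjE bexE)
    qed
  qed
qed

end
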